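(* Let $\Phi:\mathbb R^2\to\mathbb C$, $(t,s)\mapsto\Phi(t,s)$. Then $\Phi$ is the covariance function of a second order weakly harmonizable Hausdorff stochastic process $(X_t)_{t\in\mathbb R}$ if and only if $\Phi$ is an analytic positive definite kernel on $\mathbb R^2$ such that the double sequence $$\mu_{nm}=i^{n}(-i)^{m}\,\frac{\partial^{n+m}\Phi}{\partial t^n\,\partial s^m}(0,0),\qquad n,m\in\mathbb N_0,$$ is weakly bounded. Moreover, in this case, the stochastic process $X_t$ is weakly stationary if and only if the sequence $(\mu_{nm})$ is Hänkel, i.e. $\mu_{n+1,m}=\mu_{n,m+1}$ for all $n,m\in\mathbb N_0$.
   Context: Processes: a second order stochastic process is a strongly continuous map $X:\mathbb R\to L^2(\Omega,P)$, $X_t:=X(t)$, where $(\Omega,\Sigma,P)$ is a probability space and $L^2(\Omega,P)$ is complex. Its covariance function is $C(t,t')=E(\overline{X_t}\,X_{t'})$. The process is weakly stationary if there is a continuous function $F$ of one real variable with $C(t,t')=F(t'-t)$ for all $t,t'$. Bimeasures: a bimeasure $\gamma$ on $\mathrm{Bo}(\mathbb R)\times\mathrm{Bo}(\mathbb R)$ is a complex function $\gamma(A,B)$ of pairs of Borel sets that is $\sigma$-additive in each argument separately. Bimeasures here are regular (each $\gamma(A,\cdot)$ and $\gamma(\cdot,B)$ is a Radon measure) and of finite semivariation, i.e. $\sup|\sum_{j,k}a_jb_k\gamma(A_j,B_k)|<\infty$ over all finite Borel partitions $\{A_j\}$, $\{B_k\}$ of $\mathbb R$ and scalars with $|a_j|,|b_k|\le1$.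 The integral $\int f\otimes g\,\gamma$ of bounded Borel functions $f,g$ is the bilinear expression equal to $\gamma(A,B)$ for $f=\chi_A$, $g=\chi_B$, extended to simple functions by bilinearity and to bounded Borel functions by uniform limits. $\gamma$ is positive definite if $\gamma(A,B)=\overline{\gamma(B,A)}$ and $\sum_{i,j=1}^r\bar a_ia_j\gamma(A_i,A_j)\ge0$ for all complex numbers $a_i$ and Borel sets $A,B,A_i$. Weakly harmonizable: $X_t$ is weakly harmonizable if there is a positive definite bimeasure $\gamma$ with $$C(t,t')=\int_{\mathbb R\times\mathbb R}e^{-its}\otimes e^{it's'}\,\gamma(ds,ds')\qquad\text{for all }t,t'\in\mathbb R.$$ For such a process there is an $L^2(\Omega,P)$-valued $\sigma$-additive (stochastic) measure $\xi$ on $\mathrm{Bo}(\mathbb R)$ with $X_t=\int_{\mathbb R}e^{its}\,\xi(ds)$ and $\langle\xi(A),\xi(B)\rangle_{L^2(\Omega,P)}=\gamma(A,B)$ for all Borel $A,B$ (inner product conjugate-linear in the first argument). A weakly harmonizable process is called Hausdorff if the support of $\xi$ is contained in $[0,1]$, i.e. $\xi(A)=0$ for all Borel $A$ with $A\cap[0,1]=\emptyset$. Kernels: $\Phi$ is a positive definite kernel if $\sum_{l,k=1}^r\bar a_la_k\Phi(t_l,t_k)\ge0$ for all $r\ge1$, $a_1,\dots,a_r\in\mathbb C$, $t_1,\dots,t_r\in\mathbb R$; analytic means real-analytic on $\mathbb R^2$. Weakly bounded: for a complex double sequence $(\mu_{nm})_{n,m\in\mathbb N_0}$, let $L$ be the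 bilinear functional on polynomials in one variable with complex coefficients with $L(t^n,t^m)=\mu_{nm}$, and for $0\le m_1\le k_1$, $0\le m_2\le k_2$ set $$\lambda_{(k_1,k_2;m_1,m_2)}=L\Big(\tbinom{k_1}{m_1}t^{m_1}(1-t)^{k_1-m_1},\ \tbinom{k_2}{m_2}t^{m_2}(1-t)^{k_2-m_2}\Big).$$ The sequence is weakly bounded if there is $C>0$ such that $\big|\sum_{m_1=0}^{k_1}\sum_{m_2=0}^{k_2}a_{m_1}b_{m_2}\lambda_{(k_1,k_2;m_1,m_2)}\big|\le C$ for all $k_1,k_2\in\mathbb N_0$ and all numbers $a_{m_1},b_{m_2}$ with $|a_{m_1}|\le1$, $|b_{m_2}|\le1$. *)

theory Defs
  imports
    "HOL-Probability.Probability"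
    "HOL-Computational_Algebra.Polynomial"
begin

subsection \<open>Square-integrable random variables and second order processes\<close>

text \<open>
  Elements of the complex space \<open>L\<^sup>2(\<Omega>, P)\<close> are represented by measurable functions on the
  probability space; equality of classes is equality almost everywhere.
\<close>

definition L2_fun :: "'w measure \<Rightarrow> ('w \<Rightarrow> complex) \<Rightarrow> bool" where
  "L2_fun M f \<longleftrightarrow> f \<in> borel_measurable M \<and> integrable M (\<lambda>\<omega>. (cmod (f \<omega>))\<^sup>2)"

definition L2_inner :: "'w measure \<Rightarrow> ('w \<Rightarrow> complex) \<Rightarrow> ('w \<Rightarrow> complex) \<Rightarrow> complex" where
  "L2_inner M f g = (\<integral>\<omega>. cnj (f \<omega>) * g \<omega> \<partial>M)"

definition L2_tendsto ::
    "'w measure \<Rightarrow> ('i \<Rightarrow> 'w \<Rightarrow> complex) \<Rightarrow> ('w \<Rightarrow> complex) \<Rightarrow> 'i filter \<Rightarrow> bool" where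
  "L2_tendsto M f g F \<longleftrightarrow> ((\<lambda>i. \<integral>\<omega>. (cmod (f i \<omega> - g \<omega>))\<^sup>2 \<partial>M) \<longlongrightarrow> 0) F"

definition second_order_process :: "'w measure \<Rightarrow> (real \<Rightarrow> 'w \<Rightarrow> complex) \<Rightarrow> bool" where
  "second_order_process M X \<longleftrightarrow>
     prob_space M \<and> (\<forall>t. L2_fun M (X t)) \<and> (\<forall>t. L2_tendsto M X (X t) (at t))"

definition covariance ::
    "'w measure \<Rightarrow> (real \<Rightarrow> 'w \<Rightarrow> complex) \<Rightarrow> real \<Rightarrow> real \<Rightarrow> complex" where
  "covariance M X t t' = L2_inner M (X t) (X t')"

definition weakly_stationary :: "'w measure \<Rightarrow> (real \<Rightarrow> 'w \<Rightarrow> complex) \<Rightarrow> bool" where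
  "weakly_stationary M X \<longleftrightarrow>
     (\<exists>F :: real \<Rightarrow> complex. continuous_on UNIV F \<and> (\<forall>t t'. covariance M X t t' = F (t' - t)))"


subsection \<open>Bimeasures\<close>

text \<open>
  Set functions are total; only their values on Borel sets matter.
\<close>

definition sigma_additive :: "(real set \<Rightarrow> complex) \<Rightarrow> bool" where
  "sigma_additive \<mu> \<longleftrightarrow>
     (\<forall>A :: nat \<Rightarrow> real set. range A \<subseteq> sets borel \<longrightarrow> disjoint_family A \<longrightarrow>
        (\<lambda>n. \<mu> (A n)) sums \<mu> (\<Union>n. A n))"

text \<open>
  Inner regularity by compact sets of the total variation \<open>\<bar>\<mu>\<bar>\<close>: the bound on the sums over
  finite disjoint families \<open>\<P>\<close> of Borel subsets of \<open>A - K\<close> says \<open>\<bar>\<mu>\<bar>(A - K) \<le> e\<close>.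
\<close>

definition radon_regular :: "(real set \<Rightarrow> complex) \<Rightarrow> bool" where
  "radon_regular \<mu> \<longleftrightarrow>
     (\<forall>A \<in> sets borel. \<forall>e > 0. \<exists>K. compact K \<and> K \<subseteq> A \<and>
        (\<forall>\<P>. finite \<P> \<longrightarrow> disjoint \<P> \<longrightarrow> (\<forall>B \<in> \<P>. B \<in> sets borel \<and> B \<subseteq> A - K) \<longrightarrow>
           (\<Sum>B\<in>\<P>. cmod (\<mu> B)) \<le> e))"

definition finite_semivariation :: "(real set \<Rightarrow> real set \<Rightarrow> complex) \<Rightarrow> bool" where
  "finite_semivariation \<gamma> \<longleftrightarrow>
     (\<exists>C. \<forall>\<A> \<B> a b.
        finite \<A> \<and> partition_on UNIV \<A> \<and> \<A> \<subseteq> sets borel \<and>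
        finite \<B> \<and> partition_on UNIV \<B> \<and> \<B> \<subseteq> sets borel \<and>
        (\<forall>A\<in>\<A>. cmod (a A) \<le> 1) \<and> (\<forall>B\<in>\<B>. cmod (b B) \<le> 1) \<longrightarrow>
        cmod (\<Sum>A\<in>\<A>. \<Sum>B\<in>\<B>. a A * b B * \<gamma> A B) \<le> C)"

definition bimeasure :: "(real set \<Rightarrow> real set \<Rightarrow> complex) \<Rightarrow> bool" where
  "bimeasure \<gamma> \<longleftrightarrow>
     (\<forall>A \<in> sets borel. sigma_additive (\<lambda>B. \<gamma> A B) \<and> radon_regular (\<lambda>B. \<gamma> A B)) \<and>
     (\<forall>B \<in> sets borel. sigma_additive (\<lambda>A. \<gamma> A B) \<and> radon_regular (\<lambda>A. \<gamma> A B)) \<and>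
     finite_semivariation \<gamma>"

definition positive_definite_bimeasure :: "(real set \<Rightarrow> real set \<Rightarrow> complex) \<Rightarrow> bool" where
  "positive_definite_bimeasure \<gamma> \<longleftrightarrow>
     bimeasure \<gamma> \<and>
     (\<forall>A \<in> sets borel. \<forall>B \<in> sets borel. \<gamma> A B = cnj (\<gamma> B A)) \<and>
     (\<forall>(r::nat) (a :: nat \<Rightarrow> complex) A. (\<forall>i<r. A i \<in> sets borel) \<longrightarrow>
        (\<Sum>i<r. \<Sum>j<r. cnj (a i) * a j * \<gamma> (A i) (A j)) \<in> \<real>\<^sub>\<ge>\<^sub>0)"

definition simple_bimeasure_integral ::
    "(real set \<Rightarrow> real set \<Rightarrow> complex) \<Rightarrow> (real \<Rightarrow> complex) \<Rightarrow> (real \<Rightarrow> complex) \<Rightarrow> complex" where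
  "simple_bimeasure_integral \<gamma> p q =
     (\<Sum>a\<in>range p. \<Sum>b\<in>range q. a * b * \<gamma> (p -` {a}) (q -` {b}))"

text \<open>
  The integral of \<open>f \<otimes> g\<close> is the limit along simple functions converging uniformly to \<open>f\<close> and
  \<open>g\<close> (which are therefore bounded and Borel). Finite semivariation makes the limit exist and be
  independent of the approximating sequences.
\<close>

definition has_bimeasure_integral ::
    "(real set \<Rightarrow> real set \<Rightarrow> complex) \<Rightarrow> (real \<Rightarrow> complex) \<Rightarrow> (real \<Rightarrow> complex) \<Rightarrow> complex \<Rightarrow> bool"
  where
  "has_bimeasure_integral \<gamma> f g I \<longleftrightarrow>
     (\<exists>p q. (\<forall>n. simple_function borel (p n)) \<and> uniform_limit UNIV p f sequentially \<and>
            (\<forall>n. simple_function borel (q n)) \<and> uniform_limit UNIV q g sequentially \<and>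
            (\<lambda>n. simple_bimeasure_integral \<gamma> (p n) (q n)) \<longlonglongrightarrow> I)"


subsection \<open>Stochastic measures\<close>

definition stochastic_measure :: "'w measure \<Rightarrow> (real set \<Rightarrow> 'w \<Rightarrow> complex) \<Rightarrow> bool" where
  "stochastic_measure M \<xi> \<longleftrightarrow>
     (\<forall>A \<in> sets borel. L2_fun M (\<xi> A)) \<and>
     (\<forall>A :: nat \<Rightarrow> real set. range A \<subseteq> sets borel \<longrightarrow> disjoint_family A \<longrightarrow>
        L2_tendsto M (\<lambda>n \<omega>. \<Sum>k<n. \<xi> (A k) \<omega>) (\<xi> (\<Union>k. A k)) sequentially)"

definition simple_stochastic_integral ::
    "(real set \<Rightarrow> 'w \<Rightarrow> complex) \<Rightarrow> (real \<Rightarrow> complex) \<Rightarrow> 'w \<Rightarrow> complex" where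
  "simple_stochastic_integral \<xi> p \<omega> = (\<Sum>a\<in>range p. a * \<xi> (p -` {a}) \<omega>)"

definition has_stochastic_integral ::
    "'w measure \<Rightarrow> (real set \<Rightarrow> 'w \<Rightarrow> complex) \<Rightarrow> (real \<Rightarrow> complex) \<Rightarrow> ('w \<Rightarrow> complex) \<Rightarrow> bool"
  where
  "has_stochastic_integral M \<xi> f Y \<longleftrightarrow>
     L2_fun M Y \<and>
     (\<exists>p. (\<forall>n. simple_function borel (p n)) \<and> uniform_limit UNIV p f sequentially \<and>
          L2_tendsto M (\<lambda>n. simple_stochastic_integral \<xi> (p n)) Y sequentially)"


subsection \<open>Weakly harmonizable and Hausdorff processes\<close>

definition spectral_bimeasure ::
    "'w measure \<Rightarrow> (real \<Rightarrow> 'w \<Rightarrow> complex) \<Rightarrow> (real set \<Rightarrow> real set \<Rightarrow> complex) \<Rightarrow> bool" where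
  "spectral_bimeasure M X \<gamma> \<longleftrightarrow>
     positive_definite_bimeasure \<gamma> \<and>
     (\<forall>t t'. has_bimeasure_integral \<gamma>
        (\<lambda>s. exp (- (\<i> * of_real t * of_real s))) (\<lambda>s'. exp (\<i> * of_real t' * of_real s'))
        (covariance M X t t'))"

definition weakly_harmonizable :: "'w measure \<Rightarrow> (real \<Rightarrow> 'w \<Rightarrow> complex) \<Rightarrow> bool" where
  "weakly_harmonizable M X \<longleftrightarrow> second_order_process M X \<and> (\<exists>\<gamma>. spectral_bimeasure M X \<gamma>)"

definition spectral_stochastic_measure ::
    "'w measure \<Rightarrow> (real \<Rightarrow> 'w \<Rightarrow> complex) \<Rightarrow> (real set \<Rightarrow> real set \<Rightarrow> complex) \<Rightarrow>
     (real set \<Rightarrow> 'w \<Rightarrow> complex) \<Rightarrow> bool" where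
  "spectral_stochastic_measure M X \<gamma> \<xi> \<longleftrightarrow>
     stochastic_measure M \<xi> \<and>
     (\<forall>t. has_stochastic_integral M \<xi> (\<lambda>s. exp (\<i> * of_real t * of_real s)) (X t)) \<and>
     (\<forall>A \<in> sets borel. \<forall>B \<in> sets borel. L2_inner M (\<xi> A) (\<xi> B) = \<gamma> A B)"

text \<open>
  The process determines \<open>\<gamma>\<close>, and \<open>\<xi>\<close> up to null sets, so the existential quantifier
  just names them.
\<close>

definition hausdorff_process :: "'w measure \<Rightarrow> (real \<Rightarrow> 'w \<Rightarrow> complex) \<Rightarrow> bool" where
  "hausdorff_process M X \<longleftrightarrow>
     weakly_harmonizable M X \<and>
     (\<exists>\<gamma> \<xi>. spectral_bimeasure M X \<gamma> \<and> spectral_stochastic_measure M X \<gamma> \<xi> \<and>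
        (\<forall>A \<in> sets borel. A \<inter> {0..1} = {} \<longrightarrow> (AE \<omega> in M. \<xi> A \<omega> = 0)))"


subsection \<open>Kernels\<close>

definition positive_definite_kernel :: "(real \<Rightarrow> real \<Rightarrow> complex) \<Rightarrow> bool" where
  "positive_definite_kernel \<Phi> \<longleftrightarrow>
     (\<forall>r \<ge> (1::nat). \<forall>(a :: nat \<Rightarrow> complex) (t :: nat \<Rightarrow> real).
        (\<Sum>l<r. \<Sum>k<r. cnj (a l) * a k * \<Phi> (t l) (t k)) \<in> \<real>\<^sub>\<ge>\<^sub>0)"

definition analytic_kernel :: "(real \<Rightarrow> real \<Rightarrow> complex) \<Rightarrow> bool" where
  "analytic_kernel \<Phi> \<longleftrightarrow>
     (\<forall>t0 s0. \<exists>(c :: nat \<Rightarrow> nat \<Rightarrow> complex). \<exists>r > 0.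
        \<forall>t s. \<bar>t - t0\<bar> < r \<longrightarrow> \<bar>s - s0\<bar> < r \<longrightarrow>
          ((\<lambda>(j, k). c j k * of_real ((t - t0) ^ j * (s - s0) ^ k)) has_sum \<Phi> t s) UNIV)"

definition partial_fst :: "(real \<Rightarrow> real \<Rightarrow> complex) \<Rightarrow> real \<Rightarrow> real \<Rightarrow> complex" where
  "partial_fst \<Phi> t s = vector_derivative (\<lambda>x. \<Phi> x s) (at t)"

definition partial_snd :: "(real \<Rightarrow> real \<Rightarrow> complex) \<Rightarrow> real \<Rightarrow> real \<Rightarrow> complex" where
  "partial_snd \<Phi> t s = vector_derivative (\<lambda>y. \<Phi> t y) (at s)"

definition kernel_moment :: "(real \<Rightarrow> real \<Rightarrow> complex) \<Rightarrow> nat \<Rightarrow> nat \<Rightarrow> complex" where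
  "kernel_moment \<Phi> n m =
     \<i> ^ n * (- \<i>) ^ m * (partial_fst ^^ n) ((partial_snd ^^ m) \<Phi>) 0 0"


subsection \<open>Weakly bounded double sequences\<close>

definition moment_functional ::
    "(nat \<Rightarrow> nat \<Rightarrow> complex) \<Rightarrow> complex poly \<Rightarrow> complex poly \<Rightarrow> complex" where
  "moment_functional \<mu> p q =
     (\<Sum>i\<le>degree p. \<Sum>j\<le>degree q. coeff p i * coeff q j * \<mu> i j)"

definition bernstein_poly :: "nat \<Rightarrow> nat \<Rightarrow> complex poly" where
  "bernstein_poly k m = of_nat (k choose m) * [:0, 1:] ^ m * [:1, -1:] ^ (k - m)"

definition bernstein_moment ::
    "(nat \<Rightarrow> nat \<Rightarrow> complex) \<Rightarrow> nat \<Rightarrow> nat \<Rightarrow> nat \<Rightarrow> nat \<Rightarrow> complex" where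
  "bernstein_moment \<mu> k1 k2 m1 m2 =
     moment_functional \<mu> (bernstein_poly k1 m1) (bernstein_poly k2 m2)"

definition weakly_bounded :: "(nat \<Rightarrow> nat \<Rightarrow> complex) \<Rightarrow> bool" where
  "weakly_bounded \<mu> \<longleftrightarrow>
     (\<exists>C > 0. \<forall>k1 k2. \<forall>a b :: nat \<Rightarrow> complex.
        (\<forall>m\<le>k1. cmod (a m) \<le> 1) \<longrightarrow> (\<forall>m\<le>k2. cmod (b m) \<le> 1) \<longrightarrow>
        cmod (\<Sum>m1\<le>k1. \<Sum>m2\<le>k2. a m1 * b m2 * bernstein_moment \<mu> k1 k2 m1 m2) \<le> C)"

definition hankel :: "(nat \<Rightarrow> nat \<Rightarrow> complex) \<Rightarrow> bool" where
  "hankel \<mu> \<longleftrightarrow> (\<forall>n m. \<mu> (Suc n) m = \<mu> n (Suc m))"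

end

theory Submission
  imports Defs
begin

text \<open>
  A bimeasure supported in the unit interval defines a bilinear form \<open>B\<close> on bounded Borel functions
  with \<open>\<bar>B f g\<bar> \<le> C * sup \<bar>f\<bar> * sup \<bar>g\<bar>\<close>, suprema over the unit interval. Expanding both
  exponentials in \<open>B (e\<^bsup>-itu\<^esup>) (e\<^bsup>isu\<^esup>)\<close> shows that the covariance is entire with moments
  \<open>\<mu> n m = B (u\<^sup>n) (u\<^sup>m)\<close>; weak boundedness follows since the Bernstein polynomials are a partition
  of unity, and the Hankel condition says that \<open>B f g\<close> depends only on the product of \<open>f\<close> and \<open>g\<close>.

  Conversely, repeatedly passing to the Schur complement of a positive definite power series at the
  origin and dividing by \<open>t * s\<close> yields a Cholesky factorization \<open>\<mu> n m = \<langle>w n, w m\<rangle>\<close> in the sequence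
  space. Weak boundedness makes \<open>u\<^sup>n \<mapsto> w n\<close> a bounded operator from polynomials with the supremum
  norm. Each coordinate is the weak limit of its discrete Bernstein measures, and together these form
  a vector measure \<open>\<xi>\<close>, countably additive in norm because vectors of disjoint sets have bounded square
  sum. The process is the Fourier transform of \<open>\<xi>\<close>; its covariance has the same Taylor coefficients at
  the origin as the given kernel, hence equals it by analytic continuation along lines.
\<close>

subsection \<open>Kernels given by double power series\<close>

text \<open>Positive definiteness is given only at real points, whereas a Hilbert space is wanted
  from the Taylor coefficients; eliminating at the origin works with real points throughout and
  takes no limits of difference quotients. The factorization is triangular: \<open>w n\<close> has
  only its first \<open>n + 1\<close> coordinates nonzero, so inner products of moments are finite
  sums and estimates can be made on the first \<open>N\<close> coordinates with a bound free of
  \<open>N\<close>. Measures are built one coordinate at a time, since scalar Helly selection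
  applies there. What ties the coordinates together is a square sum bound, which weak boundedness
  gives for Bernstein sums by testing with \<open>cnj a\<close> and \<open>a\<close>. It survives
  the weak limit for continuous functions, and Lusin approximation carries it to bounded Borel
  functions. Both directions share one abstract bilinear form, so that the kernel, its moments and
  the Hankel criterion are treated once. The sample space is the natural numbers with a geometric
  law, weighted so that the sequence space embeds isometrically.\<close>

definition double_power_series ::
    "(real \<Rightarrow> real \<Rightarrow> complex) \<Rightarrow> (nat \<Rightarrow> nat \<Rightarrow> complex) \<Rightarrow> real \<Rightarrow> bool" where
  "double_power_series f c r \<longleftrightarrow> r > 0 \<and>
     (\<forall>t s. \<bar>t\<bar> < r \<longrightarrow> \<bar>s\<bar> < r \<longrightarrow>
        ((\<lambda>(j, k). c j k * of_real (t ^ j * s ^ k)) has_sum f t s) UNIV)"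

text \<open>Translating the kernel moves every base point to the origin, so that termwise calculus
  is needed at one centre only.\<close>

lemma analytic_kernel_iff:
  "analytic_kernel \<Phi> \<longleftrightarrow>
     (\<forall>t0 s0. \<exists>c r. double_power_series (\<lambda>t s. \<Phi> (t0 + t) (s0 + s)) c r)"
proof
  assume A: "analytic_kernel \<Phi>"
  show "\<forall>t0 s0. \<exists>c r. double_power_series (\<lambda>t s. \<Phi> (t0 + t) (s0 + s)) c r"
  proof (intro allI)
    fix t0 s0
    obtain c r where r: "r > 0"
      and c: "\<And>t s. \<bar>t - t0\<bar> < r \<Longrightarrow> \<bar>s - s0\<bar> < r \<Longrightarrow>
          ((\<lambda>(j, k). c j k * of_real ((t - t0) ^ j * (s - s0) ^ k)) has_sum \<Phi> t s) UNIV"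
      using A unfolding analytic_kernel_def by blast
    have "double_power_series (\<lambda>t s. \<Phi> (t0 + t) (s0 + s)) c r"
      unfolding double_power_series_def
    proof (intro conjI r allI impI)
      fix t s assume "\<bar>t\<bar> < r" "\<bar>s\<bar> < r"
      then show "((\<lambda>(j, k). c j k * of_real (t ^ j * s ^ k)) has_sum \<Phi> (t0 + t) (s0 + s)) UNIV"
        using c[of "t0 + t" "s0 + s"] by simp
    qed
    then show "\<exists>c r. double_power_series (\<lambda>t s. \<Phi> (t0 + t) (s0 + s)) c r" by blast
  qed
next
  assume A: "\<forall>t0 s0. \<exists>c r. double_power_series (\<lambda>t s. \<Phi> (t0 + t) (s0 + s)) c r"
  show "analytic_kernel \<Phi>"
    unfolding analytic_kernel_def
  proof (intro allI)
    fix t0 s0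
    obtain c r where c: "double_power_series (\<lambda>t s. \<Phi> (t0 + t) (s0 + s)) c r"
      using A by blast
    then have r: "r > 0" by (simp add: double_power_series_def)
    have "((\<lambda>(j, k). c j k * of_real ((t - t0) ^ j * (s - s0) ^ k)) has_sum \<Phi> t s) UNIV"
      if "\<bar>t - t0\<bar> < r" "\<bar>s - s0\<bar> < r" for t s
    proof -
      have "((\<lambda>(j, k). c j k * of_real ((t - t0) ^ j * (s - s0) ^ k))
               has_sum \<Phi> (t0 + (t - t0)) (s0 + (s - s0))) UNIV"
        using c that unfolding double_power_series_def by blast
      then show ?thesis by simp
    qed
    then show "\<exists>c. \<exists>r>0. \<forall>t s. \<bar>t - t0\<bar> < r \<longrightarrow> \<bar>s - s0\<bar> < r \<longrightarrow>
          ((\<lambda>(j, k). c j k * of_real ((t - t0) ^ j * (s - s0) ^ k)) has_sum \<Phi> t s) UNIV"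
      using r by blast
  qed
qed

lemma has_sum_prod_swap:
  "((\<lambda>(j, k). f j k) has_sum S) (UNIV :: ('a \<times> 'b) set) \<longleftrightarrow>
   ((\<lambda>(k, j). f j k) has_sum S) (UNIV :: ('b \<times> 'a) set)"
  using has_sum_swap[where f = "\<lambda>(j, k). f j k" and A = "UNIV :: 'a set" and B = "UNIV :: 'b set"]
  by simp

lemma double_power_series_swap:
  assumes "double_power_series f c r"
  shows "double_power_series (\<lambda>t s. f s t) (\<lambda>j k. c k j) r"
proof -
  have "((\<lambda>(j, k). c k j * of_real (t ^ j * s ^ k)) has_sum f s t) UNIV"
    if "\<bar>t\<bar> < r" "\<bar>s\<bar> < r" for t s
  proof -
    have "((\<lambda>(j, k). c j k * of_real (s ^ j * t ^ k)) has_sum f s t) UNIV"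
      using assms that unfolding double_power_series_def by blast
    then show ?thesis
      by (subst (asm) has_sum_prod_swap) (simp add: mult.commute)
  qed
  then show ?thesis using assms unfolding double_power_series_def by blast
qed

lemma double_power_series_at_0:
  assumes "double_power_series f c r"
  shows "f 0 0 = c 0 0"
proof -
  have 1: "((\<lambda>(j, k). c j k * of_real (0 ^ j * 0 ^ k)) has_sum f 0 0) UNIV"
    using assms[unfolded double_power_series_def, THEN conjunct2, rule_format, of 0 0]
      assms[unfolded double_power_series_def, THEN conjunct1] by simp
  have "((\<lambda>(j, k). c j k * of_real (0 ^ j * 0 ^ k)) has_sum
          (\<Sum>(j, k)\<in>{(0, 0)}. c j k * of_real (0 ^ j * 0 ^ k))) UNIV"
    by (rule has_sum_finite_neutralI[OF _ _ _ refl]) (auto simp: zero_power)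
  with has_sum_unique[OF 1] show ?thesis by simp
qed

lemma summable_on_norm_complex:
  fixes f :: "'a \<times> 'b \<Rightarrow> complex"
  assumes "f summable_on UNIV"
  shows "(\<lambda>p. norm (f p)) summable_on UNIV"
  using assms by (simp add: summable_on_iff_abs_summable_on_complex)

text \<open>For fixed \<open>t\<close> the double series regroups into a power series in the second
  variable with coefficients \<open>a k\<close>, which may be differentiated termwise. What remains
  is unconditional summability of the differentiated double series, by comparison with the given one
  at a slightly larger second coordinate.\<close>

lemma double_power_series_deriv_snd:
  assumes f: "double_power_series f c r" and t: "\<bar>t\<bar> < r" and s: "\<bar>s\<bar> < r"
  shows "(\<lambda>y. f t y) differentiable (at s)"
    and "((\<lambda>(j, k). of_nat (Suc k) * c j (Suc k) * of_real (t ^ j * s ^ k))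
            has_sum partial_snd f t s) UNIV"
proof -
  have hs: "((\<lambda>(k, j). c j k * of_real (t ^ j * y ^ k)) has_sum f t y) UNIV" if "\<bar>y\<bar> < r" for y
    using f t that unfolding double_power_series_def
    by (subst (asm) has_sum_prod_swap) auto
  \<comment> \<open>Room between \<open>\<bar>s\<bar>\<close> and \<open>r\<close> pays for the
    factor \<open>Suc k\<close> that differentiation produces.\<close>
  obtain s' where s': "\<bar>s\<bar> < s'" "s' < r" using dense[OF s] by blast
  have s'0: "s' > 0" using s'(1) by simp
  have sum': "(\<lambda>(k, j). c j k * of_real (t ^ j * s' ^ k)) summable_on UNIV"
    using hs[of s'] s' s'0 by (auto simp: summable_on_def)
  define a where "a k = infsum (\<lambda>j. c j k * of_real (t ^ j)) UNIV" for k
  have a: "((\<lambda>j. c j k * of_real (t ^ j)) has_sum a k) UNIV" for k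
  proof -
    have "(\<lambda>(k, j). c j k * of_real (t ^ j * s' ^ k)) summable_on Sigma UNIV (\<lambda>_. UNIV)"
      using sum' by simp
    from summable_on_SigmaD1[OF this, of k]
    have "(\<lambda>j. c j k * of_real (t ^ j * s' ^ k)) summable_on UNIV" by simp
    then have "(\<lambda>j. (c j k * of_real (t ^ j * s' ^ k)) * of_real (inverse (s' ^ k))) summable_on UNIV"
      by (rule summable_on_cmult_left)
    also have "(\<lambda>j. (c j k * of_real (t ^ j * s' ^ k)) * of_real (inverse (s' ^ k)))
                = (\<lambda>j. c j k * of_real (t ^ j))"
      using s'0 by (auto simp: field_simps)
    finally show ?thesis unfolding a_def by simp
  qed
  have a_sums: "(\<lambda>k. a k * of_real y ^ k) sums f t y" if y: "\<bar>y\<bar> < r" for y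
  proof -
    have "((\<lambda>k. a k * of_real (y ^ k)) has_sum f t y) UNIV"
    proof (rule has_sum_SigmaD[where B = "\<lambda>_. UNIV"])
      show "((\<lambda>(k, j). c j k * of_real (t ^ j * y ^ k)) has_sum f t y) (Sigma UNIV (\<lambda>_. UNIV))"
        using hs[OF y] by simp
      show "((\<lambda>j. case (k, j) of (k, j) \<Rightarrow> c j k * of_real (t ^ j * y ^ k))
              has_sum a k * of_real (y ^ k)) UNIV" for k
        using has_sum_cmult_left[OF a[of k], of "of_real (y ^ k)"] by (simp add: mult_ac)
    qed
    from has_sum_imp_sums[OF this] show ?thesis by simp
  qed
  have a_summable: "summable (\<lambda>k. a k * z ^ k)" if z: "norm z < r" for z :: complex
  proof -
    obtain y where y: "norm z < y" "y < r" using dense[OF z] by blast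
    then have "summable (\<lambda>k. a k * of_real y ^ k)"
      using a_sums[of y] norm_ge_zero[of z] by (auto intro: sums_summable)
    moreover have "norm z < norm (of_real y :: complex)" using y by simp
    ultimately show ?thesis by (rule powser_inside)
  qed
  define d where "d = (\<Sum>k. diffs a k * of_real s ^ k)"
  have "((\<lambda>z. \<Sum>k. a k * z ^ k) has_field_derivative d) (at (of_real s))"
    unfolding d_def by (rule termdiffs_strong'[where K = r]) (use a_summable s in auto)
  then have D: "((\<lambda>y. \<Sum>k. a k * of_real y ^ k) has_vector_derivative d) (at s)"
    by (rule has_vector_derivative_real_field)
  have D': "((\<lambda>y. f t y) has_vector_derivative d) (at s)"
  proof (rule has_vector_derivative_transform_within_open[OF D])
    show "open {-r<..<r}" "s \<in> {-r<..<r}" using s by auto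
    show "(\<Sum>k. a k * of_real y ^ k) = f t y" if "y \<in> {-r<..<r}" for y
      using a_sums[of y] that by (auto simp: sums_iff abs_less_iff)
  qed
  then show "(\<lambda>y. f t y) differentiable (at s)"
    by (auto simp: has_vector_derivative_def differentiable_def)
  have d: "partial_snd f t s = d"
    unfolding partial_snd_def using D' by (rule vector_derivative_at)
  \<comment> \<open>The factor is absorbed since \<open>k * q ^ k\<close> tends to 0 for
    \<open>q = \<bar>s\<bar> / s'\<close>.\<close>
  have form_bound: "\<exists>K. \<forall>k. of_nat (Suc k) * \<bar>s\<bar> ^ k \<le> K * s' ^ Suc k"
  proof -
    have "(\<lambda>k. of_nat k * (\<bar>s\<bar> / s') ^ k) \<longlonglongrightarrow> 0"
      using s' s'0 by (intro powser_times_n_limit_0) auto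
    moreover have "(\<lambda>k. (\<bar>s\<bar> / s') ^ k) \<longlonglongrightarrow> 0"
      using s' s'0 by (intro LIMSEQ_realpow_zero) auto
    ultimately have "(\<lambda>k. of_nat k * (\<bar>s\<bar> / s') ^ k + (\<bar>s\<bar> / s') ^ k) \<longlonglongrightarrow> 0 + 0"
      by (rule tendsto_add)
    then have "Bseq (\<lambda>k. of_nat k * (\<bar>s\<bar> / s') ^ k + (\<bar>s\<bar> / s') ^ k)"
      by (intro convergent_imp_Bseq convergentI)
    then obtain K where K: "\<And>k. norm (of_nat k * (\<bar>s\<bar> / s') ^ k + (\<bar>s\<bar> / s') ^ k) \<le> K"
      unfolding Bseq_def by blast
    have "of_nat (Suc k) * \<bar>s\<bar> ^ k \<le> K / s' * s' ^ Suc k" for k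
    proof -
      have "(of_nat k * (\<bar>s\<bar> / s') ^ k + (\<bar>s\<bar> / s') ^ k) \<le> K"
        using K[of k] by (simp add: abs_le_iff)
      then have "(of_nat k * (\<bar>s\<bar> / s') ^ k + (\<bar>s\<bar> / s') ^ k) * s' ^ k \<le> K * s' ^ k"
        using s'0 by (intro mult_right_mono) auto
      also have "(of_nat k * (\<bar>s\<bar> / s') ^ k + (\<bar>s\<bar> / s') ^ k) * s' ^ k = of_nat (Suc k) * \<bar>s\<bar> ^ k"
        using s'0 by (simp add: power_divide ring_distribs)
      finally show ?thesis using s'0 by simp
    qed
    then show ?thesis by blast
  qed
  then obtain K where K: "\<And>k. of_nat (Suc k) * \<bar>s\<bar> ^ k \<le> K * s' ^ Suc k" by blast
  have sumabs: "(\<lambda>(k, j). norm (c j k * of_real (t ^ j * s' ^ k))) summable_on UNIV"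
    using summable_on_norm_complex[OF sum'] by (simp add: case_prod_unfold)
  have "(\<lambda>(k, j). norm (c j (Suc k) * of_real (t ^ j * s' ^ Suc k))) summable_on UNIV"
  proof -
    have inj: "inj_on (\<lambda>(k :: nat, j :: nat). (Suc k, j)) UNIV" by (auto simp: inj_on_def)
    have "(\<lambda>(k, j). norm (c j k * of_real (t ^ j * s' ^ k))) summable_on
             range (\<lambda>(k :: nat, j :: nat). (Suc k, j))"
      using sumabs by (rule summable_on_subset) auto
    then show ?thesis
      by (subst (asm) summable_on_reindex[OF inj]) (simp add: o_def case_prod_unfold)
  qed
  then have "(\<lambda>p. K * (case p of (k, j) \<Rightarrow> norm (c j (Suc k) * of_real (t ^ j * s' ^ Suc k)))) summable_on UNIV"
    by (rule summable_on_cmult_right)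
  then have "(\<lambda>p. norm (case p of (k, j) \<Rightarrow> of_nat (Suc k) * c j (Suc k) * complex_of_real (t ^ j * s ^ k))) summable_on UNIV"
  proof (rule Infinite_Sum.abs_summable_on_comparison_test')
    fix p :: "nat \<times> nat"
    obtain k j where p: "p = (k, j)" by (cases p)
    have "norm (of_nat (Suc k) * c j (Suc k) * complex_of_real (t ^ j * s ^ k)) =
          (norm (c j (Suc k)) * \<bar>t\<bar> ^ j) * (of_nat (Suc k) * \<bar>s\<bar> ^ k)"
      by (simp add: norm_mult norm_power power_abs del: of_nat_Suc)
    also have "\<dots> \<le> (norm (c j (Suc k)) * \<bar>t\<bar> ^ j) * (K * s' ^ Suc k)"
      by (intro mult_left_mono K) auto
    also have "\<dots> = K * norm (c j (Suc k) * of_real (t ^ j * s' ^ Suc k))"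
      using s'0 by (simp add: norm_mult norm_power power_abs)
    finally show "norm (case p of (k, j) \<Rightarrow> of_nat (Suc k) * c j (Suc k) * complex_of_real (t ^ j * s ^ k))
       \<le> K * (case p of (k, j) \<Rightarrow> norm (c j (Suc k) * of_real (t ^ j * s' ^ Suc k)))"
      by (simp add: p)
  qed
  then have "(\<lambda>(k, j). of_nat (Suc k) * c j (Suc k) * complex_of_real (t ^ j * s ^ k)) summable_on UNIV"
    by (rule abs_summable_summable)
  then obtain S where S: "((\<lambda>(k, j). of_nat (Suc k) * c j (Suc k) * complex_of_real (t ^ j * s ^ k)) has_sum S) UNIV"
    by (auto simp: summable_on_def)
  \<comment> \<open>Summing over \<open>j\<close> first turns the double series into the termwise
    derivative, which identifies its sum.\<close>
  have "((\<lambda>k. diffs a k * of_real (s ^ k)) has_sum S) UNIV"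
  proof (rule has_sum_SigmaD[where B = "\<lambda>_. UNIV"])
    show "((\<lambda>(k, j). of_nat (Suc k) * c j (Suc k) * complex_of_real (t ^ j * s ^ k)) has_sum S)
             (Sigma UNIV (\<lambda>_. UNIV))"
      using S by simp
    show "((\<lambda>j. case (k, j) of (k, j) \<Rightarrow> of_nat (Suc k) * c j (Suc k) * complex_of_real (t ^ j * s ^ k))
              has_sum diffs a k * of_real (s ^ k)) UNIV" for k
      using has_sum_cmult_left[OF a[of "Suc k"], of "of_nat (Suc k) * of_real (s ^ k)"]
      by (simp add: mult_ac diffs_def del: of_nat_Suc)
  qed
  then have "(\<lambda>k. diffs a k * of_real s ^ k) sums S"
    using has_sum_imp_sums[where f = "\<lambda>k. diffs a k * of_real (s ^ k)"] by simp
  then have "S = d" unfolding d_def by (simp add: sums_iff)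
  with S show "((\<lambda>(j, k). of_nat (Suc k) * c j (Suc k) * of_real (t ^ j * s ^ k))
            has_sum partial_snd f t s) UNIV"
    unfolding d by (subst has_sum_prod_swap) simp
qed

lemma double_power_series_partial_snd:
  assumes "double_power_series f c r"
  shows "double_power_series (partial_snd f) (\<lambda>j k. of_nat (Suc k) * c j (Suc k)) r"
  using assms double_power_series_deriv_snd(2)[OF assms]
  unfolding double_power_series_def by blast

lemma double_power_series_partial_fst:
  assumes "double_power_series f c r"
  shows "double_power_series (partial_fst f) (\<lambda>j k. of_nat (Suc j) * c (Suc j) k) r"
proof -
  have "partial_fst f = (\<lambda>t s. partial_snd (\<lambda>t s. f s t) s t)"
    by (simp add: partial_fst_def partial_snd_def fun_eq_iff)
  then show ?thesis
    using double_power_series_swap[OF double_power_series_partial_snd[OF double_power_series_swap[OF assms]]]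
    by simp
qed

lemma double_power_series_partials:
  assumes "double_power_series f c r"
  shows "double_power_series ((partial_fst ^^ n) ((partial_snd ^^ m) f))
           (\<lambda>j k. fact (j + n) / fact j * (fact (k + m) / fact k) * c (j + n) (k + m)) r"
proof -
  have snd: "double_power_series ((partial_snd ^^ m) f)
               (\<lambda>j k. fact (k + m) / fact k * c j (k + m)) r"
  proof (induction m)
    case 0
    then show ?case using assms by simp
  next
    case (Suc m)
    have "(\<lambda>j k. of_nat (Suc k) * (fact (Suc k + m) / fact (Suc k) * c j (Suc k + m)))
          = (\<lambda>j k. fact (k + Suc m) / fact k * c j (k + Suc m))"
      by (auto simp: fun_eq_iff field_simps simp del: of_nat_Suc)
    with double_power_series_partial_snd[OF Suc] show ?case by simp
  qed
  show ?thesis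
  proof (induction n)
    case 0
    then show ?case using snd by simp
  next
    case (Suc n)
    have "(\<lambda>j k. of_nat (Suc j) * (fact (Suc j + n) / fact (Suc j) * (fact (k + m) / fact k) * c (Suc j + n) (k + m)))
          = (\<lambda>j k. fact (j + Suc n) / fact j * (fact (k + m) / fact k) * c (j + Suc n) (k + m))"
      by (auto simp: fun_eq_iff field_simps simp del: of_nat_Suc)
    with double_power_series_partial_fst[OF Suc] show ?case by simp
  qed
qed

text \<open>Evaluating the differentiated series at the origin leaves its constant term. From here
  on a condition on moments is a condition on Taylor coefficients.\<close>

lemma kernel_moment_eq:
  assumes "double_power_series f c r"
  shows "kernel_moment f n m = \<i> ^ n * (- \<i>) ^ m * (fact n * fact m * c n m)"
  unfolding kernel_moment_def
  using double_power_series_at_0[OF double_power_series_partials[OF assms, of n m]] by simp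

text \<open>The coefficients are recovered from the kernel through its moments, since the powers of
  \<open>\<i>\<close> and the factorials do not vanish.\<close>

lemma double_power_series_unique:
  assumes "double_power_series f c r" "double_power_series f d r'"
  shows "c = d"
proof (intro ext)
  fix n m
  have "\<i> ^ n * (- \<i>) ^ m * (fact n * fact m * c n m) = \<i> ^ n * (- \<i>) ^ m * (fact n * fact m * d n m)"
    using kernel_moment_eq[OF assms(1)] kernel_moment_eq[OF assms(2)] by metis
  then show "c n m = d n m" by (simp del: power_minus_Bit0)
qed

lemma double_power_series_diff:
  assumes "double_power_series f c r" "double_power_series g d r'"
  shows "double_power_series (\<lambda>t s. f t s - g t s) (\<lambda>j k. c j k - d j k) (min r r')"
  unfolding double_power_series_def
proof (intro conjI allI impI)
  show "min r r' > 0" using assms by (auto simp: double_power_series_def)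
  fix t s assume "\<bar>t\<bar> < min r r'" "\<bar>s\<bar> < min r r'"
  then have "((\<lambda>(j, k). c j k * of_real (t ^ j * s ^ k)) has_sum f t s) UNIV"
    "((\<lambda>(j, k). d j k * of_real (t ^ j * s ^ k)) has_sum g t s) UNIV"
    using assms unfolding double_power_series_def by auto
  from has_sum_add[OF this(1) has_sum_cmult_right[OF this(2), of "-1"]]
  show "((\<lambda>(j, k). (c j k - d j k) * of_real (t ^ j * s ^ k)) has_sum (f t s - g t s)) UNIV"
    by (simp add: case_prod_unfold algebra_simps)
qed

section \<open>The identity theorem along lines through the origin\<close>

lemma double_power_series_line:
  assumes f: "double_power_series f c r"
  shows "\<exists>d. \<forall>x. \<bar>x * a\<bar> < r \<longrightarrow> \<bar>x * b\<bar> < r \<longrightarrow>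
           (\<lambda>n. d n * of_real x ^ n) sums f (x * a) (x * b)"
proof -
  \<comment> \<open>On a line the double series becomes a one-variable series after collecting the
    terms of total degree \<open>n = j + k\<close>.\<close>
  define d where "d n = (\<Sum>j\<le>n. c j (n - j) * of_real (a ^ j * b ^ (n - j)))" for n
  have "(\<lambda>n. d n * of_real x ^ n) sums f (x * a) (x * b)"
    if "\<bar>x * a\<bar> < r" "\<bar>x * b\<bar> < r" for x
  proof -
    have "((\<lambda>(j, k). c j k * of_real ((x * a) ^ j * (x * b) ^ k)) has_sum f (x * a) (x * b)) UNIV"
      using f that unfolding double_power_series_def by blast
    then have "((\<lambda>(n, j). c j (n - j) * of_real ((x * a) ^ j * (x * b) ^ (n - j)))
                 has_sum f (x * a) (x * b)) (Sigma UNIV (\<lambda>n. {..n}))"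
      by (rule iffD1[OF has_sum_reindex_bij_witness
            [where i = "\<lambda>(n, j). (j, n - j)" and j = "\<lambda>(j, k). (j + k, j)"], rotated -1])
         auto
    then have sum: "(d' has_sum f (x * a) (x * b)) UNIV"
      if "\<And>n. d' n = (\<Sum>j\<le>n. c j (n - j) * of_real ((x * a) ^ j * (x * b) ^ (n - j)))" for d'
    proof (rule has_sum_SigmaD)
      show "((\<lambda>j. case (n, j) of (n, j) \<Rightarrow> c j (n - j) * of_real ((x * a) ^ j * (x * b) ^ (n - j)))
              has_sum d' n) {..n}" for n
        unfolding that by (simp add: has_sum_finite)
    qed
    have "d n * of_real x ^ n
        = (\<Sum>j\<le>n. c j (n - j) * of_real ((x * a) ^ j * (x * b) ^ (n - j)))" for n
      unfolding d_def sum_distrib_right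
    proof (rule sum.cong[OF refl])
      fix j assume "j \<in> {..n}"
      then have "x ^ n = x ^ j * x ^ (n - j)" by (simp flip: power_add)
      then show "c j (n - j) * of_real (a ^ j * b ^ (n - j)) * of_real x ^ n
          = c j (n - j) * of_real ((x * a) ^ j * (x * b) ^ (n - j))"
        by (simp add: power_mult_distrib mult_ac flip: of_real_power)
    qed
    then show ?thesis by (intro has_sum_imp_sums sum)
  qed
  then show ?thesis by blast
qed

text \<open>If some coefficient is nonzero, let \<open>d n\<close> be the first one. The series is
  \<open>x ^ n * H x\<close> with \<open>H\<close> continuous and \<open>H 0 = d n\<close>, so it
  has no zeros near 0 other than possibly 0 itself.\<close>

lemma real_powser_zero_if_accumulates:
  fixes d :: "nat \<Rightarrow> complex"
  assumes r: "r > 0" and g: "\<And>x. \<bar>x\<bar> < r \<Longrightarrow> (\<lambda>n. d n * of_real x ^ n) sums g x"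
    and acc: "\<And>e. e > 0 \<Longrightarrow> \<exists>x. x \<noteq> 0 \<and> \<bar>x\<bar> < e \<and> g x = 0"
  shows "\<forall>x. \<bar>x\<bar> < r \<longrightarrow> g x = 0"
proof -
  have summ: "summable (\<lambda>n. d n * z ^ n)" if z: "norm z < r" for z :: complex
  proof -
    obtain y where y: "norm z < y" "y < r" using dense[OF z] by blast
    then have "summable (\<lambda>n. d n * of_real y ^ n)"
      using g[of y] norm_ge_zero[of z] by (auto intro: sums_summable)
    moreover have "norm z < norm (of_real y :: complex)" using y by simp
    ultimately show ?thesis by (rule powser_inside)
  qed
  define G where "G z = (\<Sum>n. d n * z ^ n)" for z
  have G: "(\<lambda>n. d n * z ^ n) sums G z" if "norm z < r" for z
    unfolding G_def using summ[OF that] by (rule summable_sums)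
  have Gg: "G (of_real x) = g x" if "\<bar>x\<bar> < r" for x
    using G[of "of_real x"] g[OF that] that sums_unique2 by fastforce
  have "d n = 0" for n
  proof (induction n rule: less_induct)
    case (less n)
    show ?case
    proof (rule ccontr)
      assume n: "d n \<noteq> 0"
      define H where "H z = (\<Sum>k. d (k + n) * z ^ k)" for z
      have "summable (\<lambda>k. d (k + n) * of_real (r / 2) ^ k)"
      proof -
        have "summable (\<lambda>k. d (k + n) * of_real (r / 2) ^ (k + n))"
          using summ[of "of_real (r / 2)"] r by (subst summable_iff_shift) auto
        then have "summable (\<lambda>k. (d (k + n) * of_real (r / 2) ^ (k + n)) * inverse (of_real (r / 2) ^ n))"
          by (rule summable_mult2)
        also have "(\<lambda>k. (d (k + n) * of_real (r / 2) ^ (k + n)) * inverse (of_real (r / 2) ^ n))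
                    = (\<lambda>k. d (k + n) * of_real (r / 2) ^ k)"
          using r by (auto simp: power_add field_simps)
        finally show ?thesis .
      qed
      then have "isCont (\<lambda>z. \<Sum>k. d (k + n) * z ^ k) 0"
        by (rule isCont_powser) (use r in simp)
      then have "isCont H 0" unfolding H_def .
      moreover have "H 0 = d n" unfolding H_def by (subst powser_zero) simp
      ultimately obtain e where e: "e > 0" "\<And>z. dist 0 z < e \<Longrightarrow> H z \<noteq> 0"
        using continuous_at_avoid[of 0 H 0] n by auto
      obtain x where x: "x \<noteq> 0" "\<bar>x\<bar> < min e r" "g x = 0" using acc[of "min e r"] e r by auto
      have sx: "summable (\<lambda>n. d n * of_real x ^ n)" using summ[of "of_real x"] x by simp
      have "0 = (\<Sum>k. d (k + n) * of_real x ^ (k + n)) + (\<Sum>i<n. d i * of_real x ^ i)"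
        using suminf_split_initial_segment[OF sx, of n] Gg[of x] x by (simp add: G_def)
      also have "(\<Sum>i<n. d i * of_real x ^ i) = 0" using less by simp
      also have "(\<Sum>k. d (k + n) * of_real x ^ (k + n)) = (\<Sum>k. of_real x ^ n * (d (k + n) * of_real x ^ k))"
        by (simp add: power_add mult_ac)
      also have "\<dots> = of_real x ^ n * H (of_real x)"
        unfolding H_def
      proof (rule suminf_mult)
        have "summable (\<lambda>k. d (k + n) * of_real x ^ (k + n))" using sx by (subst summable_iff_shift)
        then have "summable (\<lambda>k. (d (k + n) * of_real x ^ (k + n)) * inverse (of_real x ^ n))"
          by (rule summable_mult2)
        also have "(\<lambda>k. (d (k + n) * of_real x ^ (k + n)) * inverse (of_real x ^ n))
                    = (\<lambda>k. d (k + n) * of_real x ^ k)"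
          using x by (auto simp: power_add field_simps)
        finally show "summable (\<lambda>k. d (k + n) * of_real x ^ k)" .
      qed
      finally show False using e(2)[of "of_real x"] x by simp
    qed
  qed
  then have "G z = 0" for z unfolding G_def by simp
  with Gg show ?thesis by simp
qed

text \<open>The difference of the kernels along the line from the origin through
  \<open>(a, b)\<close> is a real-analytic function \<open>g\<close> of one variable. The set of
  points around which \<open>g\<close> vanishes is open and closed, and equal moments put 0 into
  it.\<close>

theorem analytic_kernel_eqI:
  assumes P: "analytic_kernel \<Phi>" and Q: "analytic_kernel \<Psi>"
    and eq: "\<And>n m. kernel_moment \<Phi> n m = kernel_moment \<Psi> n m"
  shows "\<Phi> = \<Psi>"
proof (intro ext)
  fix a b :: real
  define D where "D t s = \<Phi> t s - \<Psi> t s" for t s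
  define g where "g x = D (x * a) (x * b)" for x
  have D: "\<exists>c r. double_power_series (\<lambda>t s. D (t0 + t) (s0 + s)) c r" for t0 s0
    using P Q double_power_series_diff unfolding analytic_kernel_iff D_def by blast
  have local: "\<exists>d e. e > 0 \<and> (\<forall>x. \<bar>x\<bar> < e \<longrightarrow> (\<lambda>n. d n * of_real x ^ n) sums g (x0 + x))" for x0
  proof -
    obtain c r where c: "double_power_series (\<lambda>t s. D (x0 * a + t) (x0 * b + s)) c r" using D by blast
    then have r: "r > 0" by (simp add: double_power_series_def)
    obtain d where d: "\<And>x. \<bar>x * a\<bar> < r \<Longrightarrow> \<bar>x * b\<bar> < r \<Longrightarrow>
           (\<lambda>n. d n * of_real x ^ n) sums D (x0 * a + x * a) (x0 * b + x * b)"
      using double_power_series_line[OF c, of a b] by blast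
    \<comment> \<open>This radius keeps both \<open>x * a\<close> and \<open>x * b\<close> below
      \<open>r\<close>; the summand 1 prevents division by zero when
      \<open>a = b = 0\<close>.\<close>
    define e where "e = r / (1 + \<bar>a\<bar> + \<bar>b\<bar>)"
    have e: "e > 0" using r by (simp add: e_def add_pos_nonneg)
    have "(\<lambda>n. d n * of_real x ^ n) sums g (x0 + x)" if "\<bar>x\<bar> < e" for x
    proof -
      have x: "\<bar>x\<bar> * (1 + \<bar>a\<bar> + \<bar>b\<bar>) < r"
        using that unfolding e_def by (simp add: pos_less_divide_eq add_pos_nonneg)
      have "\<bar>x\<bar> * \<bar>a\<bar> \<le> \<bar>x\<bar> * (1 + \<bar>a\<bar> + \<bar>b\<bar>)" "\<bar>x\<bar> * \<bar>b\<bar> \<le> \<bar>x\<bar> * (1 + \<bar>a\<bar> + \<bar>b\<bar>)"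
        by (intro mult_left_mono; simp)+
      with x have "\<bar>x * a\<bar> < r" "\<bar>x * b\<bar> < r" by (auto simp: abs_mult)
      from d[OF this] show ?thesis by (simp add: g_def algebra_simps)
    qed
    with e show ?thesis by blast
  qed
  define Z where "Z = {x. \<forall>\<^sub>F y in nhds x. g y = 0}"
  have oZ: "open Z"
    unfolding Z_def open_dist
    by (metis (mono_tags, lifting) eventually_eventually eventually_nhds_metric mem_Collect_eq)
  have cZ: "closed Z"
    unfolding closed_limpt
  proof (intro allI impI)
    \<comment> \<open>Zeros accumulate at a limit point of \<open>Z\<close>, so the local expansion
      there vanishes identically.\<close>
    fix x0 assume lim: "x0 islimpt Z"
    obtain d e where e: "e > 0" and d: "\<And>x. \<bar>x\<bar> < e \<Longrightarrow> (\<lambda>n. d n * of_real x ^ n) sums g (x0 + x)"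
      using local[of x0] by blast
    have "\<forall>x. \<bar>x\<bar> < e \<longrightarrow> g (x0 + x) = 0"
    proof (rule real_powser_zero_if_accumulates[OF e d])
      fix e' :: real assume "e' > 0"
      then obtain y where y: "y \<in> Z" "y \<noteq> x0" "dist y x0 < e'"
        using lim unfolding islimpt_approachable by blast
      then have "g y = 0" unfolding Z_def using eventually_nhds_x_imp_x by fastforce
      with y show "\<exists>x. x \<noteq> 0 \<and> \<bar>x\<bar> < e' \<and> g (x0 + x) = 0"
        by (intro exI[of _ "y - x0"]) (auto simp: dist_real_def)
    qed
    then have "\<forall>y. dist y x0 < e \<longrightarrow> g y = 0"
      by (metis add.commute diff_add_cancel dist_real_def)
    then show "x0 \<in> Z" unfolding Z_def eventually_nhds_metric using e by blast
  qed
  have "0 \<in> Z"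
  proof -
    obtain c r where c: "double_power_series \<Phi> c r"
      using P[unfolded analytic_kernel_iff, rule_format, of 0 0] by auto
    obtain d r' where d: "double_power_series \<Psi> d r'"
      using Q[unfolded analytic_kernel_iff, rule_format, of 0 0] by auto
    have cd: "c n m = d n m" for n m
      using eq[of n m] unfolding kernel_moment_eq[OF c] kernel_moment_eq[OF d] by simp
    have r: "min r r' > 0" using c d by (auto simp: double_power_series_def)
    have D0: "D t s = 0" if "\<bar>t\<bar> < min r r'" "\<bar>s\<bar> < min r r'" for t s
    proof -
      have "((\<lambda>(j, k). (c j k - d j k) * of_real (t ^ j * s ^ k)) has_sum D t s) UNIV"
        using double_power_series_diff[OF c d] that unfolding double_power_series_def D_def by blast
      then have "((\<lambda>_. 0) has_sum D t s) (UNIV :: (nat \<times> nat) set)"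
        by (simp add: cd case_prod_unfold)
      then show ?thesis using infsumI by fastforce
    qed
    have lim: "((\<lambda>x. \<bar>x * q\<bar>) \<longlongrightarrow> 0) (nhds 0)" for q :: real
      by (auto intro!: tendsto_eq_intros filterlim_ident)
    have "\<forall>\<^sub>F x in nhds 0. \<bar>x * a\<bar> < min r r'" "\<forall>\<^sub>F x in nhds 0. \<bar>x * b\<bar> < min r r'"
      using order_tendstoD(2)[OF lim r] by blast+
    then have "\<forall>\<^sub>F x in nhds 0. g x = 0"
      by eventually_elim (simp add: g_def D0)
    then show ?thesis by (simp add: Z_def)
  qed
  then have "Z = UNIV" using connected_clopen[of "UNIV :: real set"] oZ cZ by auto
  then have "g 1 = 0" unfolding Z_def using eventually_nhds_x_imp_x by fastforce
  then show "\<Phi> a b = \<Psi> a b" by (simp add: g_def D_def)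
qed

subsection \<open>Bounded bilinear forms on functions on the unit interval\<close>

text \<open>Boundedness is asked only on the unit interval, which admits powers and exponentials
  with any complex rate, while measurability is kept on the whole line.\<close>

definition bounded_borel :: "(real \<Rightarrow> complex) \<Rightarrow> bool" where
  "bounded_borel f \<longleftrightarrow> f \<in> borel_measurable borel \<and> (\<exists>b. \<forall>x\<in>{0..1}. cmod (f x) \<le> b)"

lemma bounded_borel_continuous:
  assumes "continuous_on UNIV f" shows "bounded_borel f"
proof -
  have "bounded (f ` {0..1})"
    by (intro compact_imp_bounded compact_continuous_image continuous_on_subset[OF assms]) auto
  then show ?thesis
    using borel_measurable_continuous_onI[OF assms] unfolding bounded_borel_def bounded_iff by blast
qed

lemma bounded_borelD:
  assumes "bounded_borel f"
  obtains b where "b \<ge> 0" "\<And>x. x \<in> {0..1} \<Longrightarrow> cmod (f x) \<le> b"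
proof -
  obtain b where "\<forall>x\<in>{0..1}. cmod (f x) \<le> b" using assms unfolding bounded_borel_def by blast
  then have "max b 0 \<ge> 0" "\<And>x. x \<in> {0..1} \<Longrightarrow> cmod (f x) \<le> max b 0" by fastforce+
  then show thesis by (rule that)
qed

lemma bounded_borel_measurable: "bounded_borel f \<Longrightarrow> f \<in> borel_measurable borel"
  by (simp add: bounded_borel_def)

lemma bounded_borelI:
  assumes "f \<in> borel_measurable borel" "\<And>x. x \<in> {0..1} \<Longrightarrow> cmod (f x) \<le> b"
  shows "bounded_borel f"
  using assms unfolding bounded_borel_def by blast

lemma bounded_borel_const [simp]: "bounded_borel (\<lambda>_. c)"
  by (intro bounded_borel_continuous continuous_intros)

lemma bounded_borel_add [intro]:
  assumes "bounded_borel f" "bounded_borel g"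
  shows "bounded_borel (\<lambda>x. f x + g x)"
proof -
  obtain a where a: "a \<ge> 0" "\<And>x. x \<in> {0..1} \<Longrightarrow> cmod (f x) \<le> a" using bounded_borelD[OF assms(1)] by metis
  obtain b where b: "b \<ge> 0" "\<And>x. x \<in> {0..1} \<Longrightarrow> cmod (g x) \<le> b" using bounded_borelD[OF assms(2)] by metis
  show ?thesis
  proof (rule bounded_borelI)
    show "(\<lambda>x. f x + g x) \<in> borel_measurable borel"
      using assms by (intro borel_measurable_add bounded_borel_measurable)
    show "cmod (f x + g x) \<le> a + b" if "x \<in> {0..1}" for x
      using norm_triangle_mono[OF a(2) b(2)] that by blast
  qed
qed

lemma bounded_borel_mult [intro]:
  assumes "bounded_borel f" "bounded_borel g"
  shows "bounded_borel (\<lambda>x. f x * g x)"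
proof -
  obtain a where a: "a \<ge> 0" "\<And>x. x \<in> {0..1} \<Longrightarrow> cmod (f x) \<le> a" using bounded_borelD[OF assms(1)] by metis
  obtain b where b: "b \<ge> 0" "\<And>x. x \<in> {0..1} \<Longrightarrow> cmod (g x) \<le> b" using bounded_borelD[OF assms(2)] by metis
  show ?thesis
  proof (rule bounded_borelI)
    show "(\<lambda>x. f x * g x) \<in> borel_measurable borel"
      using assms by (intro borel_measurable_times bounded_borel_measurable)
    show "cmod (f x * g x) \<le> a * b" if "x \<in> {0..1}" for x
      unfolding norm_mult using a b that by (intro mult_mono) auto
  qed
qed

lemma bounded_borel_diff [intro]:
  assumes "bounded_borel f" "bounded_borel g"
  shows "bounded_borel (\<lambda>x. f x - g x)"
  using bounded_borel_add[OF assms(1) bounded_borel_mult[OF bounded_borel_const[of "-1"] assms(2)]]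
  by simp

lemma bounded_borel_sum:
  assumes "\<And>i. i \<in> I \<Longrightarrow> bounded_borel (F i)"
  shows "bounded_borel (\<lambda>x. \<Sum>i\<in>I. F i x)"
  using assms by (induction I rule: infinite_finite_induct) (auto intro!: bounded_borel_add)

lemma bounded_borel_cnj [intro]:
  assumes "bounded_borel f" shows "bounded_borel (\<lambda>x. cnj (f x))"
proof -
  obtain a where a: "a \<ge> 0" "\<And>x. x \<in> {0..1} \<Longrightarrow> cmod (f x) \<le> a" using bounded_borelD[OF assms(1)] by metis
  show ?thesis
    by (rule bounded_borelI[where b = a],
        rule borel_measurable_continuous_on[OF continuous_on_cnj[OF continuous_on_id] bounded_borel_measurable[OF assms]])
       (use a in simp)
qed

lemma bounded_borel_pow [simp]: "bounded_borel (\<lambda>u. of_real u ^ n)"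
  by (intro bounded_borel_continuous continuous_intros)

lemma bounded_borel_exp [simp]: "bounded_borel (\<lambda>u. exp (z * of_real u))"
  by (intro bounded_borel_continuous continuous_intros)

section \<open>The exponential series on the unit interval\<close>

definition exp_partial :: "nat \<Rightarrow> complex \<Rightarrow> real \<Rightarrow> complex" where
  "exp_partial N z u = (\<Sum>n<N. z ^ n / fact n * of_real u ^ n)"

lemma bounded_borel_exp_partial [simp]: "bounded_borel (exp_partial N z)"
  unfolding exp_partial_def
  by (intro bounded_borel_continuous continuous_intros)

definition exp_tail :: "nat \<Rightarrow> real \<Rightarrow> real" where
  "exp_tail N R = exp R - (\<Sum>n<N. R ^ n / fact n)"

lemma exp_sums_div: "(\<lambda>n. z ^ n / fact n) sums exp z" for z :: "'a :: {real_normed_field, banach}"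
  using exp_converges[of z] by (simp add: scaleR_conv_of_real divide_inverse mult.commute)

lemma exp_tail_tendsto: "(\<lambda>N. exp_tail N R) \<longlonglongrightarrow> 0"
proof -
  have "(\<lambda>N. \<Sum>n<N. R ^ n / fact n) \<longlonglongrightarrow> exp R"
    using exp_sums_div[of R] by (simp add: sums_def)
  from tendsto_diff[OF tendsto_const this, of "exp R"] show ?thesis by (simp add: exp_tail_def)
qed

lemma exp_partial_error:
  assumes u: "u \<in> {0..1}"
  shows "cmod (exp_partial N z u - exp (z * of_real u)) \<le> exp_tail N (cmod z)"
proof -
  let ?w = "z * of_real u"
  have sw: "summable (\<lambda>n. ?w ^ n / fact n)" by (rule sums_summable[OF exp_sums_div])
  have sR: "summable (\<lambda>n. cmod z ^ n / fact n)" by (rule sums_summable[OF exp_sums_div])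
  have "exp ?w - exp_partial N z u = exp ?w - (\<Sum>n<N. ?w ^ n / fact n)"
    by (simp add: exp_partial_def power_mult_distrib)
  also have "\<dots> = (\<Sum>n. ?w ^ (n + N) / fact (n + N))"
    using suminf_minus_initial_segment[OF sw, of N] exp_sums_div[of ?w] by (simp add: sums_iff)
  also have "cmod \<dots> \<le> (\<Sum>n. cmod z ^ (n + N) / fact (n + N))"
  proof (rule norm_suminf_le)
    show "cmod (?w ^ (n + N) / fact (n + N)) \<le> cmod z ^ (n + N) / fact (n + N)" for n
    proof -
      have "cmod ?w ^ (n + N) \<le> cmod z ^ (n + N)"
        using u by (intro power_mono) (auto simp: norm_mult mult_left_le)
      then show ?thesis by (simp add: norm_divide norm_power divide_right_mono)
    qed
    show "summable (\<lambda>n. cmod z ^ (n + N) / fact (n + N))" using sR by (subst summable_iff_shift)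
  qed
  also have "\<dots> = exp_tail N (cmod z)"
    using suminf_minus_initial_segment[OF sR, of N] exp_sums_div[of "cmod z"]
    by (simp add: sums_iff exp_tail_def)
  finally show ?thesis by (simp add: norm_minus_commute)
qed

text \<open>This Lipschitz estimate in the time parameter gives continuity of the stationary
  covariance and mean square continuity of the constructed process.\<close>

lemma norm_exp_i_diff:
  assumes "u \<in> {0..1}"
  shows "cmod (exp (\<i> * of_real x * of_real u) - exp (\<i> * of_real y * of_real u)) \<le> \<bar>x - y\<bar>"
proof -
  have "exp (\<i> * of_real x * of_real u) - exp (\<i> * of_real y * of_real u)
        = exp (\<i> * of_real (y * u)) * (exp (\<i> * of_real ((x - y) * u)) - 1)"
    by (simp add: algebra_simps flip: exp_add)
  then have "cmod (exp (\<i> * of_real x * of_real u) - exp (\<i> * of_real y * of_real u))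
       = cmod (exp (\<i> * of_real ((x - y) * u)) - 1)"
    by (simp add: norm_mult)
  also have "\<dots> \<le> \<bar>(x - y) * u\<bar>"
    using iexp_approx1[of "(x - y) * u" 0] by simp
  also have "\<dots> \<le> \<bar>x - y\<bar>" using assms by (simp add: abs_mult mult_left_le)
  finally show ?thesis .
qed

text \<open>The form is bilinear, with no conjugation in the first slot, and its bound sees only
  values on the unit interval. It is instantiated by the integral of a given bimeasure for necessity
  and by the Gram form of a vector measure for sufficiency.\<close>

locale bounded_form =
  fixes B :: "(real \<Rightarrow> complex) \<Rightarrow> (real \<Rightarrow> complex) \<Rightarrow> complex" and C :: real
  assumes C_nonneg: "C \<ge> 0"
    and add_left: "\<And>f f' g. bounded_borel f \<Longrightarrow> bounded_borel f' \<Longrightarrow> bounded_borel g \<Longrightarrow>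
          B (\<lambda>x. f x + f' x) g = B f g + B f' g"
    and add_right: "\<And>f g g'. bounded_borel f \<Longrightarrow> bounded_borel g \<Longrightarrow> bounded_borel g' \<Longrightarrow>
          B f (\<lambda>x. g x + g' x) = B f g + B f g'"
    and scale_left: "\<And>a f g. bounded_borel f \<Longrightarrow> bounded_borel g \<Longrightarrow> B (\<lambda>x. a * f x) g = a * B f g"
    and scale_right: "\<And>a f g. bounded_borel f \<Longrightarrow> bounded_borel g \<Longrightarrow> B f (\<lambda>x. a * g x) = a * B f g"
    and bound: "\<And>f g a b. bounded_borel f \<Longrightarrow> bounded_borel g \<Longrightarrow>
          (\<And>x. x \<in> {0..1} \<Longrightarrow> cmod (f x) \<le> a) \<Longrightarrow> (\<And>x. x \<in> {0..1} \<Longrightarrow> cmod (g x) \<le> b) \<Longrightarrow>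
          cmod (B f g) \<le> C * a * b"
begin

lemma diff_left:
  assumes "bounded_borel f" "bounded_borel f'" "bounded_borel g"
  shows "B (\<lambda>x. f x - f' x) g = B f g - B f' g"
  using add_left[OF assms(1) bounded_borel_mult[OF bounded_borel_const[of "-1"] assms(2)] assms(3)]
    scale_left[OF assms(2,3), of "-1"] by simp

lemma diff_right:
  assumes "bounded_borel f" "bounded_borel g" "bounded_borel g'"
  shows "B f (\<lambda>x. g x - g' x) = B f g - B f g'"
  using add_right[OF assms(1,2) bounded_borel_mult[OF bounded_borel_const[of "-1"] assms(3)]]
    scale_right[OF assms(1,3), of "-1"] by simp

lemma zero_left [simp]: "bounded_borel g \<Longrightarrow> B (\<lambda>x. 0) g = 0"
  using scale_left[of "\<lambda>_. 0" g 0] by simp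

lemma zero_right [simp]: "bounded_borel f \<Longrightarrow> B f (\<lambda>x. 0) = 0"
  using scale_right[of f "\<lambda>_. 0" 0] by simp

lemma sum_left:
  assumes "finite I" "\<And>i. i \<in> I \<Longrightarrow> bounded_borel (F i)" "bounded_borel g"
  shows "B (\<lambda>x. \<Sum>i\<in>I. F i x) g = (\<Sum>i\<in>I. B (F i) g)"
  using assms(1,2)
proof (induction I)
  case empty
  then show ?case using assms(3) by simp
next
  case (insert i I)
  then show ?case using assms(3) by (simp add: add_left bounded_borel_sum)
qed

lemma sum_right:
  assumes "finite I" "\<And>i. i \<in> I \<Longrightarrow> bounded_borel (G i)" "bounded_borel f"
  shows "B f (\<lambda>x. \<Sum>i\<in>I. G i x) = (\<Sum>i\<in>I. B f (G i))"
  using assms(1,2)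
proof (induction I)
  case empty
  then show ?case using assms(3) by simp
next
  case (insert i I)
  then show ?case using assms(3) by (simp add: add_right bounded_borel_sum)
qed

lemma sum_both:
  assumes "finite I" "finite J" "\<And>i. i \<in> I \<Longrightarrow> bounded_borel (F i)" "\<And>j. j \<in> J \<Longrightarrow> bounded_borel (G j)"
  shows "B (\<lambda>x. \<Sum>i\<in>I. a i * F i x) (\<lambda>x. \<Sum>j\<in>J. b j * G j x) = (\<Sum>i\<in>I. \<Sum>j\<in>J. a i * b j * B (F i) (G j))"
proof -
  have F: "bounded_borel (\<lambda>x. a i * F i x)" if "i \<in> I" for i
    using assms(3)[OF that] by (intro bounded_borel_mult) auto
  have G: "bounded_borel (\<lambda>x. b j * G j x)" if "j \<in> J" for j
    using assms(4)[OF that] by (intro bounded_borel_mult) auto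
  have "B (\<lambda>x. \<Sum>i\<in>I. a i * F i x) (\<lambda>x. \<Sum>j\<in>J. b j * G j x)
      = (\<Sum>i\<in>I. B (\<lambda>x. a i * F i x) (\<lambda>x. \<Sum>j\<in>J. b j * G j x))"
    using F G assms by (intro sum_left bounded_borel_sum)
  also have "\<dots> = (\<Sum>i\<in>I. \<Sum>j\<in>J. a i * b j * B (F i) (G j))"
  proof (rule sum.cong[OF refl])
    fix i assume i: "i \<in> I"
    have "B (\<lambda>x. a i * F i x) (\<lambda>x. \<Sum>j\<in>J. b j * G j x) = (\<Sum>j\<in>J. B (\<lambda>x. a i * F i x) (\<lambda>x. b j * G j x))"
      using F G assms i by (intro sum_right)
    also have "\<dots> = (\<Sum>j\<in>J. a i * b j * B (F i) (G j))"
      using i G assms(3,4) by (intro sum.cong refl) (simp add: scale_left scale_right)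
    finally show "B (\<lambda>x. a i * F i x) (\<lambda>x. \<Sum>j\<in>J. b j * G j x) = (\<Sum>j\<in>J. a i * b j * B (F i) (G j))" .
  qed
  finally show ?thesis .
qed

lemma tendsto_form:
  assumes f: "\<And>n. bounded_borel (fn n)" "bounded_borel f" and g: "\<And>n. bounded_borel (gn n)" "bounded_borel g"
    and df: "\<And>n x. x \<in> {0..1} \<Longrightarrow> cmod (fn n x - f x) \<le> d n" and d: "d \<longlonglongrightarrow> 0"
    and eg: "\<And>n x. x \<in> {0..1} \<Longrightarrow> cmod (gn n x - g x) \<le> e n" and e: "e \<longlonglongrightarrow> 0"
  shows "(\<lambda>n. B (fn n) (gn n)) \<longlonglongrightarrow> B f g"
proof -
  obtain a where a: "a \<ge> 0" "\<And>x. x \<in> {0..1} \<Longrightarrow> cmod (f x) \<le> a" using bounded_borelD[OF f(2)] by metis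
  obtain b where b: "b \<ge> 0" "\<And>x. x \<in> {0..1} \<Longrightarrow> cmod (g x) \<le> b" using bounded_borelD[OF g(2)] by metis
  have gb: "cmod (gn n x) \<le> b + e n" if "x \<in> {0..1}" for n x
    using norm_triangle_sub[of "gn n x" "g x"] b(2)[OF that] eg[OF that, of n] by linarith
  have "cmod (B (fn n) (gn n) - B f g) \<le> C * d n * (b + e n) + C * a * e n" for n
  proof -
    have "B (fn n) (gn n) - B f g = B (\<lambda>x. fn n x - f x) (gn n) + B f (\<lambda>x. gn n x - g x)"
      using f g by (simp add: diff_left diff_right)
    also have "cmod \<dots> \<le> C * d n * (b + e n) + C * a * e n"
      using f g by (intro norm_triangle_mono bound bounded_borel_diff df eg gb a)
    finally show ?thesis .
  qed
  moreover have "(\<lambda>n. C * d n * (b + e n) + C * a * e n) \<longlonglongrightarrow> 0"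
    using d e by (auto intro!: tendsto_eq_intros)
  ultimately have "(\<lambda>n. B (fn n) (gn n) - B f g) \<longlonglongrightarrow> 0"
    by (rule Lim_null_comparison[OF always_eventually[OF allI]])
  then show ?thesis by (simp add: LIM_zero_iff)
qed

lemma exp_partial_times_error:
  assumes "\<And>x. x \<in> {0..1} \<Longrightarrow> cmod (\<phi> x) \<le> a" "x \<in> {0..1}" "a \<ge> 0"
  shows "cmod (\<phi> x * exp_partial N z x - \<phi> x * exp (z * of_real x)) \<le> a * exp_tail N (cmod z)"
proof -
  have "cmod (\<phi> x * exp_partial N z x - \<phi> x * exp (z * of_real x))
      = cmod (\<phi> x) * cmod (exp_partial N z x - exp (z * of_real x))"
    by (simp add: norm_mult flip: right_diff_distrib)
  also have "\<dots> \<le> a * exp_tail N (cmod z)"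
    using assms exp_partial_error by (intro mult_mono) auto
  finally show ?thesis .
qed

lemma tendsto_exp_partial:
  assumes \<phi>: "bounded_borel \<phi>" and \<psi>: "bounded_borel \<psi>"
  shows "(\<lambda>N. B (\<lambda>u. \<phi> u * exp_partial N z u) (\<lambda>u. \<psi> u * exp_partial N w u))
           \<longlonglongrightarrow> B (\<lambda>u. \<phi> u * exp (z * of_real u)) (\<lambda>u. \<psi> u * exp (w * of_real u))"
proof -
  obtain a where a: "a \<ge> 0" "\<And>x. x \<in> {0..1} \<Longrightarrow> cmod (\<phi> x) \<le> a" using bounded_borelD[OF \<phi>] by metis
  obtain b where b: "b \<ge> 0" "\<And>x. x \<in> {0..1} \<Longrightarrow> cmod (\<psi> x) \<le> b" using bounded_borelD[OF \<psi>] by metis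
  show ?thesis
  proof (rule tendsto_form)
    show "cmod (\<phi> x * exp_partial n z x - \<phi> x * exp (z * of_real x)) \<le> a * exp_tail n (cmod z)"
      "cmod (\<psi> x * exp_partial n w x - \<psi> x * exp (w * of_real x)) \<le> b * exp_tail n (cmod w)"
      if "x \<in> {0..1}" for n x
      using exp_partial_times_error that a b by blast+
    show "(\<lambda>n. a * exp_tail n (cmod z)) \<longlonglongrightarrow> 0" "(\<lambda>n. b * exp_tail n (cmod w)) \<longlonglongrightarrow> 0"
      using tendsto_mult[OF tendsto_const exp_tail_tendsto] by force+
  qed (use \<phi> \<psi> in auto)
qed

lemma form_exp_partial:
  assumes \<phi>: "bounded_borel \<phi>" and \<psi>: "bounded_borel \<psi>"
  shows "B (\<lambda>u. \<phi> u * exp_partial N z u) (\<lambda>u. \<psi> u * exp_partial M w u) =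
     (\<Sum>n<N. \<Sum>m<M. z ^ n / fact n * (w ^ m / fact m) * B (\<lambda>u. \<phi> u * of_real u ^ n) (\<lambda>u. \<psi> u * of_real u ^ m))"
proof -
  have "B (\<lambda>u. \<phi> u * exp_partial N z u) (\<lambda>u. \<psi> u * exp_partial M w u) =
        B (\<lambda>u. \<Sum>n<N. z ^ n / fact n * (\<phi> u * of_real u ^ n)) (\<lambda>u. \<Sum>m<M. w ^ m / fact m * (\<psi> u * of_real u ^ m))"
    by (simp add: exp_partial_def sum_distrib_left mult_ac)
  also have "\<dots> = (\<Sum>n<N. \<Sum>m<M. z ^ n / fact n * (w ^ m / fact m) * B (\<lambda>u. \<phi> u * of_real u ^ n) (\<lambda>u. \<psi> u * of_real u ^ m))"
    using \<phi> \<psi> by (intro sum_both) auto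
  finally show ?thesis .
qed

text \<open>Unconditional summability comes from a majorant with sum
  \<open>C * a * b * exp (cmod z) * exp (cmod w)\<close>; the value is then identified along square
  partial sums, which are values of the form on truncated exponentials. The weights
  \<open>\<phi>\<close> and \<open>\<psi>\<close> allow expansion around arbitrary base
  points.\<close>

lemma form_exp_has_sum:
  assumes \<phi>: "bounded_borel \<phi>" and \<psi>: "bounded_borel \<psi>"
  shows "((\<lambda>(n, m). z ^ n / fact n * (w ^ m / fact m) * B (\<lambda>u. \<phi> u * of_real u ^ n) (\<lambda>u. \<psi> u * of_real u ^ m))
      has_sum B (\<lambda>u. \<phi> u * exp (z * of_real u)) (\<lambda>u. \<psi> u * exp (w * of_real u))) UNIV"
proof -
  define t where "t = (\<lambda>(n, m). z ^ n / fact n * (w ^ m / fact m) * B (\<lambda>u. \<phi> u * of_real u ^ n) (\<lambda>u. \<psi> u * of_real u ^ m))"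
  obtain a where a: "a \<ge> 0" "\<And>x. x \<in> {0..1} \<Longrightarrow> cmod (\<phi> x) \<le> a" using bounded_borelD[OF \<phi>] by metis
  obtain b where b: "b \<ge> 0" "\<And>x. x \<in> {0..1} \<Longrightarrow> cmod (\<psi> x) \<le> b" using bounded_borelD[OF \<psi>] by metis
  have hs: "((\<lambda>n. R ^ n / fact n) has_sum exp R) UNIV" if "R \<ge> 0" for R :: real
    by (rule norm_summable_imp_has_sum[OF _ exp_sums_div])
       (use sums_summable[OF exp_sums_div[of R]] that in simp)
  have pw: "cmod (\<phi> x * of_real x ^ n) \<le> a" "cmod (\<psi> x * of_real x ^ n) \<le> b" if "x \<in> {0..1}" for x n
  proof -
    have "cmod (of_real x ^ n) \<le> 1" using that by (simp add: norm_power power_le_one)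
    then show "cmod (\<phi> x * of_real x ^ n) \<le> a" "cmod (\<psi> x * of_real x ^ n) \<le> b"
      using a b that by (auto simp: norm_mult intro: mult_le_one mult_left_le order_trans[OF mult_left_le])
  qed
  have "(\<lambda>(n, m). cmod z ^ n / fact n * (cmod w ^ m / fact m)) summable_on Sigma UNIV (\<lambda>_. UNIV)"
  proof (rule summable_on_SigmaI)
    show "((\<lambda>m. case (n, m) of (n, m) \<Rightarrow> cmod z ^ n / fact n * (cmod w ^ m / fact m))
             has_sum cmod z ^ n / fact n * exp (cmod w)) UNIV" for n
      unfolding prod.case by (rule has_sum_cmult_right[OF hs]) simp
    show "(\<lambda>n. cmod z ^ n / fact n * exp (cmod w)) summable_on UNIV"
      using hs[of "cmod z"] by (intro summable_on_cmult_left) (auto simp: summable_on_def)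
  qed auto
  then have "(\<lambda>p. C * a * b * (case p of (n, m) \<Rightarrow> cmod z ^ n / fact n * (cmod w ^ m / fact m))) summable_on UNIV"
    by (intro summable_on_cmult_right) simp
  then have "(\<lambda>p. norm (t p)) summable_on UNIV"
  proof (rule Infinite_Sum.abs_summable_on_comparison_test')
    fix p :: "nat \<times> nat"
    obtain n m where p: "p = (n, m)" by (cases p)
    have "cmod (t p) = cmod z ^ n / fact n * (cmod w ^ m / fact m) * cmod (B (\<lambda>u. \<phi> u * of_real u ^ n) (\<lambda>u. \<psi> u * of_real u ^ m))"
      by (simp add: t_def p norm_mult norm_divide norm_power)
    also have "\<dots> \<le> cmod z ^ n / fact n * (cmod w ^ m / fact m) * (C * a * b)"
      using \<phi> \<psi> by (intro mult_left_mono bound pw) auto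
    finally show "cmod (t p) \<le> C * a * b * (case p of (n, m) \<Rightarrow> cmod z ^ n / fact n * (cmod w ^ m / fact m))"
      by (simp add: p mult_ac)
  qed
  then have "t summable_on UNIV" by (rule abs_summable_summable)
  then obtain S where S: "(t has_sum S) UNIV" by (auto simp: summable_on_def)
  \<comment> \<open>Squares exhaust the index set, so the unconditional sum is the limit over
    them.\<close>
  have "filterlim (\<lambda>N :: nat. {..<N} \<times> {..<N}) (finite_subsets_at_top UNIV) sequentially"
    unfolding filterlim_finite_subsets_at_top
  proof (intro allI impI)
    fix X :: "(nat \<times> nat) set" assume "finite X \<and> X \<subseteq> UNIV"
    then have "finite X" by simp
    then have "\<exists>N. X \<subseteq> {..<N} \<times> {..<N}"
    proof (induction X)
      case (insert p X)
      then obtain N where "X \<subseteq> {..<N} \<times> {..<N}" by blast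
      then have "insert p X \<subseteq> {..<max N (Suc (max (fst p) (snd p)))} \<times> {..<max N (Suc (max (fst p) (snd p)))}"
        by (cases p) force
      then show ?case by blast
    qed auto
    then obtain N where N: "X \<subseteq> {..<N} \<times> {..<N}" by blast
    show "\<forall>\<^sub>F M in sequentially. finite ({..<M} \<times> {..<M}) \<and> X \<subseteq> {..<M} \<times> {..<M} \<and> {..<M} \<times> {..<M} \<subseteq> (UNIV :: (nat \<times> nat) set)"
      using eventually_ge_at_top[of N] by eventually_elim (use N in force)
  qed
  with S have "(\<lambda>N. sum t ({..<N} \<times> {..<N})) \<longlonglongrightarrow> S"
    unfolding has_sum_def by (rule filterlim_compose)
  moreover have "sum t ({..<N} \<times> {..<N}) = B (\<lambda>u. \<phi> u * exp_partial N z u) (\<lambda>u. \<psi> u * exp_partial N w u)" for N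
    unfolding form_exp_partial[OF \<phi> \<psi>] t_def sum.cartesian_product ..
  ultimately have "S = B (\<lambda>u. \<phi> u * exp (z * of_real u)) (\<lambda>u. \<psi> u * exp (w * of_real u))"
    using LIMSEQ_unique[OF _ tendsto_exp_partial[OF \<phi> \<psi>]] by simp
  with S show ?thesis unfolding t_def by simp
qed

definition form_kernel :: "real \<Rightarrow> real \<Rightarrow> complex" where
  "form_kernel t t' = B (\<lambda>s. exp (- (\<i> * of_real t * of_real s))) (\<lambda>s'. exp (\<i> * of_real t' * of_real s'))"

text \<open>The base point is absorbed into the weights of \<open>form_exp_has_sum\<close>. The
  radius 1 is an arbitrary choice, as the expansion converges everywhere.\<close>

lemma form_kernel_series:
  "double_power_series (\<lambda>t s. form_kernel (t0 + t) (s0 + s))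
     (\<lambda>n m. (- \<i>) ^ n / fact n * (\<i> ^ m / fact m) *
        B (\<lambda>u. exp (- (\<i> * of_real t0 * of_real u)) * of_real u ^ n)
          (\<lambda>u. exp (\<i> * of_real s0 * of_real u) * of_real u ^ m)) 1"
  unfolding double_power_series_def
proof (intro conjI allI impI)
  fix t s :: real
  let ?\<phi> = "\<lambda>u. exp (- (\<i> * of_real t0 * of_real u))" and ?\<psi> = "\<lambda>u. exp (\<i> * of_real s0 * of_real u)"
  have b: "bounded_borel ?\<phi>" "bounded_borel ?\<psi>"
    by (intro bounded_borel_continuous continuous_intros)+
  have "(\<lambda>u. ?\<phi> u * exp (- \<i> * of_real t * of_real u)) = (\<lambda>u. exp (- (\<i> * of_real (t0 + t) * of_real u)))"
    "(\<lambda>u. ?\<psi> u * exp (\<i> * of_real s * of_real u)) = (\<lambda>u. exp (\<i> * of_real (s0 + s) * of_real u))"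
    by (simp_all add: algebra_simps flip: exp_add)
  then have eq: "form_kernel (t0 + t) (s0 + s) = B (\<lambda>u. ?\<phi> u * exp (- \<i> * of_real t * of_real u)) (\<lambda>u. ?\<psi> u * exp (\<i> * of_real s * of_real u))"
    unfolding form_kernel_def by simp
  have cf: "(- \<i> * of_real t) ^ n / fact n * ((\<i> * of_real s) ^ m / fact m) * b
      = (- \<i>) ^ n / fact n * (\<i> ^ m / fact m) * b * of_real (t ^ n * s ^ m)" for n m b
    by (simp only: power_mult_distrib of_real_mult of_real_power divide_inverse mult_ac)
  show "((\<lambda>(n, m). (- \<i>) ^ n / fact n * (\<i> ^ m / fact m) * B (\<lambda>u. ?\<phi> u * of_real u ^ n) (\<lambda>u. ?\<psi> u * of_real u ^ m) * of_real (t ^ n * s ^ m))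
      has_sum form_kernel (t0 + t) (s0 + s)) UNIV"
    using form_exp_has_sum[OF b, of "- \<i> * of_real t" "\<i> * of_real s"] unfolding eq cf .
qed simp

lemma analytic_form_kernel: "analytic_kernel form_kernel"
  unfolding analytic_kernel_iff using form_kernel_series by blast

lemma form_kernel_series_0:
  "double_power_series form_kernel
     (\<lambda>n m. (- \<i>) ^ n / fact n * (\<i> ^ m / fact m) * B (\<lambda>u. of_real u ^ n) (\<lambda>u. of_real u ^ m)) 1"
  using form_kernel_series[of 0 0] by simp

text \<open>The powers of \<open>\<i>\<close> in \<open>kernel_moment\<close> are those that cancel
  the ones produced by differentiating the exponentials.\<close>

lemma kernel_moment_form: "kernel_moment form_kernel n m = B (\<lambda>u. of_real u ^ n) (\<lambda>u. of_real u ^ m)"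
proof -
  have "\<i> ^ n * (- \<i>) ^ n = 1" "\<i> ^ m * (- \<i>) ^ m = 1" by (simp_all flip: power_mult_distrib)
  then have "\<i> ^ n * (- \<i>) ^ m * ((- \<i>) ^ n * \<i> ^ m) = 1"
    by (metis (no_types, lifting) mult.assoc mult.commute mult_1)
  then have "\<i> ^ n * (- \<i>) ^ m * ((- \<i>) ^ n * \<i> ^ m) * b = b" for b by simp
  then show ?thesis
    unfolding kernel_moment_eq[OF form_kernel_series_0] by (simp add: mult_ac)
qed

lemma bounded_borel_poly [simp]: "bounded_borel (\<lambda>u. poly p (of_real u))"
  by (intro bounded_borel_continuous continuous_intros)

lemma moment_functional_form:
  "moment_functional (kernel_moment form_kernel) p q = B (\<lambda>u. poly p (of_real u)) (\<lambda>u. poly q (of_real u))"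
  unfolding moment_functional_def kernel_moment_form poly_altdef
  by (subst sum_both) auto

lemma poly_bernstein: "poly (bernstein_poly k m) (of_real u) = of_real (Bernstein k m u)"
  by (simp add: bernstein_poly_def Bernstein_def poly_power)

lemma weakly_bounded_form: "weakly_bounded (kernel_moment form_kernel)"
  unfolding weakly_bounded_def
\<comment> \<open>\<open>C\<close> may be 0, while a strictly positive constant is required.\<close>
proof (intro exI[of _ "C + 1"] conjI allI impI)
  show "C + 1 > 0" using C_nonneg by simp
  fix k1 k2 and a b :: "nat \<Rightarrow> complex"
  assume a: "\<forall>m\<le>k1. cmod (a m) \<le> 1" and b: "\<forall>m\<le>k2. cmod (b m) \<le> 1"
  let ?P = "\<lambda>k a u. \<Sum>m\<le>k. a m * poly (bernstein_poly k m) (of_real u)"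
  have bd: "cmod (?P k a u) \<le> 1" if "\<forall>m\<le>k. cmod (a m) \<le> 1" "u \<in> {0..1}" for k u and a :: "nat \<Rightarrow> complex"
  proof -
    have "cmod (?P k a u) \<le> (\<Sum>m\<le>k. cmod (a m * poly (bernstein_poly k m) (of_real u)))" by (rule norm_sum)
    also have "\<dots> \<le> (\<Sum>m\<le>k. Bernstein k m u)"
    proof (rule sum_mono)
      fix m assume m: "m \<in> {..k}"
      have B: "Bernstein k m u \<ge> 0" using that by (intro Bernstein_nonneg) auto
      have "cmod (a m * poly (bernstein_poly k m) (of_real u)) = cmod (a m) * Bernstein k m u"
        unfolding poly_bernstein norm_mult using B by simp
      also have "\<dots> \<le> Bernstein k m u" using that m B by (intro mult_left_le_one_le) auto
      finally show "cmod (a m * poly (bernstein_poly k m) (of_real u)) \<le> Bernstein k m u" .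
    qed
    finally show ?thesis by simp
  qed
  have bb: "bounded_borel (?P k a)" for k a
    by (intro bounded_borel_continuous continuous_intros)
  have "(\<Sum>m1\<le>k1. \<Sum>m2\<le>k2. a m1 * b m2 * bernstein_moment (kernel_moment form_kernel) k1 k2 m1 m2)
      = B (?P k1 a) (?P k2 b)"
    unfolding bernstein_moment_def moment_functional_form by (subst sum_both) auto
  also have "cmod \<dots> \<le> C * 1 * 1"
    by (intro bound bb bd a b) auto
  finally show "cmod (\<Sum>m1\<le>k1. \<Sum>m2\<le>k2. a m1 * b m2 * bernstein_moment (kernel_moment form_kernel) k1 k2 m1 m2) \<le> C + 1"
    by simp
qed

lemma hankel_shift:
  assumes "hankel \<mu>" shows "\<mu> n m = \<mu> 0 (n + m)"
  using assms by (induction n arbitrary: m) (auto simp: hankel_def)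

text \<open>The Hankel condition moves powers of \<open>u\<close> from the first slot to the second.
  Exponential series extend this one slot at a time: \<open>pw\<close> treats an exponential in the
  second slot, then the exponential in the first slot is expanded. The kernel becomes the form of 1
  and \<open>exp (\<i> * (t' - t) * u)\<close>.\<close>

lemma form_kernel_hankel:
  assumes h: "hankel (kernel_moment form_kernel)"
  shows "form_kernel t t' = form_kernel 0 (t' - t)"
proof -
  have pow: "B (\<lambda>u. of_real u ^ n) (\<lambda>u. of_real u ^ m) = B (\<lambda>_. 1) (\<lambda>u. of_real u ^ n * of_real u ^ m)" for n m
    using hankel_shift[OF h, of n m] unfolding kernel_moment_form by (simp add: power_add)
  define z w where "z = - (\<i> * of_real t)" and "w = \<i> * of_real t'"
  have b1: "bounded_borel (\<lambda>_. 1)" by simp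
  have pw: "B (\<lambda>u. of_real u ^ n) (\<lambda>u. exp (w * of_real u)) = B (\<lambda>_. 1) (\<lambda>u. of_real u ^ n * exp (w * of_real u))" for n
  proof -
    \<comment> \<open>Exponent 0 stands for the constant 1, so the limit lemma for two exponentials
      serves although only one genuine exponential is present.\<close>
    have "(\<lambda>N. B (\<lambda>u. of_real u ^ n * exp_partial N 0 u) (\<lambda>u. 1 * exp_partial N w u))
           \<longlonglongrightarrow> B (\<lambda>u. of_real u ^ n * exp (0 * of_real u)) (\<lambda>u. 1 * exp (w * of_real u))"
      by (rule tendsto_exp_partial) auto
    moreover have "(\<lambda>N. B (\<lambda>u. 1 * exp_partial N 0 u) (\<lambda>u. of_real u ^ n * exp_partial N w u))
           \<longlonglongrightarrow> B (\<lambda>u. 1 * exp (0 * of_real u)) (\<lambda>u. of_real u ^ n * exp (w * of_real u))"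
      by (rule tendsto_exp_partial) auto
    moreover have "B (\<lambda>u. of_real u ^ n * exp_partial N 0 u) (\<lambda>u. 1 * exp_partial N w u)
          = B (\<lambda>u. 1 * exp_partial N 0 u) (\<lambda>u. of_real u ^ n * exp_partial N w u)" for N
      by (subst (1 2) form_exp_partial)
         (auto simp: zero_power pow intro!: sum.cong split: if_splits)
    ultimately show ?thesis using LIMSEQ_unique by fastforce
  qed
  have L1: "(\<lambda>N. B (\<lambda>u. 1 * exp_partial N z u) (\<lambda>u. exp (w * of_real u) * exp_partial N 0 u))
         \<longlonglongrightarrow> B (\<lambda>u. 1 * exp (z * of_real u)) (\<lambda>u. exp (w * of_real u) * exp (0 * of_real u))"
    by (rule tendsto_exp_partial) auto
  have L2: "(\<lambda>N. B (\<lambda>u. 1 * exp_partial N 0 u) (\<lambda>u. exp (w * of_real u) * exp_partial N z u))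
         \<longlonglongrightarrow> B (\<lambda>u. 1 * exp (0 * of_real u)) (\<lambda>u. exp (w * of_real u) * exp (z * of_real u))"
    by (rule tendsto_exp_partial) auto
  \<comment> \<open>The index \<open>Suc N\<close> is used because \<open>exp_partial 0 0\<close> is
    an empty sum, while \<open>exp_partial (Suc N) 0\<close> is constantly 1.\<close>
  have eq: "B (\<lambda>u. 1 * exp_partial (Suc N) z u) (\<lambda>u. exp (w * of_real u) * exp_partial (Suc N) 0 u)
      = B (\<lambda>u. 1 * exp_partial (Suc N) 0 u) (\<lambda>u. exp (w * of_real u) * exp_partial (Suc N) z u)" for N
  proof -
    have e0: "exp_partial (Suc N) 0 u = 1" for u
      unfolding exp_partial_def by (subst sum.remove[of _ 0]) (auto simp: zero_power)
    have "B (\<lambda>u. exp_partial (Suc N) z u) (\<lambda>u. exp (w * of_real u))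
       = (\<Sum>n<Suc N. B (\<lambda>u. z ^ n / fact n * of_real u ^ n) (\<lambda>u. exp (w * of_real u)))"
      unfolding exp_partial_def by (intro sum_left bounded_borel_mult) auto
    also have "\<dots> = (\<Sum>n<Suc N. B (\<lambda>_. 1) (\<lambda>u. z ^ n / fact n * (of_real u ^ n * exp (w * of_real u))))"
    proof (rule sum.cong[OF refl])
      fix n
      have "B (\<lambda>u. z ^ n / fact n * of_real u ^ n) (\<lambda>u. exp (w * of_real u))
          = z ^ n / fact n * B (\<lambda>u. of_real u ^ n) (\<lambda>u. exp (w * of_real u))"
        by (rule scale_left) auto
      also have "\<dots> = B (\<lambda>_. 1) (\<lambda>u. z ^ n / fact n * (of_real u ^ n * exp (w * of_real u)))"
        unfolding pw by (rule scale_right[symmetric]) auto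
      finally show "B (\<lambda>u. z ^ n / fact n * of_real u ^ n) (\<lambda>u. exp (w * of_real u))
          = B (\<lambda>_. 1) (\<lambda>u. z ^ n / fact n * (of_real u ^ n * exp (w * of_real u)))" .
    qed
    also have "\<dots> = B (\<lambda>_. 1) (\<lambda>u. \<Sum>n<Suc N. z ^ n / fact n * (of_real u ^ n * exp (w * of_real u)))"
      by (intro sum_right[symmetric] bounded_borel_mult) auto
    also have "(\<lambda>u. \<Sum>n<Suc N. z ^ n / fact n * (of_real u ^ n * exp (w * of_real u)))
        = (\<lambda>u. exp (w * of_real u) * exp_partial (Suc N) z u)"
      by (simp only: exp_partial_def sum_distrib_left mult_ac)
    finally show ?thesis by (simp only: e0 mult_1 mult_1_right)
  qed
  have "B (\<lambda>u. exp (z * of_real u)) (\<lambda>u. exp (w * of_real u)) =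
        B (\<lambda>u. 1) (\<lambda>u. exp (w * of_real u) * exp (z * of_real u))"
    using LIMSEQ_unique[OF LIMSEQ_Suc[OF L1, unfolded eq] LIMSEQ_Suc[OF L2]] by simp
  also have "(\<lambda>u. exp (w * of_real u) * exp (z * of_real u)) = (\<lambda>u. exp (\<i> * of_real (t' - t) * of_real u))"
    by (simp add: z_def w_def algebra_simps flip: exp_add)
  finally show ?thesis
    by (simp add: form_kernel_def z_def w_def)
qed

lemma form_kernel_0_continuous: "continuous_on UNIV (form_kernel 0)"
proof -
  have bb: "bounded_borel (\<lambda>u. exp (\<i> * of_real x * of_real u))" for x
    by (intro bounded_borel_continuous continuous_intros)
  have "cmod (form_kernel 0 x - form_kernel 0 y) \<le> C * \<bar>x - y\<bar>" for x y
  proof -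
    have "form_kernel 0 x - form_kernel 0 y
        = B (\<lambda>_. 1) (\<lambda>u. exp (\<i> * of_real x * of_real u) - exp (\<i> * of_real y * of_real u))"
      using bb by (simp add: form_kernel_def diff_right)
    also have "cmod \<dots> \<le> C * 1 * \<bar>x - y\<bar>"
      by (intro bound bounded_borel_diff bb norm_exp_i_diff) auto
    finally show ?thesis by simp
  qed
  then have "C-lipschitz_on UNIV (form_kernel 0)"
    using C_nonneg by (auto simp: lipschitz_on_def dist_norm)
  then show ?thesis by (rule lipschitz_on_continuous_on)
qed

text \<open>A function of \<open>t' - t\<close> has opposite partial derivatives. Comparing
  coefficients gives \<open>(n + 1) * c (n + 1) m = - (m + 1) * c n (m + 1)\<close>, and this sign
  is exactly the one between \<open>\<i> ^ (n + 1) * (- \<i>) ^ m\<close> and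
  \<open>\<i> ^ n * (- \<i>) ^ (m + 1)\<close>.\<close>

lemma stationary_imp_hankel:
  assumes F: "\<And>t t'. form_kernel t t' = F (t' - t)"
  shows "hankel (kernel_moment form_kernel)"
proof -
  define c where "c n m = (- \<i>) ^ n / fact n * (\<i> ^ m / fact m) * B (\<lambda>u. of_real u ^ n) (\<lambda>u. of_real u ^ m)" for n m
  have c: "double_power_series form_kernel c 1" using form_kernel_series_0 unfolding c_def .
  \<comment> \<open>\<open>F\<close> is a section of the kernel, which supplies its
    differentiability.\<close>
  have dF: "(F has_vector_derivative vector_derivative F (at x)) (at x)" for x
  proof -
    have "(\<lambda>y. form_kernel (0 + 0) (x + y)) differentiable (at 0)"
      using double_power_series_deriv_snd(1)[OF form_kernel_series[of 0 x], of 0 0] by simp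
    then have "(\<lambda>y. F (x + y)) differentiable (at 0)" by (simp add: F)
    then have "((\<lambda>y. F (x + y)) \<circ> (\<lambda>y. y - x)) differentiable (at x)"
      by (intro differentiable_chain_at) auto
    then show ?thesis by (simp add: o_def vector_derivative_works)
  qed
  have "partial_snd form_kernel t s = vector_derivative F (at (s - t))" for t s
  proof -
    have "(F \<circ> (\<lambda>y. y - t) has_vector_derivative (1 *\<^sub>R vector_derivative F (at (s - t)))) (at s)"
      by (intro vector_diff_chain_at derivative_eq_intros refl dF) auto
    then show ?thesis unfolding partial_snd_def F by (simp add: o_def vector_derivative_at)
  qed
  moreover have "partial_fst form_kernel t s = - vector_derivative F (at (s - t))" for t s
  proof -
    have "(F \<circ> (\<lambda>y. s - y) has_vector_derivative ((-1) *\<^sub>R vector_derivative F (at (s - t)))) (at t)"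
      by (intro vector_diff_chain_at dF) (auto intro!: derivative_eq_intros)
    then show ?thesis unfolding partial_fst_def F by (simp add: o_def vector_derivative_at)
  qed
  ultimately have eq: "partial_fst form_kernel t s = - partial_snd form_kernel t s" for t s by simp
  have "double_power_series (partial_fst form_kernel) (\<lambda>j k. - (of_nat (Suc k) * c j (Suc k))) 1"
    unfolding double_power_series_def eq
  proof (intro conjI allI impI)
    fix t s :: real assume "\<bar>t\<bar> < 1" "\<bar>s\<bar> < 1"
    then have "((\<lambda>(j, k). of_nat (Suc k) * c j (Suc k) * of_real (t ^ j * s ^ k)) has_sum partial_snd form_kernel t s) UNIV"
      using double_power_series_partial_snd[OF c] unfolding double_power_series_def by blast
    from has_sum_cmult_right[OF this, of "-1"]
    show "((\<lambda>(j, k). - (of_nat (Suc k) * c j (Suc k)) * of_real (t ^ j * s ^ k)) has_sum - partial_snd form_kernel t s) UNIV"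
      by (simp add: case_prod_unfold)
  qed simp
  with double_power_series_partial_fst[OF c]
  have "(\<lambda>j k. of_nat (Suc j) * c (Suc j) k) = (\<lambda>j k. - (of_nat (Suc k) * c j (Suc k)))"
    by (rule double_power_series_unique)
  then have cc: "of_nat (Suc n) * c (Suc n) m = - (of_nat (Suc m) * c n (Suc m))" for n m by meson
  show ?thesis
    unfolding hankel_def kernel_moment_eq[OF c]
  proof (intro allI)
    fix n m
    have "\<i> ^ Suc n * (- \<i>) ^ m * (fact (Suc n) * fact m * c (Suc n) m)
        = \<i> * \<i> ^ n * (- \<i>) ^ m * fact n * fact m * (of_nat (Suc n) * c (Suc n) m)"
      by (simp only: fact_Suc power_Suc of_nat_mult mult_ac)
    also have "\<dots> = \<i> ^ n * (- \<i>) ^ Suc m * (fact n * fact (Suc m) * c n (Suc m))"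
      unfolding cc by (simp add: algebra_simps)
    finally show "\<i> ^ Suc n * (- \<i>) ^ m * (fact (Suc n) * fact m * c (Suc n) m)
        = \<i> ^ n * (- \<i>) ^ Suc m * (fact n * fact (Suc m) * c n (Suc m))" .
  qed
qed

end

subsection \<open>The bilinear form of a bimeasure supported in the unit interval\<close>

text \<open>Rounding down to the grid of mesh \<open>1 / Suc n\<close> is a concrete uniform
  approximation, along which \<open>form\<close> can be defined as a limit.\<close>

definition round_grid :: "nat \<Rightarrow> (real \<Rightarrow> complex) \<Rightarrow> real \<Rightarrow> complex" where
  "round_grid n f x = Complex (of_int \<lfloor>real (Suc n) * Re (f x)\<rfloor> / real (Suc n))
                       (of_int \<lfloor>real (Suc n) * Im (f x)\<rfloor> / real (Suc n))"

lemma round_grid_error: "cmod (round_grid n f x - f x) \<le> 2 / real (Suc n)"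
proof -
  have e: "\<bar>of_int \<lfloor>real (Suc n) * y\<rfloor> / real (Suc n) - y\<bar> \<le> 1 / real (Suc n)" for y
  proof -
    have "of_int \<lfloor>real (Suc n) * y\<rfloor> / real (Suc n) - y
        = (of_int \<lfloor>real (Suc n) * y\<rfloor> - real (Suc n) * y) / real (Suc n)"
      by (simp add: field_simps del: of_nat_Suc)
    moreover have "\<bar>of_int \<lfloor>real (Suc n) * y\<rfloor> - real (Suc n) * y\<bar> \<le> 1" by linarith
    ultimately show ?thesis by (simp add: divide_right_mono del: of_nat_Suc)
  qed
  have "cmod (round_grid n f x - f x) \<le> \<bar>Re (round_grid n f x - f x)\<bar> + \<bar>Im (round_grid n f x - f x)\<bar>"
    by (rule cmod_le)
  also have "\<dots> \<le> 1 / real (Suc n) + 1 / real (Suc n)"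
    unfolding round_grid_def using e by (intro add_mono) (simp_all del: of_nat_Suc)
  finally show ?thesis by simp
qed

lemma simple_function_round_grid:
  assumes f: "f \<in> borel_measurable borel" and b: "\<And>x. cmod (f x) \<le> b"
  shows "simple_function borel (round_grid n f)"
proof (rule simple_function_borel_measurable)
  have [measurable]: "(\<lambda>x. Re (f x)) \<in> borel_measurable borel" "(\<lambda>x. Im (f x)) \<in> borel_measurable borel"
    using f by auto
  have "(\<lambda>x. of_real (of_int \<lfloor>real (Suc n) * Re (f x)\<rfloor> / real (Suc n)) +
             \<i> * of_real (of_int \<lfloor>real (Suc n) * Im (f x)\<rfloor> / real (Suc n))) \<in> borel_measurable borel"
    by measurable
  then show "round_grid n f \<in> borel_measurable borel"
    unfolding round_grid_def Complex_eq by simp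
  \<comment> \<open>Bounds the integer grid indices, so that the rounded function takes finitely
    many values.\<close>
  define K where "K = \<lceil>real (Suc n) * b\<rceil> + 1"
  have k: "\<lfloor>real (Suc n) * y\<rfloor> \<in> {-K..K}" if "\<bar>y\<bar> \<le> b" for y
  proof -
    have "\<bar>real (Suc n) * y\<bar> \<le> real (Suc n) * b"
      using that by (simp add: abs_mult mult_left_mono del: of_nat_Suc)
    then have "- (real (Suc n) * b) \<le> real (Suc n) * y" "real (Suc n) * y \<le> real (Suc n) * b"
      by linarith+
    then show ?thesis unfolding K_def atLeastAtMost_iff by linarith
  qed
  have "range (round_grid n f) \<subseteq> (\<lambda>(p, q). Complex (of_int p / real (Suc n)) (of_int q / real (Suc n))) ` ({-K..K} \<times> {-K..K})"
  proof
    fix z assume "z \<in> range (round_grid n f)"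
    then obtain x where x: "z = round_grid n f x" by blast
    have "\<lfloor>real (Suc n) * Re (f x)\<rfloor> \<in> {-K..K}" "\<lfloor>real (Suc n) * Im (f x)\<rfloor> \<in> {-K..K}"
      by (rule k, rule order_trans[OF abs_Re_le_cmod b], rule k, rule order_trans[OF abs_Im_le_cmod b])
    then show "z \<in> (\<lambda>(p, q). Complex (of_int p / real (Suc n)) (of_int q / real (Suc n))) ` ({-K..K} \<times> {-K..K})"
      unfolding x round_grid_def
      by (intro image_eqI[where x = "(\<lfloor>real (Suc n) * Re (f x)\<rfloor>, \<lfloor>real (Suc n) * Im (f x)\<rfloor>)"]) auto
  qed
  from finite_subset[OF this] show "finite (round_grid n f ` space borel)" by simp
qed

lemma round_grid_error_tendsto: "(\<lambda>n. 2 / real (Suc n)) \<longlonglongrightarrow> 0"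
  using tendsto_mult[OF tendsto_const[of 2] LIMSEQ_inverse_real_of_nat] by (simp add: divide_inverse)

text \<open>A \<open>bounded_borel\<close> function may be unbounded off the unit interval; cutting
  it off there makes its roundings simple.\<close>

definition restrict_unit :: "(real \<Rightarrow> complex) \<Rightarrow> real \<Rightarrow> complex" where
  "restrict_unit f x = indicator {0..1} x * f x"

lemma restrict_unit_eq [simp]: "x \<in> {0..1} \<Longrightarrow> restrict_unit f x = f x"
  by (simp add: restrict_unit_def)

lemma restrict_unit_bounded:
  assumes "bounded_borel f"
  shows "restrict_unit f \<in> borel_measurable borel" "\<exists>b. \<forall>x. cmod (restrict_unit f x) \<le> b"
proof -
  show "restrict_unit f \<in> borel_measurable borel"
    unfolding restrict_unit_def[abs_def]
    by (intro borel_measurable_times borel_measurable_indicator bounded_borel_measurable[OF assms]) auto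
  obtain b where "b \<ge> 0" "\<And>x. x \<in> {0..1} \<Longrightarrow> cmod (f x) \<le> b" using bounded_borelD[OF assms] by metis
  then have "\<forall>x. cmod (restrict_unit f x) \<le> b" by (auto simp: restrict_unit_def indicator_def)
  then show "\<exists>b. \<forall>x. cmod (restrict_unit f x) \<le> b" by blast
qed

lemma simple_function_round_restrict: "bounded_borel f \<Longrightarrow> simple_function borel (round_grid n (restrict_unit f))"
  using restrict_unit_bounded[of f] simple_function_round_grid by blast

definition simple_approx :: "(real \<Rightarrow> complex) \<Rightarrow> (nat \<Rightarrow> real \<Rightarrow> complex) \<Rightarrow> bool" where
  "simple_approx f p \<longleftrightarrow> (\<forall>n. simple_function borel (p n)) \<and>
     (\<exists>d. d \<longlonglongrightarrow> 0 \<and> (\<forall>n. \<forall>x\<in>{0..1}. cmod (p n x - f x) \<le> d n))"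

lemma simple_approx_round_grid:
  assumes "bounded_borel f" shows "simple_approx f (\<lambda>n. round_grid n (restrict_unit f))"
proof -
  have "cmod (round_grid n (restrict_unit f) x - f x) \<le> 2 / real (Suc n)" if "x \<in> {0..1}" for n x
    using round_grid_error[of n "restrict_unit f" x] that by simp
  then show ?thesis
    unfolding simple_approx_def
    by (intro conjI allI simple_function_round_restrict assms exI[of _ "\<lambda>n. 2 / real (Suc n)"]
          round_grid_error_tendsto ballI)
qed

lemma simple_function_bounded:
  assumes "simple_function borel p" obtains b where "\<And>x :: real. cmod (p x) \<le> b"
proof -
  have "finite (range p)" using assms by (simp add: simple_function_def)
  then have "bounded (range p)" by (rule finite_imp_bounded)
  then show thesis using that unfolding bounded_iff by blast
qed

lemma simple_approx_uniform_limit: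
  assumes p: "\<And>n. simple_function borel (p n)" and lim: "uniform_limit UNIV p f sequentially"
    and f: "bounded_borel f"
  shows "simple_approx f p"
proof -
  obtain b where b: "\<And>x. x \<in> {0..1} \<Longrightarrow> cmod (f x) \<le> b" using bounded_borelD[OF f] by metis
  define d where "d n = (SUP x\<in>{0..1}. cmod (p n x - f x))" for n
  have bdd: "bdd_above ((\<lambda>x. cmod (p n x - f x)) ` {0..1})" for n
  proof -
    obtain a where a: "\<And>x. cmod (p n x) \<le> a" using simple_function_bounded[OF p[of n]] by metis
    have "cmod (p n x - f x) \<le> a + b" if "x \<in> {0..1}" for x
      using norm_triangle_ineq4[of "p n x" "f x"] a[of x] b[OF that] by linarith
    then show ?thesis by (intro bdd_aboveI2) auto
  qed
  have le: "cmod (p n x - f x) \<le> d n" if "x \<in> {0..1}" for n x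
    unfolding d_def using cSUP_upper[OF that bdd] .
  have "d \<longlonglongrightarrow> 0"
  proof (rule tendstoI)
    fix e :: real assume e: "e > 0"
    then have "\<forall>\<^sub>F n in sequentially. \<forall>x\<in>UNIV. dist (p n x) (f x) < e / 2"
      using lim unfolding uniform_limit_iff by (meson half_gt_zero)
    then show "\<forall>\<^sub>F n in sequentially. dist (d n) 0 < e"
    proof eventually_elim
      case (elim n)
      have "d n \<le> e / 2" unfolding d_def
        using elim by (intro cSUP_least) (auto simp: dist_norm less_imp_le)
      moreover have "d n \<ge> 0" using order_trans[OF norm_ge_zero le[of 0 n]] by simp
      ultimately show ?case using e by simp
    qed
  qed
  then show ?thesis unfolding simple_approx_def using p le by blast
qed

section \<open>Finitely additive set functions and integrals of simple functions\<close>

definition finitely_additive :: "(real set \<Rightarrow> complex) \<Rightarrow> bool" where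
  "finitely_additive \<mu> \<longleftrightarrow> \<mu> {} = 0 \<and>
     (\<forall>A\<in>sets borel. \<forall>B\<in>sets borel. A \<inter> B = {} \<longrightarrow> \<mu> (A \<union> B) = \<mu> A + \<mu> B)"

lemma sigma_additive_imp_finitely_additive:
  assumes "sigma_additive \<mu>" shows "finitely_additive \<mu>"
proof -
  have "(\<lambda>n::nat. \<mu> {}) sums \<mu> (\<Union>n::nat. {})"
    using assms[unfolded sigma_additive_def, rule_format, of "\<lambda>_. {}"] by (simp add: disjoint_family_on_def)
  then have "summable (\<lambda>n::nat. \<mu> {})" by (rule sums_summable)
  then have e: "\<mu> {} = 0" by (simp add: summable_const_iff)
  have "\<mu> (A \<union> B) = \<mu> A + \<mu> B" if "A \<in> sets borel" "B \<in> sets borel" "A \<inter> B = {}" for A B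
  proof -
    have "range (binaryset A B) \<subseteq> sets borel" using that by (auto simp: range_binaryset_eq)
    moreover have "disjoint_family (binaryset A B)"
      using that by (auto simp: disjoint_family_on_def binaryset_def)
    ultimately have "(\<lambda>n. \<mu> (binaryset A B n)) sums \<mu> (\<Union>n. binaryset A B n)"
      using assms unfolding sigma_additive_def by blast
    moreover have "(\<lambda>n. \<mu> (binaryset A B n)) sums (\<mu> A + \<mu> B)"
      using e by (rule binaryset_sums)
    ultimately show ?thesis using sums_unique2 by (simp add: UN_binaryset_eq)
  qed
  with e show ?thesis unfolding finitely_additive_def by blast
qed

lemma finitely_additive_sum:
  assumes \<mu>: "finitely_additive \<mu>" and I: "finite I"
    and A: "\<And>i. i \<in> I \<Longrightarrow> A i \<in> sets borel" "disjoint_family_on A I"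
  shows "\<mu> (\<Union>i\<in>I. A i) = (\<Sum>i\<in>I. \<mu> (A i))"
  using I A
proof (induction I)
  case empty
  then show ?case using \<mu> by (simp add: finitely_additive_def)
next
  case (insert i I)
  have "A i \<inter> (\<Union>j\<in>I. A j) = {}"
    using insert.hyps insert.prems(2) by (auto simp: disjoint_family_on_def)
  moreover have "(\<Union>j\<in>I. A j) \<in> sets borel" using insert by auto
  ultimately have "\<mu> (A i \<union> (\<Union>j\<in>I. A j)) = \<mu> (A i) + \<mu> (\<Union>j\<in>I. A j)"
    using \<mu> insert.prems(1)[of i] unfolding finitely_additive_def by blast
  moreover have "\<mu> (\<Union>j\<in>I. A j) = (\<Sum>j\<in>I. \<mu> (A j))"
    using insert.prems by (intro insert.IH) (auto simp: disjoint_family_on_def)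
  ultimately show ?case using insert.hyps by simp
qed

definition simple_integral_wrt :: "(real set \<Rightarrow> complex) \<Rightarrow> (real \<Rightarrow> complex) \<Rightarrow> complex" where
  "simple_integral_wrt \<mu> p = (\<Sum>a\<in>range p. a * \<mu> (p -` {a}))"

text \<open>The integral of a simple function may be computed over the fibres of any finite
  measurable map through which it factors. Applied to the pair of two simple functions, this yields
  additivity over a common refinement.\<close>

lemma simple_integral_wrt_comp:
  fixes \<pi> :: "real \<Rightarrow> 'c"
  assumes \<mu>: "finitely_additive \<mu>" and fin: "finite (range \<pi>)"
    and meas: "\<And>x. \<pi> -` {x} \<in> sets borel"
  shows "simple_integral_wrt \<mu> (\<lambda>s. f (\<pi> s)) = (\<Sum>x\<in>range \<pi>. f x * \<mu> (\<pi> -` {x}))"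
proof -
  have "(\<Sum>x\<in>range \<pi>. f x * \<mu> (\<pi> -` {x}))
      = (\<Sum>a\<in>f ` range \<pi>. \<Sum>x\<in>{x \<in> range \<pi>. f x = a}. f x * \<mu> (\<pi> -` {x}))"
    using fin by (rule sum.image_gen)
  also have "\<dots> = (\<Sum>a\<in>f ` range \<pi>. a * \<mu> ((\<lambda>s. f (\<pi> s)) -` {a}))"
  proof (rule sum.cong[OF refl])
    fix a
    have "(\<lambda>s. f (\<pi> s)) -` {a} = (\<Union>x\<in>{x \<in> range \<pi>. f x = a}. \<pi> -` {x})" by auto
    also have "\<mu> \<dots> = (\<Sum>x\<in>{x \<in> range \<pi>. f x = a}. \<mu> (\<pi> -` {x}))"
      using fin meas by (intro finitely_additive_sum[OF \<mu>]) (auto simp: disjoint_family_on_def)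
    finally have "a * \<mu> ((\<lambda>s. f (\<pi> s)) -` {a}) = (\<Sum>x\<in>{x \<in> range \<pi>. f x = a}. a * \<mu> (\<pi> -` {x}))"
      by (simp add: sum_distrib_left)
    then show "(\<Sum>x\<in>{x \<in> range \<pi>. f x = a}. f x * \<mu> (\<pi> -` {x})) = a * \<mu> ((\<lambda>s. f (\<pi> s)) -` {a})"
      by (auto intro!: sum.cong)
  qed
  finally show ?thesis unfolding simple_integral_wrt_def by (simp add: image_image)
qed

lemma simple_function_vimage:
  assumes "simple_function borel p" shows "p -` {a} \<in> sets (borel :: real measure)"
  using simple_functionD(2)[OF assms, of "{a}"] by simp

lemma simple_integral_wrt_add:
  assumes \<mu>: "finitely_additive \<mu>" and p: "simple_function borel p" and q: "simple_function borel q"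
  shows "simple_integral_wrt \<mu> (\<lambda>x. p x + q x) = simple_integral_wrt \<mu> p + simple_integral_wrt \<mu> q"
proof -
  define \<pi> where "\<pi> s = (p s, q s)" for s
  have "range \<pi> \<subseteq> range p \<times> range q" by (auto simp: \<pi>_def)
  moreover have "finite (range p \<times> range q)" using p q by (auto simp: simple_function_def)
  ultimately have fin: "finite (range \<pi>)" by (rule finite_subset)
  have meas: "\<pi> -` {x} \<in> sets borel" for x
  proof -
    have "\<pi> -` {x} = p -` {fst x} \<inter> q -` {snd x}" by (auto simp: \<pi>_def)
    then show ?thesis using simple_function_vimage[OF p] simple_function_vimage[OF q] by auto
  qed
  note c = simple_integral_wrt_comp[OF \<mu> fin meas]
  show ?thesis
    using c[of "\<lambda>z. fst z + snd z"] c[of fst] c[of snd]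
    by (simp add: \<pi>_def[abs_def] algebra_simps flip: sum.distrib)
qed

lemma simple_integral_wrt_scale:
  assumes \<mu>: "finitely_additive \<mu>" and p: "simple_function borel p"
  shows "simple_integral_wrt \<mu> (\<lambda>x. c * p x) = c * simple_integral_wrt \<mu> p"
proof -
  have fin: "finite (range p)" using p by (simp add: simple_function_def)
  note c = simple_integral_wrt_comp[OF \<mu> fin simple_function_vimage[OF p]]
  show ?thesis using c[of "\<lambda>z. c * z"] c[of "\<lambda>z. z"] by (simp add: sum_distrib_left mult_ac)
qed

lemma simple_bimeasure_integral_swap:
  "simple_bimeasure_integral \<gamma> p q = simple_bimeasure_integral (\<lambda>A B. \<gamma> B A) q p"
  unfolding simple_bimeasure_integral_def by (subst sum.swap) (simp add: mult_ac)

lemma simple_bimeasure_integral_iterated: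
  "simple_bimeasure_integral \<gamma> p q = simple_integral_wrt (\<lambda>A. simple_integral_wrt (\<gamma> A) q) p"
  unfolding simple_bimeasure_integral_def simple_integral_wrt_def
  by (simp add: sum_distrib_left mult_ac)

text \<open>The conditions on a bimeasure supported in the unit interval that turn its integral of
  simple functions into a \<open>bounded_form\<close>. They are symmetric in the two arguments, so
  linearity is proved in the first and transferred to the second.\<close>

locale supported_bimeasure =
  fixes \<gamma> :: "real set \<Rightarrow> real set \<Rightarrow> complex"
  assumes additive_left: "\<And>B. B \<in> sets borel \<Longrightarrow> finitely_additive (\<lambda>A. \<gamma> A B)"
    and additive_right: "\<And>A. A \<in> sets borel \<Longrightarrow> finitely_additive (\<lambda>B. \<gamma> A B)"
    and semivariation: "finite_semivariation \<gamma>"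
    and null_left: "\<And>A B. A \<in> sets borel \<Longrightarrow> B \<in> sets borel \<Longrightarrow> A \<inter> {0..1} = {} \<Longrightarrow> \<gamma> A B = 0"
    and null_right: "\<And>A B. A \<in> sets borel \<Longrightarrow> B \<in> sets borel \<Longrightarrow> B \<inter> {0..1} = {} \<Longrightarrow> \<gamma> A B = 0"
begin

lemma simple_add_left:
  assumes "simple_function borel p" "simple_function borel p'" "simple_function borel q"
  shows "simple_bimeasure_integral \<gamma> (\<lambda>x. p x + p' x) q =
         simple_bimeasure_integral \<gamma> p q + simple_bimeasure_integral \<gamma> p' q"
proof -
  have "finitely_additive (\<lambda>A. simple_integral_wrt (\<gamma> A) q)"
    using additive_left[OF simple_function_vimage[OF assms(3)]]
    by (auto simp: finitely_additive_def simple_integral_wrt_def algebra_simps sum.distrib)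
  then show ?thesis
    unfolding simple_bimeasure_integral_iterated by (rule simple_integral_wrt_add[OF _ assms(1,2)])
qed

lemma simple_scale_left:
  assumes "simple_function borel p" "simple_function borel q"
  shows "simple_bimeasure_integral \<gamma> (\<lambda>x. c * p x) q = c * simple_bimeasure_integral \<gamma> p q"
proof -
  have "finitely_additive (\<lambda>A. simple_integral_wrt (\<gamma> A) q)"
    using additive_left[OF simple_function_vimage[OF assms(2)]]
    by (auto simp: finitely_additive_def simple_integral_wrt_def algebra_simps sum.distrib)
  then show ?thesis
    unfolding simple_bimeasure_integral_iterated by (rule simple_integral_wrt_scale[OF _ assms(1)])
qed

text \<open>The bound must use suprema over the unit interval, while semivariation runs over
  partitions of the line. On level sets of \<open>p\<close> and \<open>q\<close> that meet the unit
  interval the values are divided by \<open>a\<close> and \<open>b\<close>, giving scalars of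
  modulus at most 1; on the other level sets they are replaced by 0, since \<open>\<gamma>\<close>
  vanishes there.\<close>

lemma simple_bound:
  "\<exists>C\<ge>0. \<forall>p q a b. simple_function borel p \<longrightarrow> simple_function borel q \<longrightarrow>
     (\<forall>x\<in>{0..1}. cmod (p x) \<le> a) \<longrightarrow> (\<forall>x\<in>{0..1}. cmod (q x) \<le> b) \<longrightarrow>
     cmod (simple_bimeasure_integral \<gamma> p q) \<le> C * a * b"
proof -
  obtain C where C: "\<forall>\<A> \<B> a b.
        finite \<A> \<and> partition_on UNIV \<A> \<and> \<A> \<subseteq> sets borel \<and>
        finite \<B> \<and> partition_on UNIV \<B> \<and> \<B> \<subseteq> sets borel \<and>
        (\<forall>A\<in>\<A>. cmod (a A) \<le> 1) \<and> (\<forall>B\<in>\<B>. cmod (b B) \<le> 1) \<longrightarrow>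
        cmod (\<Sum>A\<in>\<A>. \<Sum>B\<in>\<B>. a A * b B * \<gamma> A B) \<le> C"
    using semivariation unfolding finite_semivariation_def by blast
  have "cmod (simple_bimeasure_integral \<gamma> p q) \<le> max C 0 * a * b"
    if p: "simple_function borel p" and q: "simple_function borel q"
      and a: "\<forall>x\<in>{0..1}. cmod (p x) \<le> a" and b: "\<forall>x\<in>{0..1}. cmod (q x) \<le> b" for p q a b
  proof -
    define cell where "cell r x = r -` {x}" for r :: "real \<Rightarrow> complex" and x
    \<comment> \<open>\<open>SOME\<close> recovers the value of \<open>r\<close> from its level set,
      since the scalars of the semivariation are indexed by sets. For \<open>c = 0\<close> the
      quotient is 0, which agrees with \<open>veq\<close> because the value itself is then
      0.\<close>
    define v where "v r c A = (if A \<inter> {0..1} = {} then 0 else r (SOME s. s \<in> A) / of_real c)"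
      for r :: "real \<Rightarrow> complex" and c :: real and A
    have a0: "a \<ge> 0" and b0: "b \<ge> 0"
      using order_trans[OF norm_ge_zero a[rule_format, of 0]] order_trans[OF norm_ge_zero b[rule_format, of 0]] by auto
    have fin: "finite (cell r ` range r)" if "simple_function borel r" for r
      using that by (simp add: simple_function_def)
    have part: "partition_on UNIV (cell r ` range r)" for r
      by (rule partition_onI) (auto simp: cell_def disjnt_def)
    have bor: "cell r ` range r \<subseteq> sets borel" if "simple_function borel r" for r
      using simple_function_vimage[OF that] by (auto simp: cell_def)
    have some: "r (SOME s. s \<in> cell r x) = x" if "x \<in> range r" for r x
    proof -
      have "\<exists>s. s \<in> cell r x" using that by (auto simp: cell_def)
      from someI_ex[OF this] show ?thesis by (simp add: cell_def)
    qed
    have vle: "cmod (v r c A) \<le> 1" if rc: "\<forall>x\<in>{0..1}. cmod (r x) \<le> c" and A: "A \<in> cell r ` range r" for r c A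
    proof (cases "A \<inter> {0..1} = {}")
      case False
      obtain x where x: "A = cell r x" "x \<in> range r" using A by blast
      obtain s where s: "s \<in> {0..1}" "s \<in> A" using False by blast
      then have "r s = x" using x(1) by (simp add: cell_def)
      with s have "\<exists>s\<in>{0..1}. r s = x" by blast
      then have "cmod x \<le> c" using rc by blast
      then show ?thesis
        using False some[OF x(2)] x(1) order_trans[OF norm_ge_zero \<open>cmod x \<le> c\<close>]
        by (auto simp: v_def norm_divide divide_le_eq_1 less_le)
    qed (simp add: v_def)
    have veq: "of_real c * v r c (cell r x) = x"
      if rc: "\<forall>x\<in>{0..1}. cmod (r x) \<le> c" and x: "x \<in> range r" and ne: "cell r x \<inter> {0..1} \<noteq> {}" for r c x
    proof -
      obtain s where "s \<in> {0..1}" "s \<in> cell r x" using ne by blast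
      then have "\<exists>s\<in>{0..1}. r s = x" by (auto simp only: cell_def vimage_singleton_eq)
      then have "c = 0 \<Longrightarrow> x = 0" using rc by fastforce
      then show ?thesis using ne some[OF x] by (simp add: v_def)
    qed
    have inj: "inj_on (cell r) (range r)" for r by (auto simp: inj_on_def cell_def)
    have "simple_bimeasure_integral \<gamma> p q =
        (\<Sum>x\<in>range p. \<Sum>y\<in>range q. (of_real a * v p a (cell p x)) * (of_real b * v q b (cell q y)) * \<gamma> (cell p x) (cell q y))"
      unfolding simple_bimeasure_integral_def cell_def[symmetric]
    proof (intro sum.cong refl)
      fix x y assume xy: "x \<in> range p" "y \<in> range q"
      have m: "cell p x \<in> sets borel" "cell q y \<in> sets borel" using bor[OF p] bor[OF q] xy by auto
      show "x * y * \<gamma> (cell p x) (cell q y) = (of_real a * v p a (cell p x)) * (of_real b * v q b (cell q y)) * \<gamma> (cell p x) (cell q y)"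
      proof (cases "cell p x \<inter> {0..1} = {} \<or> cell q y \<inter> {0..1} = {}")
        case True
        then have "\<gamma> (cell p x) (cell q y) = 0" using null_left null_right m by blast
        then show ?thesis by simp
      next
        case False
        then show ?thesis using veq[OF a xy(1)] veq[OF b xy(2)] by simp
      qed
    qed
    also have "\<dots> = (\<Sum>A\<in>cell p ` range p. \<Sum>B\<in>cell q ` range q. (of_real a * v p a A) * (of_real b * v q b B) * \<gamma> A B)"
      by (simp add: sum.reindex[OF inj])
    also have "\<dots> = of_real (a * b) * (\<Sum>A\<in>cell p ` range p. \<Sum>B\<in>cell q ` range q. v p a A * v q b B * \<gamma> A B)"
      by (simp add: sum_distrib_left mult_ac)
    finally have "cmod (simple_bimeasure_integral \<gamma> p q) = (a * b) * cmod (\<Sum>A\<in>cell p ` range p. \<Sum>B\<in>cell q ` range q. v p a A * v q b B * \<gamma> A B)"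
      using a0 b0 by (simp add: norm_mult)
    also have "\<dots> \<le> (a * b) * C"
    proof (rule mult_left_mono)
      show "cmod (\<Sum>A\<in>cell p ` range p. \<Sum>B\<in>cell q ` range q. v p a A * v q b B * \<gamma> A B) \<le> C"
      proof -
        have "finite (cell p ` range p)" "finite (cell q ` range q)" by (rule fin[OF p], rule fin[OF q])
        moreover have "partition_on UNIV (cell p ` range p)" "partition_on UNIV (cell q ` range q)" by (rule part)+
        moreover have "cell p ` range p \<subseteq> sets borel" "cell q ` range q \<subseteq> sets borel" by (rule bor[OF p], rule bor[OF q])
        moreover have "\<forall>A\<in>cell p ` range p. cmod (v p a A) \<le> 1" by (rule ballI) (rule vle[OF a])
        moreover have "\<forall>B\<in>cell q ` range q. cmod (v q b B) \<le> 1" by (rule ballI) (rule vle[OF b])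
        ultimately show ?thesis
          using C[THEN spec, of "cell p ` range p", THEN spec, of "cell q ` range q", THEN spec, of "v p a", THEN spec, of "v q b"]
          by satx
      qed
      show "0 \<le> a * b" using a0 b0 by simp
    qed
    also have "\<dots> \<le> (a * b) * max C 0" using a0 b0 by (intro mult_left_mono) auto
    finally show ?thesis by (simp add: mult_ac)
  qed
  then show ?thesis by (intro exI[of _ "max C 0"]) auto
qed

text \<open>Fixed by choice, so that the bound can be passed to \<open>bounded_form\<close> as a
  parameter.\<close>

definition form_bound :: real where
  "form_bound = (SOME C. C \<ge> 0 \<and> (\<forall>p q a b. simple_function borel p \<longrightarrow> simple_function borel q \<longrightarrow>
     (\<forall>x\<in>{0..1}. cmod (p x) \<le> a) \<longrightarrow> (\<forall>x\<in>{0..1}. cmod (q x) \<le> b) \<longrightarrow>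
     cmod (simple_bimeasure_integral \<gamma> p q) \<le> C * a * b))"

lemma form_bound_spec:
  "form_bound \<ge> 0 \<and> (\<forall>p q a b. simple_function borel p \<longrightarrow> simple_function borel q \<longrightarrow>
     (\<forall>x\<in>{0..1}. cmod (p x) \<le> a) \<longrightarrow> (\<forall>x\<in>{0..1}. cmod (q x) \<le> b) \<longrightarrow>
     cmod (simple_bimeasure_integral \<gamma> p q) \<le> form_bound * a * b)"
  unfolding form_bound_def by (rule someI_ex[OF simple_bound])

lemma form_bound_nonneg: "form_bound \<ge> 0"
  using form_bound_spec by (rule conjunct1)

lemma form_bound:
  assumes "simple_function borel p" "simple_function borel q"
    and "\<And>x. x \<in> {0..1} \<Longrightarrow> cmod (p x) \<le> a" "\<And>x. x \<in> {0..1} \<Longrightarrow> cmod (q x) \<le> b"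
  shows "cmod (simple_bimeasure_integral \<gamma> p q) \<le> form_bound * a * b"
proof -
  have "\<forall>x\<in>{0..1}. cmod (p x) \<le> a" "\<forall>x\<in>{0..1}. cmod (q x) \<le> b"
    by (rule ballI, rule assms, assumption)+
  with form_bound_spec[THEN conjunct2, THEN spec, of p, THEN spec, of q, THEN spec, of a, THEN spec, of b] assms(1,2)
  show ?thesis by satx
qed

end

lemma supported_bimeasure_swap:
  assumes "supported_bimeasure \<gamma>" shows "supported_bimeasure (\<lambda>A B. \<gamma> B A)"
proof -
  interpret supported_bimeasure \<gamma> by (rule assms)
  have "finite_semivariation (\<lambda>A B. \<gamma> B A)"
  proof -
    obtain C where C: "\<forall>\<A> \<B> a b.
          finite \<A> \<and> partition_on UNIV \<A> \<and> \<A> \<subseteq> sets borel \<and>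
          finite \<B> \<and> partition_on UNIV \<B> \<and> \<B> \<subseteq> sets borel \<and>
          (\<forall>A\<in>\<A>. cmod (a A) \<le> 1) \<and> (\<forall>B\<in>\<B>. cmod (b B) \<le> 1) \<longrightarrow>
          cmod (\<Sum>A\<in>\<A>. \<Sum>B\<in>\<B>. a A * b B * \<gamma> A B) \<le> C"
      using semivariation unfolding finite_semivariation_def by blast
    have "cmod (\<Sum>A\<in>\<A>. \<Sum>B\<in>\<B>. a A * b B * \<gamma> B A) \<le> C"
      if "finite \<A> \<and> partition_on UNIV \<A> \<and> \<A> \<subseteq> sets borel \<and>
          finite \<B> \<and> partition_on UNIV \<B> \<and> \<B> \<subseteq> sets borel \<and>
          (\<forall>A\<in>\<A>. cmod (a A) \<le> 1) \<and> (\<forall>B\<in>\<B>. cmod (b B) \<le> 1)" for \<A> \<B> a b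
    proof -
      have "(\<Sum>A\<in>\<A>. \<Sum>B\<in>\<B>. a A * b B * \<gamma> B A) = (\<Sum>B\<in>\<B>. \<Sum>A\<in>\<A>. b B * a A * \<gamma> B A)"
        by (subst sum.swap) (simp add: mult_ac)
      with C[THEN spec, of \<B>, THEN spec, of \<A>, THEN spec, of b, THEN spec, of a] that
      show ?thesis by (auto simp only:)
    qed
    then show ?thesis unfolding finite_semivariation_def by blast
  qed
  then show ?thesis
    using additive_left additive_right null_left null_right by unfold_locales auto
qed

context supported_bimeasure
begin

lemma simple_add_right:
  assumes "simple_function borel p" "simple_function borel q" "simple_function borel q'"
  shows "simple_bimeasure_integral \<gamma> p (\<lambda>x. q x + q' x) =
         simple_bimeasure_integral \<gamma> p q + simple_bimeasure_integral \<gamma> p q'"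
  using supported_bimeasure.simple_add_left[OF supported_bimeasure_swap[OF supported_bimeasure_axioms] assms(2,3,1)]
  by (simp add: simple_bimeasure_integral_swap[of \<gamma>])

lemma simple_scale_right:
  assumes "simple_function borel p" "simple_function borel q"
  shows "simple_bimeasure_integral \<gamma> p (\<lambda>x. c * q x) = c * simple_bimeasure_integral \<gamma> p q"
  using supported_bimeasure.simple_scale_left[OF supported_bimeasure_swap[OF supported_bimeasure_axioms] assms(2,1)]
  by (simp add: simple_bimeasure_integral_swap[of \<gamma>])

lemma simple_diff_bound:
  assumes s: "simple_function borel p" "simple_function borel p'" "simple_function borel q" "simple_function borel q'"
    and d: "\<And>x. x \<in> {0..1} \<Longrightarrow> cmod (p x - p' x) \<le> d" and e: "\<And>x. x \<in> {0..1} \<Longrightarrow> cmod (q x - q' x) \<le> e"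
    and b: "\<And>x. x \<in> {0..1} \<Longrightarrow> cmod (q x) \<le> b" and a: "\<And>x. x \<in> {0..1} \<Longrightarrow> cmod (p' x) \<le> a"
  shows "cmod (simple_bimeasure_integral \<gamma> p q - simple_bimeasure_integral \<gamma> p' q') \<le> form_bound * d * b + form_bound * a * e"
proof -
  have s': "simple_function borel (\<lambda>x. -1 * p' x)" "simple_function borel (\<lambda>x. -1 * q' x)"
    using s by (intro simple_function_mult simple_function_const; simp)+
  have "simple_bimeasure_integral \<gamma> p q - simple_bimeasure_integral \<gamma> p' q' =
     (simple_bimeasure_integral \<gamma> p q + simple_bimeasure_integral \<gamma> (\<lambda>x. -1 * p' x) q) +
     (simple_bimeasure_integral \<gamma> p' q + simple_bimeasure_integral \<gamma> p' (\<lambda>x. -1 * q' x))"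
    unfolding simple_scale_left[OF s(2,3)] simple_scale_right[OF s(2,4)] by simp
  also have "\<dots> = simple_bimeasure_integral \<gamma> (\<lambda>x. p x + -1 * p' x) q + simple_bimeasure_integral \<gamma> p' (\<lambda>x. q x + -1 * q' x)"
    using s s' by (simp only: simple_add_left simple_add_right)
  also have "cmod \<dots> \<le> form_bound * d * b + form_bound * a * e"
    using s s' d e a b
    by (intro norm_triangle_mono form_bound simple_function_add) auto
  finally show ?thesis .
qed

lemma simple_approx_diff:
  assumes f: "bounded_borel f" and g: "bounded_borel g"
    and p: "simple_approx f p" "simple_approx f p'" and q: "simple_approx g q" "simple_approx g q'"
  shows "(\<lambda>n. simple_bimeasure_integral \<gamma> (p n) (q n) - simple_bimeasure_integral \<gamma> (p' n) (q' n)) \<longlonglongrightarrow> 0"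
proof -
  obtain a where a: "\<And>x. x \<in> {0..1} \<Longrightarrow> cmod (f x) \<le> a" using bounded_borelD[OF f] by metis
  obtain b where b: "\<And>x. x \<in> {0..1} \<Longrightarrow> cmod (g x) \<le> b" using bounded_borelD[OF g] by metis
  obtain d where d: "d \<longlonglongrightarrow> 0" "\<And>n x. x \<in> {0..1} \<Longrightarrow> cmod (p n x - f x) \<le> d n"
    using p(1) unfolding simple_approx_def by metis
  obtain d' where d': "d' \<longlonglongrightarrow> 0" "\<And>n x. x \<in> {0..1} \<Longrightarrow> cmod (p' n x - f x) \<le> d' n"
    using p(2) unfolding simple_approx_def by metis
  obtain e where e: "e \<longlonglongrightarrow> 0" "\<And>n x. x \<in> {0..1} \<Longrightarrow> cmod (q n x - g x) \<le> e n"
    using q(1) unfolding simple_approx_def by metis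
  obtain e' where e': "e' \<longlonglongrightarrow> 0" "\<And>n x. x \<in> {0..1} \<Longrightarrow> cmod (q' n x - g x) \<le> e' n"
    using q(2) unfolding simple_approx_def by metis
  have tri: "cmod (u - w) \<le> s + t" if "cmod (u - v) \<le> s" "cmod (w - v) \<le> t" for u v w s t
    using norm_triangle_ineq4[of "u - v" "w - v"] that by simp
  have tri2: "cmod u \<le> s + t" if "cmod (u - v) \<le> s" "cmod v \<le> t" for u v s t
    using norm_triangle_sub[of u v] that by simp
  have pd: "cmod (p n x - p' n x) \<le> d n + d' n" "cmod (q n x - q' n x) \<le> e n + e' n"
    "cmod (q n x) \<le> e n + b" "cmod (p' n x) \<le> d' n + a" if "x \<in> {0..1}" for n x
    using tri[OF d(2) d'(2)] tri[OF e(2) e'(2)] tri2[OF e(2) b] tri2[OF d'(2) a] that by auto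
  have sf: "simple_function borel (p n)" "simple_function borel (p' n)"
    "simple_function borel (q n)" "simple_function borel (q' n)" for n
    using p q by (auto simp: simple_approx_def)
  have "cmod (simple_bimeasure_integral \<gamma> (p n) (q n) - simple_bimeasure_integral \<gamma> (p' n) (q' n))
     \<le> form_bound * (d n + d' n) * (e n + b) + form_bound * (d' n + a) * (e n + e' n)" for n
    by (intro simple_diff_bound sf pd)
  moreover have "(\<lambda>n. form_bound * (d n + d' n) * (e n + b) + form_bound * (d' n + a) * (e n + e' n)) \<longlonglongrightarrow> 0"
    using d(1) d'(1) e(1) e'(1) by (auto intro!: tendsto_eq_intros)
  ultimately show ?thesis by (rule Lim_null_comparison[OF always_eventually[OF allI]])
qed

lemma round_grid_Cauchy:
  assumes f: "bounded_borel f" and g: "bounded_borel g"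
  shows "Cauchy (\<lambda>n. simple_bimeasure_integral \<gamma> (round_grid n (restrict_unit f)) (round_grid n (restrict_unit g)))"
proof -
  obtain a where a: "a \<ge> 0" "\<And>x. x \<in> {0..1} \<Longrightarrow> cmod (f x) \<le> a" using bounded_borelD[OF f] by metis
  obtain b where b: "b \<ge> 0" "\<And>x. x \<in> {0..1} \<Longrightarrow> cmod (g x) \<le> b" using bounded_borelD[OF g] by metis
  have tri: "cmod (u - w) \<le> s + t" if "cmod (u - v) \<le> s" "cmod (w - v) \<le> t" for u v w s t
    using norm_triangle_ineq4[of "u - v" "w - v"] that by simp
  have tri2: "cmod u \<le> s + t" if "cmod (u - v) \<le> s" "cmod v \<le> t" for u v s t
    using norm_triangle_sub[of u v] that by simp
  have er: "cmod (round_grid n (restrict_unit h) x - h x) \<le> 2 / real (Suc n)" if "x \<in> {0..1}" for n h x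
    using round_grid_error[of n "restrict_unit h" x] that by simp
  have le2: "2 / real (Suc n) \<le> 2" for n by (simp add: field_simps)
  \<comment> \<open>Both error terms carry the factor
    \<open>2 / real (Suc n) + 2 / real (Suc m)\<close>, against the bounds \<open>2 + b\<close> and
    \<open>2 + a\<close>; the added 1 keeps \<open>K\<close> positive.\<close>
  define K where "K = 2 * form_bound * (a + b + 4) + 1"
  have K: "K > 0" using form_bound_nonneg a b by (simp add: K_def add_nonneg_pos)
  have est: "cmod (simple_bimeasure_integral \<gamma> (round_grid n (restrict_unit f)) (round_grid n (restrict_unit g))
        - simple_bimeasure_integral \<gamma> (round_grid m (restrict_unit f)) (round_grid m (restrict_unit g))) \<le> K * (1 / real (Suc n) + 1 / real (Suc m))" for n m
  proof -
    let ?d = "2 / real (Suc n) + 2 / real (Suc m)"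
    have "cmod (simple_bimeasure_integral \<gamma> (round_grid n (restrict_unit f)) (round_grid n (restrict_unit g))
        - simple_bimeasure_integral \<gamma> (round_grid m (restrict_unit f)) (round_grid m (restrict_unit g))) \<le> form_bound * ?d * (2 + b) + form_bound * (2 + a) * ?d"
    proof (intro simple_diff_bound simple_function_round_restrict f g)
      fix x :: real assume x: "x \<in> {0..1}"
      show "cmod (round_grid n (restrict_unit f) x - round_grid m (restrict_unit f) x) \<le> ?d" "cmod (round_grid n (restrict_unit g) x - round_grid m (restrict_unit g) x) \<le> ?d"
        by (rule tri[OF er er]; fact x)+
      show "cmod (round_grid n (restrict_unit g) x) \<le> 2 + b" "cmod (round_grid m (restrict_unit f) x) \<le> 2 + a"
        using tri2[OF er[OF x, of n g] b(2)[OF x]] tri2[OF er[OF x, of m f] a(2)[OF x]] le2[of n] le2[of m]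
        by linarith+
    qed
    also have "\<dots> = (K - 1) * (1 / real (Suc n) + 1 / real (Suc m))"
      by (simp add: K_def algebra_simps add_divide_distrib)
    also have "\<dots> \<le> K * (1 / real (Suc n) + 1 / real (Suc m))"
      by (intro mult_right_mono) auto
    finally show ?thesis .
  qed
  show ?thesis
  proof (rule CauchyI)
    fix \<epsilon> :: real assume \<epsilon>: "\<epsilon> > 0"
    obtain N where N: "1 / real (Suc N) < \<epsilon> / (2 * K)"
      using nat_approx_posE[of "\<epsilon> / (2 * K)"] \<epsilon> K by auto
    have "cmod (simple_bimeasure_integral \<gamma> (round_grid n (restrict_unit f)) (round_grid n (restrict_unit g))
        - simple_bimeasure_integral \<gamma> (round_grid m (restrict_unit f)) (round_grid m (restrict_unit g))) < \<epsilon>" if "n \<ge> N" "m \<ge> N" for n m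
    proof -
      have "1 / real (Suc n) \<le> 1 / real (Suc N)" "1 / real (Suc m) \<le> 1 / real (Suc N)"
        using that by (auto intro!: divide_left_mono)
      moreover have "\<epsilon> / (2 * K) + \<epsilon> / (2 * K) = \<epsilon> / K" using K by (simp add: field_simps)
      ultimately have "1 / real (Suc n) + 1 / real (Suc m) < \<epsilon> / K" using N by linarith
      then have "K * (1 / real (Suc n) + 1 / real (Suc m)) < \<epsilon>"
        using K by (simp add: pos_less_divide_eq mult.commute)
      with est[of n m] show ?thesis by linarith
    qed
    then show "\<exists>M. \<forall>m\<ge>M. \<forall>n\<ge>M. cmod (simple_bimeasure_integral \<gamma> (round_grid m (restrict_unit f)) (round_grid m (restrict_unit g))
        - simple_bimeasure_integral \<gamma> (round_grid n (restrict_unit f)) (round_grid n (restrict_unit g))) < \<epsilon>" by blast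
  qed
qed

definition form :: "(real \<Rightarrow> complex) \<Rightarrow> (real \<Rightarrow> complex) \<Rightarrow> complex" where
  "form f g = lim (\<lambda>n. simple_bimeasure_integral \<gamma> (round_grid n (restrict_unit f)) (round_grid n (restrict_unit g)))"

text \<open>Integrals along two admissible approximations differ by a null sequence, by
  \<open>simple_approx_diff\<close>, so the limit taken in \<open>form\<close> is independent of the
  sequence.\<close>

lemma form_limit:
  assumes f: "bounded_borel f" and g: "bounded_borel g" and p: "simple_approx f p" and q: "simple_approx g q"
  shows "(\<lambda>n. simple_bimeasure_integral \<gamma> (p n) (q n)) \<longlonglongrightarrow> form f g"
proof -
  have "convergent (\<lambda>n. simple_bimeasure_integral \<gamma> (round_grid n (restrict_unit f)) (round_grid n (restrict_unit g)))"
    using round_grid_Cauchy[OF f g] by (rule Cauchy_convergent)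
  then have "(\<lambda>n. simple_bimeasure_integral \<gamma> (round_grid n (restrict_unit f)) (round_grid n (restrict_unit g))) \<longlonglongrightarrow> form f g"
    unfolding form_def by (simp add: convergent_LIMSEQ_iff)
  from tendsto_add[OF this simple_approx_diff[OF f g p simple_approx_round_grid[OF f] q simple_approx_round_grid[OF g]]]
  show ?thesis by simp
qed

lemma simple_approx_add:
  assumes "simple_approx f p" "simple_approx g q"
  shows "simple_approx (\<lambda>x. f x + g x) (\<lambda>n x. p n x + q n x)"
proof -
  obtain d where d: "d \<longlonglongrightarrow> 0" "\<And>n x. x \<in> {0..1} \<Longrightarrow> cmod (p n x - f x) \<le> d n"
    using assms(1) unfolding simple_approx_def by metis
  obtain e where e: "e \<longlonglongrightarrow> 0" "\<And>n x. x \<in> {0..1} \<Longrightarrow> cmod (q n x - g x) \<le> e n"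
    using assms(2) unfolding simple_approx_def by metis
  have "cmod (p n x + q n x - (f x + g x)) \<le> d n + e n" if "x \<in> {0..1}" for n x
    using norm_triangle_mono[OF d(2)[OF that] e(2)[OF that]] by (simp add: algebra_simps)
  moreover have "(\<lambda>n. d n + e n) \<longlonglongrightarrow> 0" using tendsto_add[OF d(1) e(1)] by simp
  ultimately show ?thesis
    using assms unfolding simple_approx_def by (auto intro!: simple_function_add exI[of _ "\<lambda>n. d n + e n"])
qed

lemma simple_approx_scale:
  assumes "simple_approx f p"
  shows "simple_approx (\<lambda>x. c * f x) (\<lambda>n x. c * p n x)"
proof -
  obtain d where d: "d \<longlonglongrightarrow> 0" "\<And>n x. x \<in> {0..1} \<Longrightarrow> cmod (p n x - f x) \<le> d n"
    using assms(1) unfolding simple_approx_def by metis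
  have "cmod (c * p n x - c * f x) \<le> cmod c * d n" if "x \<in> {0..1}" for n x
    using mult_left_mono[OF d(2)[OF that], of "cmod c"] by (simp add: norm_mult flip: right_diff_distrib)
  moreover have "(\<lambda>n. cmod c * d n) \<longlonglongrightarrow> 0" using tendsto_mult[OF tendsto_const d(1)] by simp
  ultimately show ?thesis
    using assms unfolding simple_approx_def
    by (auto intro!: simple_function_mult simple_function_const exI[of _ "\<lambda>n. cmod c * d n"])
qed

lemma bounded_form_form: "bounded_form form form_bound"
proof
  show "form_bound \<ge> 0" by (rule form_bound_nonneg)
next
  fix f f' g assume f: "bounded_borel f" "bounded_borel f'" "bounded_borel g"
  note r = f[THEN simple_approx_round_grid]
  have "(\<lambda>n. simple_bimeasure_integral \<gamma> (\<lambda>x. round_grid n (restrict_unit f) x + round_grid n (restrict_unit f') x) (round_grid n (restrict_unit g))) \<longlonglongrightarrow> form (\<lambda>x. f x + f' x) g"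
    using f by (intro form_limit simple_approx_add r) auto
  moreover have "(\<lambda>n. simple_bimeasure_integral \<gamma> (round_grid n (restrict_unit f)) (round_grid n (restrict_unit g)) + simple_bimeasure_integral \<gamma> (round_grid n (restrict_unit f')) (round_grid n (restrict_unit g))) \<longlonglongrightarrow> form f g + form f' g"
    using f by (intro tendsto_add form_limit r)
  ultimately show "form (\<lambda>x. f x + f' x) g = form f g + form f' g"
    using f by (simp add: simple_add_left simple_function_round_restrict LIMSEQ_unique)
next
  fix f g g' assume f: "bounded_borel f" "bounded_borel g" "bounded_borel g'"
  note r = f[THEN simple_approx_round_grid]
  have "(\<lambda>n. simple_bimeasure_integral \<gamma> (round_grid n (restrict_unit f)) (\<lambda>x. round_grid n (restrict_unit g) x + round_grid n (restrict_unit g') x)) \<longlonglongrightarrow> form f (\<lambda>x. g x + g' x)"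
    using f by (intro form_limit simple_approx_add r) auto
  moreover have "(\<lambda>n. simple_bimeasure_integral \<gamma> (round_grid n (restrict_unit f)) (round_grid n (restrict_unit g)) + simple_bimeasure_integral \<gamma> (round_grid n (restrict_unit f)) (round_grid n (restrict_unit g'))) \<longlonglongrightarrow> form f g + form f g'"
    using f by (intro tendsto_add form_limit r)
  ultimately show "form f (\<lambda>x. g x + g' x) = form f g + form f g'"
    using f by (simp add: simple_add_right simple_function_round_restrict LIMSEQ_unique)
next
  fix a f g assume f: "bounded_borel f" "bounded_borel g"
  note r = f[THEN simple_approx_round_grid]
  have "(\<lambda>n. simple_bimeasure_integral \<gamma> (\<lambda>x. a * round_grid n (restrict_unit f) x) (round_grid n (restrict_unit g))) \<longlonglongrightarrow> form (\<lambda>x. a * f x) g"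
    using f by (intro form_limit simple_approx_scale r) auto
  moreover have "(\<lambda>n. a * simple_bimeasure_integral \<gamma> (round_grid n (restrict_unit f)) (round_grid n (restrict_unit g))) \<longlonglongrightarrow> a * form f g"
    using f by (intro tendsto_mult tendsto_const form_limit r)
  ultimately show "form (\<lambda>x. a * f x) g = a * form f g"
    using f by (simp add: simple_scale_left simple_function_round_restrict LIMSEQ_unique)
next
  fix a f g assume f: "bounded_borel f" "bounded_borel g"
  note r = f[THEN simple_approx_round_grid]
  have "(\<lambda>n. simple_bimeasure_integral \<gamma> (round_grid n (restrict_unit f)) (\<lambda>x. a * round_grid n (restrict_unit g) x)) \<longlonglongrightarrow> form f (\<lambda>x. a * g x)"
    using f by (intro form_limit simple_approx_scale r) auto
  moreover have "(\<lambda>n. a * simple_bimeasure_integral \<gamma> (round_grid n (restrict_unit f)) (round_grid n (restrict_unit g))) \<longlonglongrightarrow> a * form f g"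
    using f by (intro tendsto_mult tendsto_const form_limit r)
  ultimately show "form f (\<lambda>x. a * g x) = a * form f g"
    using f by (simp add: simple_scale_right simple_function_round_restrict LIMSEQ_unique)
next
  fix f g a b assume f: "bounded_borel f" "bounded_borel g"
    and a: "\<And>x. x \<in> {0..1} \<Longrightarrow> cmod (f x) \<le> a" and b: "\<And>x. x \<in> {0..1} \<Longrightarrow> cmod (g x) \<le> b"
  note r = f[THEN simple_approx_round_grid]
  have er: "cmod (round_grid n (restrict_unit h) x) \<le> 2 / real (Suc n) + c" if "x \<in> {0..1}" "cmod (h x) \<le> c" for n h x c
    using norm_triangle_sub[of "round_grid n (restrict_unit h) x" "h x"] round_grid_error[of n "restrict_unit h" x] that by simp
  show "cmod (form f g) \<le> form_bound * a * b"
  proof (rule tendsto_le[OF trivial_limit_sequentially])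
    show "(\<lambda>n. cmod (simple_bimeasure_integral \<gamma> (round_grid n (restrict_unit f)) (round_grid n (restrict_unit g)))) \<longlonglongrightarrow> cmod (form f g)"
      using f by (intro tendsto_norm form_limit r)
    have "(\<lambda>n. form_bound * (2 / real (Suc n) + a) * (2 / real (Suc n) + b)) \<longlonglongrightarrow> form_bound * (0 + a) * (0 + b)"
      by (intro tendsto_intros round_grid_error_tendsto)
    then show "(\<lambda>n. form_bound * (2 / real (Suc n) + a) * (2 / real (Suc n) + b)) \<longlonglongrightarrow> form_bound * a * b" by simp
    show "\<forall>\<^sub>F n in sequentially. cmod (simple_bimeasure_integral \<gamma> (round_grid n (restrict_unit f)) (round_grid n (restrict_unit g)))
        \<le> form_bound * (2 / real (Suc n) + a) * (2 / real (Suc n) + b)"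
      using f a b by (intro always_eventually allI form_bound simple_function_round_restrict er) auto
  qed
qed

lemma has_bimeasure_integral_form:
  assumes "bounded_borel f" "bounded_borel g" "has_bimeasure_integral \<gamma> f g I"
  shows "I = form f g"
proof -
  obtain p q where p: "\<And>n. simple_function borel (p n)" "uniform_limit UNIV p f sequentially"
    and q: "\<And>n. simple_function borel (q n)" "uniform_limit UNIV q g sequentially"
    and I: "(\<lambda>n. simple_bimeasure_integral \<gamma> (p n) (q n)) \<longlonglongrightarrow> I"
    using assms(3) unfolding has_bimeasure_integral_def by blast
  have "(\<lambda>n. simple_bimeasure_integral \<gamma> (p n) (q n)) \<longlonglongrightarrow> form f g"
    using assms p q by (intro form_limit simple_approx_uniform_limit) auto
  with I show ?thesis by (rule LIMSEQ_unique)
qed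

end

section \<open>Second moments and the properties of a Hausdorff covariance\<close>

lemma L2_fun_mult_integrable:
  assumes "L2_fun M f" "L2_fun M g"
  shows "integrable M (\<lambda>\<omega>. cnj (f \<omega>) * g \<omega>)"
proof (rule Bochner_Integration.integrable_bound)
  show "integrable M (\<lambda>\<omega>. (cmod (f \<omega>))\<^sup>2 + (cmod (g \<omega>))\<^sup>2)"
    using assms by (auto simp: L2_fun_def)
  have "(\<lambda>\<omega>. cnj (f \<omega>)) \<in> borel_measurable M"
    using assms(1) borel_measurable_continuous_on[OF continuous_on_cnj[OF continuous_on_id]]
    by (auto simp: L2_fun_def)
  then show "(\<lambda>\<omega>. cnj (f \<omega>) * g \<omega>) \<in> borel_measurable M"
    using assms(2) by (auto simp: L2_fun_def)
  have "x * y \<le> x\<^sup>2 + y\<^sup>2" if "x \<ge> 0" "y \<ge> 0" for x y :: real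
    using sum_squares_bound[of x y] that mult_nonneg_nonneg[OF that] by linarith
  then show "AE \<omega> in M. norm (cnj (f \<omega>) * g \<omega>) \<le> norm ((cmod (f \<omega>))\<^sup>2 + (cmod (g \<omega>))\<^sup>2)"
    by (simp add: norm_mult)
qed

lemma L2_inner_AE_zero:
  assumes f: "AE \<omega> in M. f \<omega> = 0"
  shows "L2_inner M f g = 0" "L2_inner M g f = 0"
proof -
  have "AE \<omega> in M. cnj (f \<omega>) * g \<omega> = 0" "AE \<omega> in M. cnj (g \<omega>) * f \<omega> = 0"
    using f by auto
  then show "L2_inner M f g = 0" "L2_inner M g f = 0"
    unfolding L2_inner_def by (auto intro: integral_eq_zero_AE)
qed

text \<open>The quadratic form is the second moment of \<open>Y\<close>, the corresponding linear
  combination of the variables.\<close>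

lemma positive_definite_covariance:
  assumes L2: "\<And>t. L2_fun M (X t)"
  shows "positive_definite_kernel (covariance M X)"
  unfolding positive_definite_kernel_def
proof (intro allI impI)
  fix r :: nat and a :: "nat \<Rightarrow> complex" and t :: "nat \<Rightarrow> real"
  define Y where "Y \<omega> = (\<Sum>k<r. a k * X (t k) \<omega>)" for \<omega>
  have int: "integrable M (\<lambda>\<omega>. cnj (X (t l) \<omega>) * X (t k) \<omega>)" for l k
    by (intro L2_fun_mult_integrable L2)
  have "(\<Sum>l<r. \<Sum>k<r. cnj (a l) * a k * covariance M X (t l) (t k))
      = (\<integral>\<omega>. (\<Sum>l<r. \<Sum>k<r. cnj (a l) * a k * (cnj (X (t l) \<omega>) * X (t k) \<omega>)) \<partial>M)"
    unfolding covariance_def L2_inner_def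
    using int by (simp add: Bochner_Integration.integral_sum)
  also have "\<dots> = (\<integral>\<omega>. of_real ((cmod (Y \<omega>))\<^sup>2) \<partial>M)"
  proof (intro Bochner_Integration.integral_cong refl)
    fix \<omega>
    have "of_real ((cmod (Y \<omega>))\<^sup>2) = cnj (Y \<omega>) * Y \<omega>"
      by (metis complex_norm_square mult.commute)
    also have "\<dots> = (\<Sum>l<r. \<Sum>k<r. cnj (a l) * a k * (cnj (X (t l) \<omega>) * X (t k) \<omega>))"
      unfolding Y_def cnj_sum sum_product complex_cnj_mult by (simp only: mult_ac)
    finally show "(\<Sum>l<r. \<Sum>k<r. cnj (a l) * a k * (cnj (X (t l) \<omega>) * X (t k) \<omega>)) = of_real ((cmod (Y \<omega>))\<^sup>2)" ..
  qed
  also have "\<dots> = of_real (\<integral>\<omega>. (cmod (Y \<omega>))\<^sup>2 \<partial>M)" by (rule integral_complex_of_real)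
  also have "\<dots> \<in> \<real>\<^sub>\<ge>\<^sub>0" by (simp add: integral_nonneg_AE)
  finally show "(\<Sum>l<r. \<Sum>k<r. cnj (a l) * a k * covariance M X (t l) (t k)) \<in> \<real>\<^sub>\<ge>\<^sub>0" .
qed

text \<open>The support condition on \<open>\<xi>\<close> passes to \<open>\<gamma>\<close> through
  \<open>\<gamma> A B = L2_inner M (\<xi> A) (\<xi> B)\<close>. Hence \<open>\<gamma>\<close> yields
  a \<open>bounded_form\<close> whose kernel is the covariance, and the assertions are those proved
  for forms, except positivity, which comes from the variables themselves.\<close>

theorem hausdorff_process_kernel:
  assumes X: "hausdorff_process M X"
  shows "analytic_kernel (covariance M X)" "positive_definite_kernel (covariance M X)"
    "weakly_bounded (kernel_moment (covariance M X))"
    "weakly_stationary M X \<longleftrightarrow> hankel (kernel_moment (covariance M X))"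
proof -
  obtain \<gamma> \<xi> where sb: "spectral_bimeasure M X \<gamma>" and ss: "spectral_stochastic_measure M X \<gamma> \<xi>"
    and null: "\<And>A. A \<in> sets borel \<Longrightarrow> A \<inter> {0..1} = {} \<Longrightarrow> AE \<omega> in M. \<xi> A \<omega> = 0"
    using X unfolding hausdorff_process_def by blast
  have bm: "bimeasure \<gamma>" using sb by (simp add: spectral_bimeasure_def positive_definite_bimeasure_def)
  have inner: "\<gamma> A B = L2_inner M (\<xi> A) (\<xi> B)" if "A \<in> sets borel" "B \<in> sets borel" for A B
    using ss that by (simp add: spectral_stochastic_measure_def)
  interpret supported_bimeasure \<gamma>
  proof
    show "finitely_additive (\<lambda>A. \<gamma> A B)" "finitely_additive (\<gamma> B)" if "B \<in> sets borel" for B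
      using bm that sigma_additive_imp_finitely_additive unfolding bimeasure_def by blast+
    show "finite_semivariation \<gamma>" using bm by (simp add: bimeasure_def)
    show "\<gamma> A B = 0" if "A \<in> sets borel" "B \<in> sets borel" "A \<inter> {0..1} = {}" for A B
      using inner[OF that(1,2)] L2_inner_AE_zero[OF null[OF that(1,3)]] by simp
    show "\<gamma> A B = 0" if "A \<in> sets borel" "B \<in> sets borel" "B \<inter> {0..1} = {}" for A B
      using inner[OF that(1,2)] L2_inner_AE_zero[OF null[OF that(2,3)]] by simp
  qed
  interpret bounded_form form form_bound by (rule bounded_form_form)
  have cov: "covariance M X = form_kernel"
  proof (intro ext)
    fix t t'
    have "has_bimeasure_integral \<gamma>
        (\<lambda>s. exp (- (\<i> * of_real t * of_real s))) (\<lambda>s'. exp (\<i> * of_real t' * of_real s'))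
        (covariance M X t t')"
      using sb by (simp add: spectral_bimeasure_def)
    then show "covariance M X t t' = form_kernel t t'"
      unfolding form_kernel_def
      by (intro has_bimeasure_integral_form bounded_borel_continuous continuous_intros)
  qed
  show "analytic_kernel (covariance M X)" unfolding cov by (rule analytic_form_kernel)
  show "weakly_bounded (kernel_moment (covariance M X))" unfolding cov by (rule weakly_bounded_form)
  show "positive_definite_kernel (covariance M X)"
    using X by (intro positive_definite_covariance)
      (simp add: hausdorff_process_def weakly_harmonizable_def second_order_process_def)
  show "weakly_stationary M X \<longleftrightarrow> hankel (kernel_moment (covariance M X))"
    unfolding weakly_stationary_def cov
  proof
    assume "\<exists>F. continuous_on UNIV F \<and> (\<forall>t t'. form_kernel t t' = F (t' - t))"
    then obtain F where "\<forall>t t'. form_kernel t t' = F (t' - t)" by (elim exE conjE)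
    then show "hankel (kernel_moment form_kernel)" by (intro stationary_imp_hankel[of F]) (elim allE)
  next
    assume h: "hankel (kernel_moment form_kernel)"
    show "\<exists>F. continuous_on UNIV F \<and> (\<forall>t t'. form_kernel t t' = F (t' - t))"
      by (rule exI[of _ "form_kernel 0"], rule conjI, rule form_kernel_0_continuous, (rule allI)+, rule form_kernel_hankel[OF h])
  qed
qed

subsection \<open>Coefficients of positive definite power series\<close>

text \<open>Positivity is localized to a set of nodes because the kernels met later are controlled
  only near the origin and, after division by \<open>x * y\<close>, at first only away from
  0.\<close>

definition psd_on :: "real set \<Rightarrow> (real \<Rightarrow> real \<Rightarrow> complex) \<Rightarrow> bool" where
  "psd_on S K \<longleftrightarrow> (\<forall>r (a :: nat \<Rightarrow> complex) t. (\<forall>i<r. t i \<in> S) \<longrightarrow>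
     (\<Sum>l<r. \<Sum>k<r. cnj (a l) * a k * K (t l) (t k)) \<in> \<real>\<^sub>\<ge>\<^sub>0)"

lemma psd_onD:
  fixes r :: nat
  assumes "psd_on S K" "\<And>i. i < r \<Longrightarrow> t i \<in> S"
  shows "(\<Sum>l<r. \<Sum>k<r. cnj (a l) * a k * K (t l) (t k)) \<in> \<real>\<^sub>\<ge>\<^sub>0"
  by (rule assms(1)[unfolded psd_on_def, rule_format]) (rule assms(2))

lemma psd_on_positive_definite_kernel:
  assumes "positive_definite_kernel K" shows "psd_on S K"
  unfolding psd_on_def
proof (intro allI impI)
  fix r :: nat and a :: "nat \<Rightarrow> complex" and t :: "nat \<Rightarrow> real"
  show "(\<Sum>l<r. \<Sum>k<r. cnj (a l) * a k * K (t l) (t k)) \<in> \<real>\<^sub>\<ge>\<^sub>0"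
    using assms unfolding positive_definite_kernel_def by (cases "r \<ge> 1") auto
qed

lemma psd_on_two:
  assumes "psd_on S K" "x \<in> S" "y \<in> S"
  shows "cnj a * a * K x x + cnj a * b * K x y + cnj b * a * K y x + cnj b * b * K y y \<in> \<real>\<^sub>\<ge>\<^sub>0"
proof -
  have "(\<Sum>l<2. \<Sum>k<2. cnj ((\<lambda>i::nat. if i = 0 then a else b) l) * (\<lambda>i::nat. if i = 0 then a else b) k
          * K ((\<lambda>i::nat. if i = 0 then x else y) l) ((\<lambda>i::nat. if i = 0 then x else y) k)) \<in> \<real>\<^sub>\<ge>\<^sub>0"
    by (rule psd_onD[OF assms(1)]) (use assms in simp)
  then show ?thesis by (simp add: eval_nat_numeral algebra_simps)
qed

lemma psd_on_diag:
  assumes "psd_on S K" "x \<in> S" shows "K x x \<in> \<real>\<^sub>\<ge>\<^sub>0"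
  using psd_on_two[OF assms assms(2), of 1 0] by simp

lemma psd_on_cnj:
  assumes "psd_on S K" "x \<in> S" "y \<in> S" shows "K y x = cnj (K x y)"
proof -
  have d: "Im (K x x) = 0" "Im (K y y) = 0"
    using psd_on_diag[OF assms(1)] assms(2,3) by (auto simp: complex_nonneg_Reals_iff)
  \<comment> \<open>The coefficients \<open>(1, 1)\<close> and \<open>(1, \<i>)\<close> give the
    imaginary and the real part of the conjugate symmetry.\<close>
  have "Im (K x x + K x y + K y x + K y y) = 0"
    using psd_on_two[OF assms, of 1 1] by (simp add: complex_nonneg_Reals_iff)
  moreover have "Im (K x x + \<i> * K x y + (- \<i>) * K y x + K y y) = 0"
    using psd_on_two[OF assms, of 1 \<i>] by (simp add: complex_nonneg_Reals_iff)
  ultimately show ?thesis using d by (simp add: complex_eq_iff)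
qed

lemma psd_on_zero:
  assumes "psd_on S K" "x \<in> S" "y \<in> S" "K x x = 0" shows "K x y = 0"
proof (rule ccontr)
  assume nz: "K x y \<noteq> 0"
  \<comment> \<open>With coefficient \<open>- c * K x y\<close> at \<open>x\<close> and 1 at
    \<open>y\<close> the form equals \<open>Re (K y y) - 2 * (Re (K y y) + 1)\<close>, which is
    negative.\<close>
  define c where "c = (Re (K y y) + 1) / (cmod (K x y))\<^sup>2"
  have "cnj a * a * K x x + cnj a * K x y + a * cnj (K x y) + K y y \<in> \<real>\<^sub>\<ge>\<^sub>0" for a
    using psd_on_two[OF assms(1-3), of a 1] psd_on_cnj[OF assms(1-3)] by simp
  from this[of "- of_real c * K x y"]
  have "Re (- of_real c * (cnj (K x y) * K x y) - of_real c * (cnj (K x y) * K x y) + K y y) \<ge> 0"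
    using assms(4) by (simp add: complex_nonneg_Reals_iff algebra_simps)
  moreover have "cnj (K x y) * K x y = of_real ((cmod (K x y))\<^sup>2)"
    by (metis complex_norm_square mult.commute)
  ultimately have "- 2 * c * (cmod (K x y))\<^sup>2 + Re (K y y) \<ge> 0"
    by simp
  moreover have "c * (cmod (K x y))\<^sup>2 = Re (K y y) + 1" using nz by (simp add: c_def)
  moreover have "Re (K y y) \<ge> 0" using psd_on_diag[OF assms(1,3)] by (simp add: complex_nonneg_Reals_iff)
  ultimately show False by simp
qed

text \<open>The Schur complement is the given form with the additional point \<open>x0\<close> whose
  coefficient minimizes it.\<close>

lemma psd_on_schur:
  assumes K: "psd_on S K" and x0: "x0 \<in> S"
  shows "psd_on S (\<lambda>x y. K x y - K x x0 * K x0 y / K x0 x0)"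
  unfolding psd_on_def
proof (intro allI impI)
  fix r :: nat and a :: "nat \<Rightarrow> complex" and t :: "nat \<Rightarrow> real"
  assume t: "\<forall>i<r. t i \<in> S"
  define d where "d = K x0 x0"
  define b where "b = (\<Sum>k<r. a k * K x0 (t k))"
  \<comment> \<open>For \<open>d = 0\<close> this is 0, in accordance with the subtracted quotient,
    which is then 0 as well.\<close>
  define c where "c = - b / d"
  have d: "cnj d = d" using psd_on_diag[OF K x0] by (simp add: d_def complex_nonneg_Reals_iff complex_eq_iff)
  have b': "(\<Sum>l<r. cnj (a l) * K (t l) x0) = cnj b"
    unfolding b_def cnj_sum using t psd_on_cnj[OF K x0] by (auto intro!: sum.cong)
  define a' where "a' i = (if i < r then a i else c)" for i
  define t' where "t' i = (if i < r then t i else x0)" for i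
  have "(\<Sum>l<r. \<Sum>k<r. cnj (a l) * a k * (K (t l) (t k) - K (t l) x0 * K x0 (t k) / K x0 x0))
      = (\<Sum>l<r. \<Sum>k<r. cnj (a l) * a k * K (t l) (t k))
        - (\<Sum>l<r. \<Sum>k<r. (cnj (a l) * K (t l) x0) * (a k * K x0 (t k))) / d"
    by (simp add: d_def right_diff_distrib sum_subtractf sum_divide_distrib mult_ac)
  also have "\<dots> = (\<Sum>l<r. \<Sum>k<r. cnj (a l) * a k * K (t l) (t k)) - cnj b * b / d"
    by (simp only: sum_product[symmetric] b' b_def[symmetric])
  also have "\<dots> = (\<Sum>l<r. \<Sum>k<r. cnj (a l) * a k * K (t l) (t k)) + c * cnj b + cnj c * b + cnj c * c * d"
    by (cases "d = 0") (simp_all add: c_def d field_simps)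
  also have "\<dots> = (\<Sum>l<Suc r. \<Sum>k<Suc r. cnj (a' l) * a' k * K (t' l) (t' k))"
  proof -
    have "(\<Sum>l<Suc r. \<Sum>k<Suc r. cnj (a' l) * a' k * K (t' l) (t' k))
        = (\<Sum>l<r. (\<Sum>k<r. cnj (a l) * a k * K (t l) (t k)) + cnj (a l) * c * K (t l) x0)
          + ((\<Sum>k<r. cnj c * a k * K x0 (t k)) + cnj c * c * d)"
      by (simp add: a'_def t'_def d_def)
    also have "\<dots> = (\<Sum>l<r. \<Sum>k<r. cnj (a l) * a k * K (t l) (t k))
          + c * (\<Sum>l<r. cnj (a l) * K (t l) x0) + (cnj c * b + cnj c * c * d)"
      by (simp add: sum.distrib b_def sum_distrib_left mult_ac)
    finally show ?thesis by (simp add: b' add_ac)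
  qed
  also have "\<dots> \<in> \<real>\<^sub>\<ge>\<^sub>0" by (rule psd_onD[OF K]) (use t x0 in \<open>simp add: t'_def\<close>)
  finally show "(\<Sum>l<r. \<Sum>k<r. cnj (a l) * a k * (K (t l) (t k) - K (t l) x0 * K x0 (t k) / K x0 x0)) \<in> \<real>\<^sub>\<ge>\<^sub>0" .
qed

text \<open>At nonzero nodes the factors \<open>x\<close> and \<open>y\<close> are absorbed into the
  coefficients \<open>a l / t l\<close>.\<close>

lemma psd_on_divide:
  assumes K: "psd_on S K" and g: "\<And>x y. x \<in> S - {0} \<Longrightarrow> y \<in> S - {0} \<Longrightarrow> K x y = of_real (x * y) * G x y"
  shows "psd_on (S - {0}) G"
  unfolding psd_on_def
proof (intro allI impI)
  fix r :: nat and a :: "nat \<Rightarrow> complex" and t :: "nat \<Rightarrow> real"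
  assume t: "\<forall>i<r. t i \<in> S - {0}"
  have "(\<Sum>l<r. \<Sum>k<r. cnj (a l) * a k * G (t l) (t k))
      = (\<Sum>l<r. \<Sum>k<r. cnj (a l / of_real (t l)) * (a k / of_real (t k)) * K (t l) (t k))"
    using t g by (intro sum.cong refl) simp
  also have "\<dots> \<in> \<real>\<^sub>\<ge>\<^sub>0" by (rule psd_onD[OF K]) (use t in simp)
  finally show "(\<Sum>l<r. \<Sum>k<r. cnj (a l) * a k * G (t l) (t k)) \<in> \<real>\<^sub>\<ge>\<^sub>0" .
qed

section \<open>Continuity of double power series and division by the variables\<close>

lemma double_power_series_summable:
  assumes "double_power_series f c r" "\<bar>x\<bar> < r" "\<bar>y\<bar> < r"
  shows "(\<lambda>(j, k). cmod (c j k) * (\<bar>x\<bar> ^ j * \<bar>y\<bar> ^ k)) summable_on UNIV"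
proof -
  have "(\<lambda>(j, k). c j k * of_real (x ^ j * y ^ k)) summable_on UNIV"
    using assms unfolding double_power_series_def summable_on_def by blast
  then have "(\<lambda>p. cmod (case p of (j, k) \<Rightarrow> c j k * of_real (x ^ j * y ^ k))) summable_on UNIV"
    by (rule summable_on_norm_complex)
  then show ?thesis by (simp add: case_prod_unfold norm_mult norm_power power_abs)
qed

text \<open>The absolute values of the terms at the corner \<open>(\<rho>, \<rho>)\<close> form a
  Weierstrass majorant on the whole square.\<close>

lemma double_power_series_continuous:
  assumes f: "double_power_series f c r" and \<rho>: "0 \<le> \<rho>" "\<rho> < r"
  shows "continuous_on ({-\<rho>..\<rho>} \<times> {-\<rho>..\<rho>}) (\<lambda>(x, y). f x y)"
proof -
  let ?S = "{-\<rho>..\<rho>} \<times> {-\<rho>..\<rho>}"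
  define t where "t = (\<lambda>(j, k) (x, y). c j k * complex_of_real (x ^ j * y ^ k))"
  have "uniform_limit ?S (\<lambda>X y. \<Sum>x\<in>X. t x y) (\<lambda>y. \<Sum>\<^sub>\<infinity>x\<in>UNIV. t x y) (finite_subsets_at_top UNIV)"
  proof (rule Weierstrass_m_test_general)
    show "(\<lambda>(j, k). cmod (c j k) * (\<bar>\<rho>\<bar> ^ j * \<bar>\<rho>\<bar> ^ k)) summable_on UNIV"
      by (rule double_power_series_summable[OF f]) (use \<rho> in auto)
    fix p :: "nat \<times> nat" and q assume q: "q \<in> ?S"
    obtain j k where p: "p = (j, k)" by (cases p)
    obtain x y where xy: "q = (x, y)" by (cases q)
    have "\<bar>x\<bar> ^ j * \<bar>y\<bar> ^ k \<le> \<bar>\<rho>\<bar> ^ j * \<bar>\<rho>\<bar> ^ k"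
      using q \<rho> unfolding xy by (intro mult_mono power_mono) auto
    then have "cmod (c j k) * (\<bar>x\<bar> ^ j * \<bar>y\<bar> ^ k) \<le> cmod (c j k) * (\<bar>\<rho>\<bar> ^ j * \<bar>\<rho>\<bar> ^ k)"
      by (rule mult_left_mono) simp
    then show "cmod (t p q) \<le> (case p of (j, k) \<Rightarrow> cmod (c j k) * (\<bar>\<rho>\<bar> ^ j * \<bar>\<rho>\<bar> ^ k))"
      by (simp add: t_def p xy norm_mult norm_power power_abs)
  qed
  then have "continuous_on ?S (\<lambda>y. \<Sum>\<^sub>\<infinity>x\<in>UNIV. t x y)"
    by (rule uniform_limit_theorem[rotated])
       (auto intro!: always_eventually continuous_intros simp: t_def case_prod_unfold)
  moreover have "(\<Sum>\<^sub>\<infinity>p\<in>UNIV. t p q) = (case q of (x, y) \<Rightarrow> f x y)" if "q \<in> ?S" for q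
  proof -
    obtain x y where xy: "q = (x, y)" by (cases q)
    have "((\<lambda>(j, k). c j k * of_real (x ^ j * y ^ k)) has_sum f x y) UNIV"
      using f that \<rho> unfolding double_power_series_def xy by auto
    from infsumI[OF this] show ?thesis by (simp add: t_def xy case_prod_unfold)
  qed
  ultimately show ?thesis by (subst continuous_on_cong[OF refl]) auto
qed

text \<open>Nodes equal to 0 are replaced by nonzero ones tending to 0; continuity on a compact
  square and closedness of the nonnegative reals let the inequality pass to the limit.\<close>

lemma psd_on_insert_0:
  assumes f: "double_power_series f c r" and psd: "psd_on ({-r<..<r} - {0}) f"
  shows "psd_on {-r<..<r} f"
  unfolding psd_on_def
proof (intro allI impI)
  fix m :: nat and a :: "nat \<Rightarrow> complex" and t :: "nat \<Rightarrow> real"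
  assume t: "\<forall>i<m. t i \<in> {-r<..<r}"
  have r: "r > 0" using f by (simp add: double_power_series_def)
  \<comment> \<open>A closed square of this size holds all nodes; including \<open>r / 2\<close>
    leaves room for the replacements of zero nodes, which start there.\<close>
  define \<rho> where "\<rho> = Max (insert (r / 2) ((\<lambda>i. \<bar>t i\<bar>) ` {..<m}))"
  have \<rho>: "r / 2 \<le> \<rho>" "\<And>i. i < m \<Longrightarrow> \<bar>t i\<bar> \<le> \<rho>" unfolding \<rho>_def by (rule Max_ge; simp)+
  have \<rho>r: "\<rho> < r" unfolding \<rho>_def using r t by (subst Max_less_iff) (auto simp: abs_less_iff)
  define u where "u n i = (if t i = 0 then r / 2 * inverse (real (Suc n)) else t i)" for n i
  have u0: "u n i \<noteq> 0" for n i using r by (simp add: u_def)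
  have u\<rho>: "u n i \<in> {-\<rho>..\<rho>}" if "i < m" for n i
  proof (cases "t i = 0")
    case True
    have "r / 2 * inverse (real (Suc n)) \<le> r / 2 * 1" using r by (intro mult_left_mono) (auto simp: inverse_le_1_iff)
    moreover have "r / 2 * inverse (real (Suc n)) \<ge> 0" using r by simp
    moreover have "u n i = r / 2 * inverse (real (Suc n))" using True unfolding u_def by (rule if_P)
    ultimately show ?thesis using \<rho>(1) r unfolding atLeastAtMost_iff by linarith
  qed (use \<rho>(2)[OF that] in \<open>auto simp: u_def abs_le_iff\<close>)
  have ulim: "(\<lambda>n. u n i) \<longlonglongrightarrow> t i" for i
  proof (cases "t i = 0")
    case True
    have "(\<lambda>n. r / 2 * inverse (real (Suc n))) \<longlonglongrightarrow> r / 2 * 0"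
      by (intro tendsto_mult tendsto_const LIMSEQ_inverse_real_of_nat)
    then show ?thesis using True by (simp add: u_def)
  qed (simp add: u_def)
  have lim: "(\<lambda>n. f (u n l) (u n k)) \<longlonglongrightarrow> f (t l) (t k)" if "l < m" "k < m" for l k
  proof -
    have "(\<lambda>n. (\<lambda>(x, y). f x y) (u n l, u n k)) \<longlonglongrightarrow> (\<lambda>(x, y). f x y) (t l, t k)"
    proof (rule continuous_on_tendsto_compose[OF double_power_series_continuous[OF f _ \<rho>r]])
      show "0 \<le> \<rho>" using \<rho>(1) r by linarith
      show "(\<lambda>n. (u n l, u n k)) \<longlonglongrightarrow> (t l, t k)" by (intro tendsto_Pair ulim)
      show "(t l, t k) \<in> {-\<rho>..\<rho>} \<times> {-\<rho>..\<rho>}" using \<rho>(2) that by (auto simp: abs_le_iff intro: minus_le_iff[THEN iffD1])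
      show "\<forall>\<^sub>F n in sequentially. (u n l, u n k) \<in> {-\<rho>..\<rho>} \<times> {-\<rho>..\<rho>}"
        using u\<rho> that by (intro always_eventually) blast
    qed
    then show ?thesis by simp
  qed
  have lims: "(\<lambda>n. \<Sum>l<m. \<Sum>k<m. cnj (a l) * a k * f (u n l) (u n k))
          \<longlonglongrightarrow> (\<Sum>l<m. \<Sum>k<m. cnj (a l) * a k * f (t l) (t k))"
    by (intro tendsto_sum tendsto_mult tendsto_const lim) auto
  have mem: "(\<Sum>l<m. \<Sum>k<m. cnj (a l) * a k * f (u n l) (u n k)) \<in> \<real>\<^sub>\<ge>\<^sub>0" for n
  proof (rule psd_onD[OF psd])
    show "u n i \<in> {-r<..<r} - {0}" if "i < m" for i
      using u\<rho>[OF that, of n] u0 \<rho>r by auto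
  qed
  show "(\<Sum>l<m. \<Sum>k<m. cnj (a l) * a k * f (t l) (t k)) \<in> \<real>\<^sub>\<ge>\<^sub>0"
    by (rule closed_sequentially[OF closed_nonneg_Reals_complex mem lims])
qed

text \<open>Dividing by \<open>y\<close> at the level of coefficients defines the quotient also for
  \<open>y = 0\<close>, where pointwise division fails.\<close>

lemma double_power_series_shift_snd:
  assumes f: "double_power_series f c r" and c0: "\<And>j. c j 0 = 0"
  obtains g where "double_power_series g (\<lambda>j k. c j (Suc k)) r"
    "\<And>x y. \<bar>x\<bar> < r \<Longrightarrow> \<bar>y\<bar> < r \<Longrightarrow> f x y = of_real y * g x y"
proof -
  have r: "r > 0" using f by (simp add: double_power_series_def)
  have inj: "inj_on (\<lambda>(j, k). (j, Suc k)) UNIV" by (auto simp: inj_on_def)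
  define t where "t x y = (\<lambda>(j, k). c j (Suc k) * complex_of_real (x ^ j * y ^ k))" for x y
  define g where "g x y = infsum (t x y) UNIV" for x y
  have summ: "t x y summable_on UNIV" if xy: "\<bar>x\<bar> < r" "\<bar>y\<bar> < r" for x y
  proof -
    \<comment> \<open>Kept positive so that the spare power of \<open>y'\<close> can be divided out
      even when \<open>y = 0\<close>.\<close>
    define y' where "y' = max \<bar>y\<bar> (r / 2)"
    have y': "y' > 0" "\<bar>y'\<bar> < r" "\<bar>y\<bar> \<le> y'" using xy r by (auto simp: y'_def)
    have "(\<lambda>(j, k). cmod (c j k) * (\<bar>x\<bar> ^ j * \<bar>y'\<bar> ^ k)) summable_on range (\<lambda>(j, k). (j, Suc k))"
      using double_power_series_summable[OF f xy(1) y'(2)] by (rule summable_on_subset) simp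
    then have "(\<lambda>(j, k). cmod (c j (Suc k)) * (\<bar>x\<bar> ^ j * y' ^ Suc k)) summable_on UNIV"
      using y' by (subst (asm) summable_on_reindex[OF inj]) (simp add: o_def case_prod_unfold)
    then have "(\<lambda>p. (case p of (j, k) \<Rightarrow> cmod (c j (Suc k)) * (\<bar>x\<bar> ^ j * y' ^ Suc k)) * inverse y') summable_on UNIV"
      by (rule summable_on_cmult_left)
    then have "(\<lambda>p. cmod (t x y p)) summable_on UNIV"
    proof (rule Infinite_Sum.abs_summable_on_comparison_test')
      fix p :: "nat \<times> nat"
      obtain j k where p: "p = (j, k)" by (cases p)
      have "\<bar>y\<bar> ^ k \<le> y' ^ k" using y' by (intro power_mono) auto
      then have "cmod (c j (Suc k)) * (\<bar>x\<bar> ^ j * \<bar>y\<bar> ^ k) \<le> cmod (c j (Suc k)) * (\<bar>x\<bar> ^ j * y' ^ k)"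
        by (intro mult_left_mono) auto
      also have "\<dots> = cmod (c j (Suc k)) * (\<bar>x\<bar> ^ j * y' ^ Suc k) * inverse y'"
        using y' by (simp add: field_simps)
      finally show "cmod (t x y p) \<le> (case p of (j, k) \<Rightarrow> cmod (c j (Suc k)) * (\<bar>x\<bar> ^ j * y' ^ Suc k)) * inverse y'"
        by (simp add: p t_def norm_mult norm_power power_abs)
    qed
    then show ?thesis by (rule abs_summable_summable)
  qed
  have g: "double_power_series g (\<lambda>j k. c j (Suc k)) r"
    unfolding double_power_series_def using r has_sum_infsum[OF summ]
    by (simp add: g_def t_def del: of_real_mult of_real_power)
  have "f x y = of_real y * g x y" if xy: "\<bar>x\<bar> < r" "\<bar>y\<bar> < r" for x y
  proof -
    have "((\<lambda>(j, k). c j k * of_real (x ^ j * y ^ k)) has_sum f x y) UNIV"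
      using f xy unfolding double_power_series_def by blast
    also have "?this \<longleftrightarrow> ((\<lambda>(j, k). c j k * of_real (x ^ j * y ^ k)) has_sum f x y) (range (\<lambda>(j, k). (j, Suc k)))"
    proof (rule has_sum_cong_neutral)
      fix p assume "p \<in> UNIV - range (\<lambda>(j :: nat, k). (j, Suc k))"
      then have "snd p = 0" by (cases p, cases "snd p") force+
      then show "(case p of (j, k) \<Rightarrow> c j k * of_real (x ^ j * y ^ k)) = 0" using c0 by (simp add: case_prod_unfold)
    qed auto
    finally have "((\<lambda>p. of_real y * t x y p) has_sum f x y) UNIV"
      by (subst (asm) has_sum_reindex[OF inj]) (simp add: o_def case_prod_unfold t_def mult_ac)
    moreover have "((\<lambda>p. of_real y * t x y p) has_sum of_real y * g x y) UNIV"
      unfolding g_def by (intro has_sum_cmult_right has_sum_infsum summ xy)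
    ultimately show ?thesis by (rule has_sum_unique)
  qed
  with g show thesis by (rule that)
qed

lemma double_power_series_shift:
  assumes f: "double_power_series f c r" and c0: "\<And>j. c j 0 = 0" "\<And>k. c 0 k = 0"
  obtains g where "double_power_series g (\<lambda>j k. c (Suc j) (Suc k)) r"
    "\<And>x y. \<bar>x\<bar> < r \<Longrightarrow> \<bar>y\<bar> < r \<Longrightarrow> f x y = of_real (x * y) * g x y"
proof -
  obtain g where g: "double_power_series g (\<lambda>j k. c j (Suc k)) r"
    "\<And>x y. \<bar>x\<bar> < r \<Longrightarrow> \<bar>y\<bar> < r \<Longrightarrow> f x y = of_real y * g x y"
    using double_power_series_shift_snd[OF f c0(1)] by blast
  obtain h where h: "double_power_series h (\<lambda>j k. c (Suc k) (Suc j)) r"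
    "\<And>x y. \<bar>x\<bar> < r \<Longrightarrow> \<bar>y\<bar> < r \<Longrightarrow> g y x = of_real y * h x y"
    using double_power_series_shift_snd[OF double_power_series_swap[OF g(1)]] c0(2) by blast
  show thesis
  proof (rule that)
    show "double_power_series (\<lambda>x y. h y x) (\<lambda>j k. c (Suc j) (Suc k)) r"
      using double_power_series_swap[OF h(1)] .
    show "f x y = of_real (x * y) * h y x" if "\<bar>x\<bar> < r" "\<bar>y\<bar> < r" for x y
      using g(2)[OF that] h(2)[OF that(2,1)] by simp
  qed
qed

lemma has_sum_times:
  fixes f g :: "nat \<Rightarrow> complex"
  assumes f: "(f has_sum a) UNIV" and g: "(g has_sum b) UNIV"
  shows "((\<lambda>(j, k). f j * g k) has_sum a * b) UNIV"
proof -
  have nf: "(\<lambda>j. cmod (f j)) summable_on UNIV" and ng: "(\<lambda>j. cmod (g j)) summable_on UNIV"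
    using f g by (auto simp: summable_on_iff_abs_summable_on_complex[symmetric] summable_on_def)
  have "(\<lambda>(j, k). cmod (f j) * cmod (g k)) summable_on Sigma UNIV (\<lambda>_. UNIV)"
  proof (rule summable_on_SigmaI)
    show "((\<lambda>k. case (j, k) of (j, k) \<Rightarrow> cmod (f j) * cmod (g k)) has_sum cmod (f j) * infsum (\<lambda>k. cmod (g k)) UNIV) UNIV" for j
      unfolding prod.case by (intro has_sum_cmult_right has_sum_infsum ng)
    show "(\<lambda>j. cmod (f j) * infsum (\<lambda>k. cmod (g k)) UNIV) summable_on UNIV"
      by (intro summable_on_cmult_left nf)
  qed auto
  then have "(\<lambda>p. cmod (case p of (j, k) \<Rightarrow> f j * g k)) summable_on UNIV"
    by (simp add: case_prod_unfold norm_mult)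
  then have s: "(\<lambda>(j, k). f j * g k) summable_on Sigma UNIV (\<lambda>_. UNIV)"
    using abs_summable_summable by fastforce
  have "((\<lambda>(j, k). f j * g k) has_sum a * b) (Sigma UNIV (\<lambda>_. UNIV))"
  proof (rule has_sum_SigmaI[OF _ _ s])
    show "((\<lambda>k. case (j, k) of (j, k) \<Rightarrow> f j * g k) has_sum f j * b) UNIV" for j
      unfolding prod.case by (intro has_sum_cmult_right g)
    show "((\<lambda>j. f j * b) has_sum a * b) UNIV" by (intro has_sum_cmult_left f)
  qed
  then show ?thesis by simp
qed

section \<open>Edge coefficients and the Cholesky factorization\<close>

lemma double_power_series_edge:
  assumes f: "double_power_series f c r" and x: "\<bar>x\<bar> < r"
  shows "((\<lambda>j. c j 0 * of_real (x ^ j)) has_sum f x 0) UNIV"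
proof -
  have r: "r > 0" using f by (simp add: double_power_series_def)
  have inj: "inj_on (\<lambda>j. (j, 0)) UNIV" by (auto simp: inj_on_def)
  have "((\<lambda>(j, k). c j k * of_real (x ^ j * 0 ^ k)) has_sum f x 0) UNIV"
    using f[unfolded double_power_series_def, THEN conjunct2, rule_format, of x 0] x r by simp
  also have "?this \<longleftrightarrow> ((\<lambda>(j, k). c j k * of_real (x ^ j * 0 ^ k)) has_sum f x 0) (range (\<lambda>j. (j, 0)))"
  proof (rule has_sum_cong_neutral)
    fix p assume "p \<in> UNIV - range (\<lambda>j :: nat. (j, 0 :: nat))"
    then have "snd p \<noteq> 0" by (cases p) auto
    then show "(case p of (j, k) \<Rightarrow> c j k * of_real (x ^ j * 0 ^ k)) = 0" by (simp add: case_prod_unfold)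
  qed auto
  finally show ?thesis
    by (subst (asm) has_sum_reindex[OF inj]) (simp add: o_def)
qed

text \<open>One elimination step of the Cholesky algorithm for the infinite matrix \<open>c\<close>:
  the Schur complement of the corner, with the emptied first row and column removed. With corner 0
  the quotient is 0 and only the shift remains.\<close>

definition schur_shift :: "(nat \<Rightarrow> nat \<Rightarrow> complex) \<Rightarrow> nat \<Rightarrow> nat \<Rightarrow> complex" where
  "schur_shift c j k = c (Suc j) (Suc k) - c (Suc j) 0 * c 0 (Suc k) / c 0 0"

text \<open>Only the existence of a kernel is recorded, so that the property can be iterated along
  \<open>schur_shift\<close> while the kernels change.\<close>

definition psd_series :: "(nat \<Rightarrow> nat \<Rightarrow> complex) \<Rightarrow> real \<Rightarrow> bool" where
  "psd_series c r \<longleftrightarrow> (\<exists>K. double_power_series K c r \<and> psd_on {-r<..<r} K)"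

text \<open>Properties of the kernel become properties of its coefficients because expansions are
  unique: conjugating and swapping gives the Hermitian symmetry, and a zero corner forces the kernel
  to vanish on the axes.\<close>

lemma psd_series_facts:
  assumes "psd_series c r"
  shows "c 0 0 \<in> \<real>\<^sub>\<ge>\<^sub>0" "c j k = cnj (c k j)" "c 0 0 = 0 \<Longrightarrow> c 0 k = 0"
proof -
  obtain K where K: "double_power_series K c r" and psd: "psd_on {-r<..<r} K"
    using assms unfolding psd_series_def by blast
  have r: "r > 0" using K by (simp add: double_power_series_def)
  have K0: "K 0 0 = c 0 0" by (rule double_power_series_at_0[OF K])
  show "c 0 0 \<in> \<real>\<^sub>\<ge>\<^sub>0" using psd_on_diag[OF psd, of 0] r K0 by simp
  have "double_power_series K (\<lambda>j k. cnj (c k j)) r"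
    unfolding double_power_series_def
  proof (intro conjI allI impI r)
    fix t s assume ts: "\<bar>t\<bar> < r" "\<bar>s\<bar> < r"
    then have "((\<lambda>(j, k). c k j * of_real (t ^ j * s ^ k)) has_sum K s t) UNIV"
      using double_power_series_swap[OF K] unfolding double_power_series_def by blast
    then have "((\<lambda>p. cnj (case p of (j, k) \<Rightarrow> c k j * of_real (t ^ j * s ^ k))) has_sum cnj (K s t)) UNIV"
      by (simp add: has_sum_cnj_iff)
    moreover have "cnj (K s t) = K t s" using psd_on_cnj[OF psd, of s t] ts by (auto simp: abs_less_iff)
    ultimately show "((\<lambda>(j, k). cnj (c k j) * of_real (t ^ j * s ^ k)) has_sum K t s) UNIV"
      by (simp add: case_prod_unfold)
  qed
  from double_power_series_unique[OF K this] have herm: "c j k = cnj (c k j)" for j k by meson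
  then show "c j k = cnj (c k j)" .
  show "c 0 k = 0" if "c 0 0 = 0"
  proof -
    have K0y: "K y 0 = 0" if "\<bar>y\<bar> < r" for y
    proof -
      have "K 0 y = 0" using psd_on_zero[OF psd, of 0 y] that r K0 \<open>c 0 0 = 0\<close> by (auto simp: abs_less_iff)
      then show ?thesis using psd_on_cnj[OF psd, of 0 y] that r by (auto simp: abs_less_iff)
    qed
    \<comment> \<open>The edge series represents the zero function; it is read as a double series
      with a single column so that uniqueness of coefficients applies.\<close>
    have "double_power_series (\<lambda>t s. 0) (\<lambda>j k. if k = 0 then c j 0 else 0) r"
      unfolding double_power_series_def
    proof (intro conjI allI impI r)
      fix t s assume "\<bar>t\<bar> < r" "\<bar>s\<bar> < r"
      have "((\<lambda>j. c j 0 * of_real (t ^ j)) has_sum 0) UNIV"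
        using double_power_series_edge[OF K \<open>\<bar>t\<bar> < r\<close>] K0y[OF \<open>\<bar>t\<bar> < r\<close>] by simp
      moreover have "((\<lambda>k::nat. if k = 0 then 1 else 0) has_sum (1::complex)) UNIV"
        by (rule has_sum_finite_neutralI[of "{0}"]) auto
      ultimately have "((\<lambda>(j, k). c j 0 * of_real (t ^ j) * (if k = 0 then 1 else 0)) has_sum 0 * 1) (UNIV :: (nat \<times> nat) set)"
        by (rule has_sum_times)
      also have "(\<lambda>(j, k::nat). c j 0 * of_real (t ^ j) * (if k = 0 then 1 else 0))
          = (\<lambda>(j, k). (if k = 0 then c j 0 else 0) * complex_of_real (t ^ j * s ^ k))"
        by (auto simp: fun_eq_iff)
      finally show "((\<lambda>(j, k). (if k = 0 then c j 0 else 0) * complex_of_real (t ^ j * s ^ k)) has_sum 0) UNIV" by simp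
    qed
    moreover have "double_power_series (\<lambda>t s. 0) (\<lambda>j k. 0) r"
      unfolding double_power_series_def using r by (auto simp: case_prod_unfold)
    ultimately have "(\<lambda>j k. if k = 0 then c j 0 else 0) = (\<lambda>(j::nat) (k::nat). 0)" by (rule double_power_series_unique)
    then have "c k 0 = 0" by meson
    then show ?thesis using herm[of 0 k] by simp
  qed
qed

text \<open>The kernel of the shifted Schur complement is
  \<open>(K x y - K x 0 * K 0 y / K 0 0) / (x * y)\<close>; it is positive definite away from the axes,
  hence everywhere by continuity.\<close>

lemma psd_series_schur_shift:
  assumes c: "psd_series c r"
  shows "psd_series (schur_shift c) r"
proof -
  obtain K where K: "double_power_series K c r" and psd: "psd_on {-r<..<r} K"
    using c unfolding psd_series_def by blast
  have r: "r > 0" using K by (simp add: double_power_series_def)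
  have K0: "K 0 0 = c 0 0" by (rule double_power_series_at_0[OF K])
  have z: "c 0 k = 0" "c k 0 = 0" if "c 0 0 = 0" for k
    using psd_series_facts(2)[OF c, of k 0] psd_series_facts(3)[OF c that] by simp_all
  define L where "L x y = K x y - K x 0 * K 0 y / K 0 0" for x y
  define d where "d j k = c j k - c j 0 * c 0 k / c 0 0" for j k
  have L: "double_power_series L d r"
    unfolding double_power_series_def
  proof (intro conjI allI impI r)
    fix x y assume x: "\<bar>x\<bar> < r" and y: "\<bar>y\<bar> < r"
    have "((\<lambda>k. c 0 k * of_real (y ^ k)) has_sum K 0 y) UNIV"
      using double_power_series_edge[OF double_power_series_swap[OF K] y] by simp
    from has_sum_cmult_right[OF has_sum_times[OF double_power_series_edge[OF K x] this], of "- inverse (c 0 0)"]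
    have "((\<lambda>(j, k). - inverse (c 0 0) * (c j 0 * of_real (x ^ j) * (c 0 k * of_real (y ^ k))))
            has_sum - inverse (c 0 0) * (K x 0 * K 0 y)) UNIV" by (simp add: case_prod_unfold)
    moreover have "((\<lambda>(j, k). c j k * of_real (x ^ j * y ^ k)) has_sum K x y) UNIV"
      using K x y unfolding double_power_series_def by blast
    ultimately have "((\<lambda>p. (case p of (j, k) \<Rightarrow> c j k * of_real (x ^ j * y ^ k)) +
            (case p of (j, k) \<Rightarrow> - inverse (c 0 0) * (c j 0 * of_real (x ^ j) * (c 0 k * of_real (y ^ k)))))
            has_sum K x y + - inverse (c 0 0) * (K x 0 * K 0 y)) UNIV" by (intro has_sum_add)
    moreover have "(\<lambda>p. (case p of (j, k) \<Rightarrow> c j k * of_real (x ^ j * y ^ k)) +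
            (case p of (j, k) \<Rightarrow> - inverse (c 0 0) * (c j 0 * of_real (x ^ j) * (c 0 k * of_real (y ^ k)))))
          = (\<lambda>(j, k). d j k * of_real (x ^ j * y ^ k))"
      by (auto simp: fun_eq_iff d_def divide_inverse algebra_simps)
    moreover have "K x y + - inverse (c 0 0) * (K x 0 * K 0 y) = L x y"
      by (simp add: L_def K0 divide_inverse mult_ac)
    ultimately show "((\<lambda>(j, k). d j k * of_real (x ^ j * y ^ k)) has_sum L x y) UNIV" by simp
  qed
  \<comment> \<open>For a nonzero corner the quotient cancels the edge exactly; for a zero corner
    the quotient is 0 and the edge vanishes by \<open>z\<close>.\<close>
  have d0: "d j 0 = 0" "d 0 j = 0" for j using z[of j] by (auto simp: d_def)
  obtain G where G: "double_power_series G (\<lambda>j k. d (Suc j) (Suc k)) r"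
    "\<And>x y. \<bar>x\<bar> < r \<Longrightarrow> \<bar>y\<bar> < r \<Longrightarrow> L x y = of_real (x * y) * G x y"
    using double_power_series_shift[OF L d0] by metis
  have "psd_on {-r<..<r} L"
    unfolding L_def using psd_on_schur[OF psd, of 0] r by simp
  then have "psd_on ({-r<..<r} - {0}) G"
    using G(2) by (rule psd_on_divide) (auto simp: abs_less_iff)
  then have "psd_on {-r<..<r} G" using psd_on_insert_0[OF G(1)] by blast
  moreover have "(\<lambda>j k. d (Suc j) (Suc k)) = schur_shift c" by (simp add: fun_eq_iff d_def schur_shift_def)
  ultimately show ?thesis using G(1) unfolding psd_series_def by auto
qed

text \<open>Each elimination step contributes one coordinate, the normalized first row of the
  current matrix. Since step \<open>k\<close> has removed the first \<open>k\<close> rows and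
  columns, the factor is triangular and the Gram sum stops after the coordinate
  \<open>min p q\<close>.\<close>

lemma psd_series_factorization:
  assumes c: "psd_series c r"
  obtains v :: "nat \<Rightarrow> nat \<Rightarrow> complex" where "\<And>p k. p < k \<Longrightarrow> v p k = 0"
    "\<And>p q N. min p q < N \<Longrightarrow> c p q = (\<Sum>k<N. cnj (v p k) * v q k)"
proof -
  define C where "C n = (schur_shift ^^ n) c" for n
  have C: "psd_series (C n) r" for n
    unfolding C_def by (induction n) (auto simp: c psd_series_schur_shift)
  \<comment> \<open>Entry \<open>k\<close> of vector \<open>p\<close> for the matrix
    \<open>C n\<close> comes from the matrix after \<open>k\<close> further steps. A zero pivot
    gives the entry 0; \<open>edge\<close> shows that nothing is lost.\<close>
  define u where "u n p k = (if p < k then 0 else C (n + k) 0 (p - k) / of_real (sqrt (Re (C (n + k) 0 0))))" for n p k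
  have sq: "of_real (sqrt (Re (C n 0 0))) * of_real (sqrt (Re (C n 0 0))) = C n 0 0" for n
  proof -
    have "Re (C n 0 0) \<ge> 0" "Im (C n 0 0) = 0"
      using psd_series_facts(1)[OF C] by (auto simp: complex_nonneg_Reals_iff)
    then show ?thesis by (simp add: complex_eq_iff)
  qed
  have pr: "cnj (u n p 0) * u n q 0 = C n p 0 * C n 0 q / C n 0 0" for n p q
  proof -
    have "cnj (u n p 0) * u n q 0
        = cnj (C n 0 p) * C n 0 q / (of_real (sqrt (Re (C n 0 0))) * of_real (sqrt (Re (C n 0 0))))"
      by (simp add: u_def)
    also have "cnj (C n 0 p) = C n p 0" using psd_series_facts(2)[OF C, of n p 0] by simp
    finally show ?thesis by (simp only: sq)
  qed
  have edge: "C n p 0 * C n 0 q / C n 0 0 = C n p q" if "p = 0 \<or> q = 0" for n p q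
  proof (cases "C n 0 0 = 0")
    case True
    have "C n 0 k = 0" "C n k 0 = 0" for k
      using psd_series_facts(2)[OF C, of n k 0] psd_series_facts(3)[OF C True] by simp_all
    then show ?thesis using that by auto
  qed (use that in auto)
  \<comment> \<open>The induction on \<open>p\<close> runs for all \<open>n\<close> at once: peeling
    off coordinate 0 undoes one \<open>schur_shift\<close> and leaves the claim for
    \<open>Suc n\<close>, with both indices lowered by 1.\<close>
  have main: "C n p q = (\<Sum>k<N. cnj (u n p k) * u n q k)" if "min p q < N" for n p q N
    using that
  proof (induction p arbitrary: n q N)
    case 0
    then obtain N' where N: "N = Suc N'" by (cases N) auto
    have "(\<Sum>k<N. cnj (u n 0 k) * u n q k) = cnj (u n 0 0) * u n q 0"
      unfolding N sum.lessThan_Suc_shift by (simp add: u_def)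
    then show ?case using edge[of 0 q n] by (simp add: pr)
  next
    case (Suc p)
    then obtain N' where N: "N = Suc N'" by (cases N) auto
    show ?case
    proof (cases q)
      case 0
      have "(\<Sum>k<N. cnj (u n (Suc p) k) * u n q k) = cnj (u n (Suc p) 0) * u n q 0"
        unfolding N sum.lessThan_Suc_shift by (simp add: u_def 0)
      then show ?thesis using edge[of "Suc p" q n] by (simp add: pr 0)
    next
      case (Suc q')
      have sh: "u n (Suc p') (Suc k) = u (Suc n) p' k" for p' k by (simp add: u_def)
      have "(\<Sum>k<N. cnj (u n (Suc p) k) * u n q k)
          = cnj (u n (Suc p) 0) * u n q 0 + (\<Sum>k<N'. cnj (u (Suc n) p k) * u (Suc n) q' k)"
        unfolding N sum.lessThan_Suc_shift Suc sh ..
      also have "(\<Sum>k<N'. cnj (u (Suc n) p k) * u (Suc n) q' k) = C (Suc n) p q'"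
        using Suc.prems N Suc by (intro Suc.IH[symmetric]) auto
      also have "C (Suc n) p q' = C n (Suc p) (Suc q') - C n (Suc p) 0 * C n 0 (Suc q') / C n 0 0"
        by (simp add: C_def schur_shift_def)
      finally show ?thesis by (simp add: pr Suc)
    qed
  qed
  show thesis
  proof (rule that)
    show "u 0 p k = 0" if "p < k" for p k using that by (simp add: u_def)
    show "c p q = (\<Sum>k<N. cnj (u 0 p k) * u 0 q k)" if "min p q < N" for p q N
      using main[OF that, of 0] by (simp add: C_def)
  qed
qed

subsection \<open>A moment problem for functionals of bounded variation\<close>

text \<open>The retraction onto the unit interval; it makes continuous functions bounded and
  measures the distance to the interval.\<close>

definition clamp01 :: "real \<Rightarrow> real" where
  "clamp01 x = max 0 (min 1 x)"

lemma clamp01_mem: "clamp01 x \<in> {0..1}"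
  by (auto simp: clamp01_def)

lemma clamp01_id: "x \<in> {0..1} \<Longrightarrow> clamp01 x = x"
  by (auto simp: clamp01_def)

lemma continuous_clamp01: "continuous_on UNIV clamp01"
  unfolding clamp01_def by (intro continuous_intros)

text \<open>Measures are kept on the whole line, with the support as an almost sure condition, so
  that weak convergence and tightness of real distributions apply.\<close>

definition prob_on_unit :: "real measure \<Rightarrow> bool" where
  "prob_on_unit \<rho> \<longleftrightarrow> real_distribution \<rho> \<and> (AE x in \<rho>. x \<in> {0..1})"

lemma prob_on_unit_integrable:
  fixes f :: "real \<Rightarrow> complex"
  assumes \<rho>: "prob_on_unit \<rho>" and f: "f \<in> borel_measurable borel" and b: "\<And>x. x \<in> {0..1} \<Longrightarrow> cmod (f x) \<le> b"
  shows "integrable \<rho> f" "cmod (\<integral>x. f x \<partial>\<rho>) \<le> b"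
proof -
  interpret real_distribution \<rho> using \<rho> by (simp add: prob_on_unit_def)
  have ae: "AE x in \<rho>. cmod (f x) \<le> b"
    using \<rho>[unfolded prob_on_unit_def, THEN conjunct2] by (rule eventually_mono) (rule b)
  have m: "f \<in> borel_measurable \<rho>" using f by simp
  show int: "integrable \<rho> f" by (rule integrable_const_bound[OF ae m])
  have "cmod (\<integral>x. f x \<partial>\<rho>) \<le> (\<integral>x. cmod (f x) \<partial>\<rho>)" by (rule integral_norm_bound)
  also have "\<dots> \<le> (\<integral>x. b \<partial>\<rho>)"
    using ae int by (intro integral_mono_AE) auto
  also have "\<dots> = b" using prob_space by simp
  finally show "cmod (\<integral>x. f x \<partial>\<rho>) \<le> b" .
qed

text \<open>The bounded continuous \<open>h\<close> vanishes exactly on the unit interval, so its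
  zero integrals pass to the limit and confine the support. Replacing \<open>f x\<close> by
  \<open>f (clamp01 x)\<close> then makes unbounded continuous functions legitimate for weak
  convergence.\<close>

lemma prob_on_unit_weak_limit:
  assumes \<mu>: "\<And>n. prob_on_unit (\<mu> n)" and \<rho>: "real_distribution \<rho>" and w: "weak_conv_m \<mu> \<rho>"
  shows "prob_on_unit \<rho>"
    "\<And>f :: real \<Rightarrow> complex. continuous_on UNIV f \<Longrightarrow> (\<lambda>n. \<integral>x. f x \<partial>\<mu> n) \<longlonglongrightarrow> (\<integral>x. f x \<partial>\<rho>)"
proof -
  interpret \<rho>: real_distribution \<rho> by (rule \<rho>)
  have \<mu>d: "real_distribution (\<mu> n)" for n using \<mu> by (simp add: prob_on_unit_def)
  define h where "h x = min 1 \<bar>x - clamp01 x\<bar>" for x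
  have hc: "continuous_on UNIV h" unfolding h_def by (intro continuous_intros continuous_clamp01)
  have "(\<lambda>n. \<integral>x. h x \<partial>\<mu> n) \<longlonglongrightarrow> (\<integral>x. h x \<partial>\<rho>)"
    by (rule weak_conv_imp_integral_bdd_continuous_conv[OF \<mu>d \<rho> w, where B = 1])
       (use hc in \<open>auto simp: continuous_on_eq_continuous_at h_def\<close>)
  moreover have "(\<integral>x. h x \<partial>\<mu> n) = 0" for n
  proof (rule integral_eq_zero_AE)
    show "AE x in \<mu> n. h x = 0"
      using \<mu>[of n, unfolded prob_on_unit_def, THEN conjunct2]
      by (rule eventually_mono) (auto simp: h_def clamp01_def)
  qed
  ultimately have "(\<integral>x. h x \<partial>\<rho>) = 0" by (simp add: LIMSEQ_const_iff)
  moreover have "integrable \<rho> h"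
    by (rule \<rho>.integrable_const_bound[where B = 1])
       (use borel_measurable_continuous_onI[OF hc] in \<open>auto simp: h_def\<close>)
  ultimately have "AE x in \<rho>. h x = 0"
    by (subst (asm) integral_nonneg_eq_0_iff_AE) (auto simp: h_def)
  then have "AE x in \<rho>. x \<in> {0..1}"
    by (rule eventually_mono) (auto simp: h_def clamp01_def min_def max_def split: if_splits)
  then show p: "prob_on_unit \<rho>" using \<rho> by (simp add: prob_on_unit_def)
  fix f :: "real \<Rightarrow> complex" assume f: "continuous_on UNIV f"
  define g where "g x = f (clamp01 x)" for x
  obtain b where b: "\<And>x. x \<in> {0..1} \<Longrightarrow> cmod (f x) \<le> b"
    using bounded_borelD[OF bounded_borel_continuous[OF f]] by metis
  have gc: "continuous_on UNIV g"
    unfolding g_def by (rule continuous_on_compose2[OF f continuous_clamp01]) auto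
  have fg: "(\<integral>x. g x \<partial>\<nu>) = (\<integral>x. f x \<partial>\<nu>)" if "prob_on_unit \<nu>" for \<nu>
  proof (rule integral_cong_AE)
    interpret real_distribution \<nu> using that by (simp add: prob_on_unit_def)
    show "g \<in> borel_measurable \<nu>" "f \<in> borel_measurable \<nu>"
      using borel_measurable_continuous_onI[OF gc] borel_measurable_continuous_onI[OF f] by auto
    show "AE x in \<nu>. g x = f x"
      using that[unfolded prob_on_unit_def, THEN conjunct2]
      by (rule eventually_mono) (simp add: g_def clamp01_id)
  qed
  have "(\<lambda>n. \<integral>x. g x \<partial>\<mu> n) \<longlonglongrightarrow> (\<integral>x. g x \<partial>\<rho>)"
    by (rule weak_conv_imp_integral_bdd_continuous_conv[OF \<mu>d \<rho> w, where B = b])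
       (use gc b clamp01_mem in \<open>auto simp: continuous_on_eq_continuous_at g_def\<close>)
  then show "(\<lambda>n. \<integral>x. f x \<partial>\<mu> n) \<longlonglongrightarrow> (\<integral>x. f x \<partial>\<rho>)" by (simp add: fg \<mu> p)
qed

lemma prob_on_unit_tight:
  assumes "\<And>n. prob_on_unit (\<mu> n)" shows "tight \<mu>"
  unfolding tight_def
proof (intro conjI allI impI)
  show "real_distribution (\<mu> n)" for n using assms by (simp add: prob_on_unit_def)
  fix e :: real assume e: "e > 0"
  have "measure (\<mu> n) {-1<..1} = 1" for n
  proof -
    interpret real_distribution "\<mu> n" using assms by (simp add: prob_on_unit_def)
    show ?thesis
      using assms[of n, unfolded prob_on_unit_def, THEN conjunct2]
      by (subst prob_eq_1) (auto elim: eventually_mono)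
  qed
  then show "\<exists>a b. a < b \<and> (\<forall>n. 1 - e < measure (\<mu> n) {a<..b})"
    using e by (intro exI[of _ "-1"] exI[of _ 1]) auto
qed

text \<open>Each sequence in turn is thinned out further by tightness; weak limits already obtained
  persist along subsequences.\<close>

lemma helly_finite:
  assumes "\<And>i n. i < (k::nat) \<Longrightarrow> prob_on_unit (\<mu> i n)"
  shows "\<exists>s \<rho>. strict_mono (s :: nat \<Rightarrow> nat) \<and>
           (\<forall>i<k. real_distribution (\<rho> i) \<and> weak_conv_m (\<lambda>n. \<mu> i (s n)) (\<rho> i))"
  using assms
proof (induction k)
  case 0
  show ?case by (intro exI[of _ id]) (simp add: strict_mono_def)
next
  case (Suc k)
  then obtain s \<rho> where s: "strict_mono (s :: nat \<Rightarrow> nat)"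
    and \<rho>: "\<And>i. i < k \<Longrightarrow> real_distribution (\<rho> i)" "\<And>i. i < k \<Longrightarrow> weak_conv_m (\<lambda>n. \<mu> i (s n)) (\<rho> i)"
    by (metis less_SucI)
  have "tight (\<mu> k)" using Suc.prems by (intro prob_on_unit_tight) auto
  from tight_imp_convergent_subsubsequence[OF this s]
  obtain r \<nu> where r: "strict_mono (r :: nat \<Rightarrow> nat)" and \<nu>: "real_distribution \<nu>" "weak_conv_m (\<mu> k \<circ> s \<circ> r) \<nu>"
    by blast
  have "weak_conv_m (\<lambda>n. \<mu> i (s (r n))) (\<rho> i)" if "i < k" for i
    using \<rho>(2)[OF that] LIMSEQ_subseq_LIMSEQ[OF _ r] unfolding weak_conv_m_def weak_conv_def
    by (fastforce simp: o_def)
  then have "\<forall>i<Suc k. real_distribution ((\<rho>(k := \<nu>)) i) \<and> weak_conv_m (\<lambda>n. \<mu> i ((s \<circ> r) n)) ((\<rho>(k := \<nu>)) i)"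
    using \<rho>(1) \<nu> by (auto simp: less_Suc_eq o_def)
  moreover have "strict_mono (s \<circ> r)" using s r by (rule strict_mono_o)
  ultimately show ?case by blast
qed

text \<open>The leftover mass \<open>1 - (\<Sum>m\<le>K. q m)\<close> is placed at the origin.\<close>

lemma discrete_prob_on_unit:
  assumes q: "\<And>m. q m \<ge> (0::real)" and le: "(\<Sum>m\<le>K. q m) \<le> 1"
  obtains \<rho> where "prob_on_unit \<rho>"
    "\<And>f :: real \<Rightarrow> complex. f \<in> borel_measurable borel \<Longrightarrow>
       (\<integral>x. f x \<partial>\<rho>) = (\<Sum>m\<le>K. of_real (q m) * f (real m / real K)) + of_real (1 - (\<Sum>m\<le>K. q m)) * f 0"
proof -
  define w where "w m = q m + (if m = 0 then 1 - (\<Sum>m\<le>K. q m) else 0)" for m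
  have w0: "w m \<ge> 0" for m using q[of m] le by (simp add: w_def)
  have w1: "(\<Sum>m\<le>K. w m) = 1" by (simp add: w_def sum.distrib)
  define P where "P = point_measure {..K} (\<lambda>m. ennreal (w m))"
  \<comment> \<open>For \<open>K = 0\<close> the single node is \<open>0 / 0 = 0\<close>, still in
    the unit interval.\<close>
  define \<rho> where "\<rho> = distr P borel (\<lambda>m. real m / real K)"
  have "prob_space P"
  proof (rule prob_spaceI)
    have "emeasure P {..K} = (\<Sum>m\<le>K. ennreal (w m))"
      unfolding P_def by (rule emeasure_point_measure_finite) auto
    also have "\<dots> = 1" using w0 w1 by (simp add: sum_ennreal)
    finally show "emeasure P (space P) = 1" by (simp add: P_def space_point_measure)
  qed
  then interpret P: prob_space P .
  have meas: "(\<lambda>m. real m / real K) \<in> measurable P borel" by (simp add: P_def measurable_point_measure_eq1)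
  have "prob_space \<rho>" unfolding \<rho>_def by (rule P.prob_space_distr[OF meas])
  then have "real_distribution \<rho>" by (simp add: real_distribution_def real_distribution_axioms_def \<rho>_def)
  moreover have "AE x in \<rho>. x \<in> {0..1}"
    unfolding \<rho>_def
  proof (subst AE_distr_iff[OF meas])
    show "AE x in P. real x / real K \<in> {0..1}"
      by (rule AE_I2) (auto simp: P_def space_point_measure divide_le_eq_1)
  qed auto
  ultimately have "prob_on_unit \<rho>" by (simp add: prob_on_unit_def)
  moreover have "(\<integral>x. f x \<partial>\<rho>) = (\<Sum>m\<le>K. of_real (q m) * f (real m / real K)) + of_real (1 - (\<Sum>m\<le>K. q m)) * f 0"
    if "f \<in> borel_measurable borel" for f :: "real \<Rightarrow> complex"
  proof -
    have "(\<integral>x. f x \<partial>\<rho>) = (\<integral>m. f (real m / real K) \<partial>P)"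
      unfolding \<rho>_def by (rule integral_distr[OF meas that])
    also have "\<dots> = (\<Sum>m\<le>K. w m *\<^sub>R f (real m / real K))"
      unfolding P_def using w0 by (intro lebesgue_integral_point_measure_finite) auto
    also have "\<dots> = (\<Sum>m\<le>K. of_real (q m) * f (real m / real K)
        + (if m = 0 then of_real (1 - (\<Sum>m\<le>K. q m)) * f 0 else 0))"
      by (intro sum.cong refl) (auto simp: w_def scaleR_conv_of_real algebra_simps)
    finally show ?thesis by (simp add: sum.distrib)
  qed
  ultimately show thesis by (rule that)
qed

lemma weierstrass_complex:
  fixes f :: "real \<Rightarrow> complex"
  assumes f: "continuous_on {0..1} f" and e: "e > 0"
  shows "\<exists>(a :: nat \<Rightarrow> complex) n. \<forall>x\<in>{0..1}. cmod (f x - (\<Sum>i\<le>n. a i * of_real x ^ i)) \<le> e"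
proof -
  have re: "continuous_on {0..1} (\<lambda>x. Re (f x))" "continuous_on {0..1} (\<lambda>x. Im (f x))"
    by (intro continuous_intros f)+
  obtain g where g: "real_polynomial_function g" "\<And>x. x \<in> {0..1} \<Longrightarrow> \<bar>Re (f x) - g x\<bar> < e / 2"
    using Stone_Weierstrass_real_polynomial_function[OF _ re(1), of "e / 2"] e by auto
  obtain h where h: "real_polynomial_function h" "\<And>x. x \<in> {0..1} \<Longrightarrow> \<bar>Im (f x) - h x\<bar> < e / 2"
    using Stone_Weierstrass_real_polynomial_function[OF _ re(2), of "e / 2"] e by auto
  obtain a n where a: "g = (\<lambda>x. \<Sum>i\<le>n. a i * x ^ i)" using g(1) real_polynomial_function_iff_sum by blast
  obtain b m where b: "h = (\<lambda>x. \<Sum>i\<le>m. b i * x ^ i)" using h(1) real_polynomial_function_iff_sum by blast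
  \<comment> \<open>Coefficients of both real polynomials are padded by 0 to a common
    degree.\<close>
  define a' where "a' i = (if i \<le> n then a i else 0)" for i
  define b' where "b' i = (if i \<le> m then b i else 0)" for i
  have g': "g x = (\<Sum>i\<le>n + m. a' i * x ^ i)" for x
    unfolding a by (rule sum.mono_neutral_cong_left) (auto simp: a'_def)
  have h': "h x = (\<Sum>i\<le>n + m. b' i * x ^ i)" for x
    unfolding b by (rule sum.mono_neutral_cong_left) (auto simp: b'_def)
  have "cmod (f x - (\<Sum>i\<le>n + m. Complex (a' i) (b' i) * of_real x ^ i)) \<le> e" if "x \<in> {0..1}" for x
  proof -
    have "(\<Sum>i\<le>n + m. Complex (a' i) (b' i) * of_real x ^ i) = Complex (g x) (h x)"
      unfolding g' h' by (simp add: complex_eq_iff flip: of_real_power)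
    then have "cmod (f x - (\<Sum>i\<le>n + m. Complex (a' i) (b' i) * of_real x ^ i)) \<le> \<bar>Re (f x) - g x\<bar> + \<bar>Im (f x) - h x\<bar>"
      using cmod_le[of "f x - Complex (g x) (h x)"] by simp
    then show ?thesis using g(2)[OF that] h(2)[OF that] by linarith
  qed
  then show ?thesis by (intro exI[of _ "\<lambda>i. Complex (a' i) (b' i)"] exI[of _ "n + m"]) blast
qed

text \<open>Each of the four sequences of positive parts of \<open>\<plusminus>Re\<close>, \<open>\<plusminus>Im\<close> of the weights is completed
  to a probability measure on the unit interval; the fifth measure is the point mass at the origin
  correcting for the added masses, which cancel up to the total weight since
  \<open>1 + \<i> - 1 - \<i> = 0\<close>.\<close>

lemma discrete_riesz:
  fixes c :: "nat \<Rightarrow> nat \<Rightarrow> complex"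
  assumes D: "\<And>K. (\<Sum>m\<le>K. cmod (c K m)) \<le> D"
    and lim: "\<And>n. convergent (\<lambda>K. \<Sum>m\<le>K. of_real (real m / real K) ^ n * c K m)"
  shows "\<exists>\<rho> \<beta>. (\<forall>j<5. prob_on_unit (\<rho> j)) \<and>
     (\<forall>f. continuous_on UNIV f \<longrightarrow>
        (\<lambda>K. \<Sum>m\<le>K. f (real m / real K) * c K m) \<longlonglongrightarrow> (\<Sum>j<(5::nat). \<beta> j * (\<integral>x. f x \<partial>\<rho> j)))"
proof -
  \<comment> \<open>A positive normalization even if \<open>D = 0\<close>; the positive parts
    divided by \<open>E\<close> have total mass at most 1.\<close>
  define E where "E = D + 1"
  have D0: "D \<ge> 0" using order_trans[OF sum_nonneg D] by (metis norm_ge_zero)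
  have E: "E > 0" using D0 by (simp add: E_def)
  \<comment> \<open>For \<open>j = 0, 1, 2, 3\<close> these are the positive parts of
    \<open>Re\<close>, \<open>Im\<close>, \<open>- Re\<close> and \<open>- Im\<close> of the
    weight.\<close>
  define r where "r j K m = max 0 (Re (c K m * (- \<i>) ^ j))" for j K m
  have r0: "r j K m \<ge> 0" for j K m by (simp add: r_def)
  have rle: "(\<Sum>m\<le>K. r j K m / E) \<le> 1" for j K
  proof -
    have "(\<Sum>m\<le>K. r j K m) \<le> (\<Sum>m\<le>K. cmod (c K m))"
    proof (rule sum_mono)
      fix m
      have "Re (c K m * (- \<i>) ^ j) \<le> cmod (c K m * (- \<i>) ^ j)" by (rule complex_Re_le_cmod)
      then show "r j K m \<le> cmod (c K m)" by (simp add: r_def norm_mult norm_power)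
    qed
    then have "(\<Sum>m\<le>K. r j K m) \<le> E" using D[of K] by (simp add: E_def)
    then show ?thesis using E by (simp flip: sum_divide_distrib)
  qed
  define Q where "Q \<rho> j K \<longleftrightarrow> prob_on_unit \<rho> \<and> (\<forall>f :: real \<Rightarrow> complex. f \<in> borel_measurable borel \<longrightarrow>
       (\<integral>x. f x \<partial>\<rho>) = (\<Sum>m\<le>K. of_real (r j K m / E) * f (real m / real K)) + of_real (1 - (\<Sum>m\<le>K. r j K m / E)) * f 0)"
    for \<rho> j K
  define \<mu> where "\<mu> j K = (SOME \<rho>. Q \<rho> j K)" for j K
  have "\<exists>\<rho>. Q \<rho> j K" for j K
    by (rule discrete_prob_on_unit[of "\<lambda>m. r j K m / E" K]) (use r0 E rle in \<open>auto simp: Q_def\<close>)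
  then have Q: "Q (\<mu> j K) j K" for j K unfolding \<mu>_def by (rule someI_ex)
  have \<mu>: "prob_on_unit (\<mu> j K)" for j K using Q[of j K] by (simp add: Q_def)
  have \<mu>f: "(\<integral>x. f x \<partial>\<mu> j K) = (\<Sum>m\<le>K. of_real (r j K m / E) * f (real m / real K)) + of_real (1 - (\<Sum>m\<le>K. r j K m / E)) * f 0"
    if "f \<in> borel_measurable borel" for j K and f :: "real \<Rightarrow> complex"
    using Q[of j K, unfolded Q_def, THEN conjunct2, rule_format, OF that] .
  have four: "(\<Sum>j<(4::nat). \<i> ^ j * of_real (r j K m)) = c K m" for K m
    by (simp add: r_def eval_nat_numeral complex_eq_iff max_def)
  have i4: "(\<Sum>j<(4::nat). \<i> ^ j) = 0" by (simp add: eval_nat_numeral)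
  have rep: "(\<Sum>m\<le>K. f (real m / real K) * c K m)
      = (\<Sum>j<(4::nat). of_real E * \<i> ^ j * (\<integral>x. f x \<partial>\<mu> j K)) + (\<Sum>m\<le>K. c K m) * f 0"
    if f: "f \<in> borel_measurable borel" for f K
  proof -
    have "of_real E * \<i> ^ j * (\<integral>x. f x \<partial>\<mu> j K) = (\<Sum>m\<le>K. \<i> ^ j * of_real (r j K m) * f (real m / real K))
        + (of_real E * \<i> ^ j - (\<Sum>m\<le>K. \<i> ^ j * of_real (r j K m))) * f 0" for j
      unfolding \<mu>f[OF f] using E by (simp add: field_simps sum_distrib_left sum_distrib_right sum_divide_distrib)
    then have "(\<Sum>j<(4::nat). of_real E * \<i> ^ j * (\<integral>x. f x \<partial>\<mu> j K))
        = (\<Sum>j<4. \<Sum>m\<le>K. \<i> ^ j * of_real (r j K m) * f (real m / real K))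
          + (of_real E * (\<Sum>j<4. \<i> ^ j) - (\<Sum>j<4. \<Sum>m\<le>K. \<i> ^ j * of_real (r j K m))) * f 0"
      by (simp add: sum.distrib sum_subtractf sum_distrib_left sum_distrib_right left_diff_distrib)
    also have "(\<Sum>j<(4::nat). \<Sum>m\<le>K. \<i> ^ j * of_real (r j K m) * f (real m / real K)) = (\<Sum>m\<le>K. f (real m / real K) * c K m)"
      by (subst sum.swap) (simp only: sum_distrib_right[symmetric] four mult.commute[of _ "c K _"])
    also have "(\<Sum>j<(4::nat). \<Sum>m\<le>K. \<i> ^ j * of_real (r j K m)) = (\<Sum>m\<le>K. c K m)"
      by (subst sum.swap) (simp add: four)
    finally show ?thesis by (simp add: i4)
  qed
  obtain s \<nu> where s: "strict_mono (s :: nat \<Rightarrow> nat)"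
    and \<nu>: "\<And>i. i < (4::nat) \<Longrightarrow> real_distribution (\<nu> i)" "\<And>i. i < 4 \<Longrightarrow> weak_conv_m (\<lambda>n. \<mu> i (s n)) (\<nu> i)"
    using helly_finite[of 4 \<mu>] \<mu> by blast
  note wl = prob_on_unit_weak_limit[OF \<mu> \<nu>]
  obtain \<alpha> where \<alpha>: "(\<lambda>K. \<Sum>m\<le>K. c K m) \<longlonglongrightarrow> \<alpha>" using lim[of 0] by (auto simp: convergent_def)
  define \<rho> where "\<rho> j = (if j < 4 then \<nu> j else return borel 0)" for j :: nat
  define \<beta> where "\<beta> j = (if j < 4 then of_real E * \<i> ^ j else \<alpha>)" for j :: nat
  have p\<rho>: "prob_on_unit (\<rho> j)" for j
  proof (cases "j < 4")
    case False
    have "prob_space (return borel (0::real))" by (rule prob_space_return) simp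
    then show ?thesis
      using False by (simp add: \<rho>_def prob_on_unit_def real_distribution_def real_distribution_axioms_def AE_return)
  qed (simp add: \<rho>_def wl)
  define I where "I f = (\<Sum>j<(5::nat). \<beta> j * (\<integral>x. f x \<partial>\<rho> j))" for f
  define S where "S f K = (\<Sum>m\<le>K. f (real m / real K) * c K m)" for f K
  have Isplit: "I f = (\<Sum>j<(4::nat). of_real E * \<i> ^ j * (\<integral>x. f x \<partial>\<nu> j)) + \<alpha> * f 0"
    if f: "f \<in> borel_measurable borel" for f
  proof -
    have "(\<Sum>j<(5::nat). \<beta> j * (\<integral>x. f x \<partial>\<rho> j)) = (\<Sum>j<(4::nat). \<beta> j * (\<integral>x. f x \<partial>\<rho> j)) + \<beta> 4 * (\<integral>x. f x \<partial>\<rho> 4)"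
      using sum.lessThan_Suc[of "\<lambda>j. \<beta> j * (\<integral>x. f x \<partial>\<rho> j)" 4] by simp
    moreover have "(\<integral>x. f x \<partial>\<rho> 4) = f 0" using f by (simp add: \<rho>_def integral_return)
    ultimately show ?thesis by (simp add: I_def \<rho>_def \<beta>_def)
  qed
  have sub: "(\<lambda>n. S f (s n)) \<longlonglongrightarrow> I f" if f: "continuous_on UNIV f" for f
  proof -
    have fm: "f \<in> borel_measurable borel" using f by (rule borel_measurable_continuous_onI)
    have "(\<lambda>n. (\<Sum>j<(4::nat). of_real E * \<i> ^ j * (\<integral>x. f x \<partial>\<mu> j (s n))) + (\<Sum>m\<le>s n. c (s n) m) * f 0) \<longlonglongrightarrow> I f"
      unfolding Isplit[OF fm]
      using LIMSEQ_subseq_LIMSEQ[OF \<alpha> s]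
      by (intro tendsto_add tendsto_sum tendsto_mult tendsto_const wl f) (auto simp: o_def)
    then show ?thesis unfolding S_def rep[OF fm] .
  qed
  \<comment> \<open>Selection gives convergence along \<open>s\<close> only. For powers the full
    sequence converges by hypothesis, so the subsequential limit is its limit; density of
    polynomials then extends this to continuous functions.\<close>
  have pow: "(\<lambda>K. S (\<lambda>x. of_real x ^ n) K) \<longlonglongrightarrow> I (\<lambda>x. of_real x ^ n)" for n
  proof -
    obtain l where l: "(\<lambda>K. S (\<lambda>x. of_real x ^ n) K) \<longlonglongrightarrow> l" using lim[of n] by (auto simp: convergent_def S_def)
    have "(\<lambda>k. S (\<lambda>x. of_real x ^ n) (s k)) \<longlonglongrightarrow> l" using LIMSEQ_subseq_LIMSEQ[OF l s] by (simp add: o_def)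
    moreover have "(\<lambda>k. S (\<lambda>x. of_real x ^ n) (s k)) \<longlonglongrightarrow> I (\<lambda>x. of_real x ^ n)" by (intro sub continuous_intros)
    ultimately have "l = I (\<lambda>x. of_real x ^ n)" by (rule LIMSEQ_unique)
    with l show ?thesis by simp
  qed
  have intg: "integrable (\<rho> j) f" if f: "continuous_on UNIV f" for f :: "real \<Rightarrow> complex" and j
  proof -
    obtain b where "\<And>x. x \<in> {0..1} \<Longrightarrow> cmod (f x) \<le> b"
      using bounded_borelD[OF bounded_borel_continuous[OF f]] by metis
    then show ?thesis
      by (rule prob_on_unit_integrable(1)[OF p\<rho> borel_measurable_continuous_onI[OF f]])
  qed
  have poly: "(\<lambda>K. S (\<lambda>x. \<Sum>i\<le>n. a i * of_real x ^ i) K) \<longlonglongrightarrow> I (\<lambda>x. \<Sum>i\<le>n. a i * of_real x ^ i)" for n a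
  proof -
    have "S (\<lambda>x. \<Sum>i\<le>n. a i * of_real x ^ i) K = (\<Sum>i\<le>n. a i * S (\<lambda>x. of_real x ^ i) K)" for K
    proof -
      have "S (\<lambda>x. \<Sum>i\<le>n. a i * of_real x ^ i) K = (\<Sum>m\<le>K. \<Sum>i\<le>n. a i * (of_real (real m / real K) ^ i * c K m))"
        by (simp only: S_def sum_distrib_right mult.assoc)
      also have "\<dots> = (\<Sum>i\<le>n. a i * S (\<lambda>x. of_real x ^ i) K)"
        by (subst sum.swap) (simp only: S_def sum_distrib_left)
      finally show ?thesis .
    qed
    moreover have "I (\<lambda>x. \<Sum>i\<le>n. a i * of_real x ^ i) = (\<Sum>i\<le>n. a i * I (\<lambda>x. of_real x ^ i))"
    proof -
      have "(\<integral>x. (\<Sum>i\<le>n. a i * of_real x ^ i) \<partial>\<rho> j) = (\<Sum>i\<le>n. a i * (\<integral>x. of_real x ^ i \<partial>\<rho> j))" for j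
        by (subst Bochner_Integration.integral_sum) (auto intro!: intg continuous_intros)
      then have "I (\<lambda>x. \<Sum>i\<le>n. a i * of_real x ^ i) = (\<Sum>j<5. \<Sum>i\<le>n. a i * (\<beta> j * (\<integral>x. of_real x ^ i \<partial>\<rho> j)))"
        by (simp only: I_def sum_distrib_left mult.left_commute)
      also have "\<dots> = (\<Sum>i\<le>n. a i * I (\<lambda>x. of_real x ^ i))"
        by (subst sum.swap) (simp only: I_def sum_distrib_left)
      finally show ?thesis .
    qed
    ultimately show ?thesis using pow by (auto intro!: tendsto_intros)
  qed
  have "(\<lambda>K. S f K) \<longlonglongrightarrow> I f" if f: "continuous_on UNIV f" for f
  proof (rule LIMSEQ_I)
    fix e :: real assume e: "e > 0"
    \<comment> \<open>Collects the factors of the three errors: the mass of the weights, the limit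
      for the polynomial, and the norm of the limiting functional.\<close>
    define W where "W = D + (\<Sum>j<5. cmod (\<beta> j)) + 1"
    have W: "W > 0" using D0 by (simp add: W_def add_nonneg_pos sum_nonneg)
    have eW: "e / (2 * W) > 0" using e W by simp
    obtain a n where an: "\<And>x. x \<in> {0..1} \<Longrightarrow> cmod (f x - (\<Sum>i\<le>n. a i * of_real x ^ i)) \<le> e / (2 * W)"
      using weierstrass_complex[OF continuous_on_subset[OF f subset_UNIV] eW] by blast
    define p where "p = (\<lambda>x. \<Sum>i\<le>n. a i * complex_of_real x ^ i)"
    have pc: "continuous_on UNIV p" unfolding p_def by (intro continuous_intros)
    have ap: "cmod (f x - p x) \<le> e / (2 * W)" if "x \<in> {0..1}" for x using an[OF that] by (simp add: p_def)
    have 1: "cmod (S f K - S p K) \<le> e / (2 * W) * D" for K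
    proof -
      have "S f K - S p K = (\<Sum>m\<le>K. (f (real m / real K) - p (real m / real K)) * c K m)"
        by (simp add: S_def sum_subtractf left_diff_distrib)
      also have "cmod \<dots> \<le> (\<Sum>m\<le>K. e / (2 * W) * cmod (c K m))"
      proof (rule sum_norm_le)
        fix m assume "m \<in> {..K}"
        then have "real m / real K \<in> {0..1}" by (auto simp: divide_le_eq_1)
        from mult_right_mono[OF ap[OF this], of "cmod (c K m)"]
        show "cmod ((f (real m / real K) - p (real m / real K)) * c K m) \<le> e / (2 * W) * cmod (c K m)"
          by (simp add: norm_mult)
      qed
      also have "\<dots> \<le> e / (2 * W) * D"
        unfolding sum_distrib_left[symmetric] using e W D by (intro mult_left_mono) auto
      finally show ?thesis .
    qed
    have 2: "cmod (I f - I p) \<le> e / (2 * W) * (\<Sum>j<5. cmod (\<beta> j))"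
    proof -
      have "I f - I p = (\<Sum>j<5. \<beta> j * (\<integral>x. f x - p x \<partial>\<rho> j))"
        using intg f pc by (simp add: I_def sum_subtractf right_diff_distrib)
      also have "cmod \<dots> \<le> (\<Sum>j<5. e / (2 * W) * cmod (\<beta> j))"
      proof (rule sum_norm_le)
        fix j :: nat
        have "cmod (\<integral>x. f x - p x \<partial>\<rho> j) \<le> e / (2 * W)"
          by (rule prob_on_unit_integrable(2)[OF p\<rho> _ ap])
             (intro borel_measurable_diff borel_measurable_continuous_onI f pc)
        from mult_left_mono[OF this, of "cmod (\<beta> j)"]
        show "cmod (\<beta> j * (\<integral>x. f x - p x \<partial>\<rho> j)) \<le> e / (2 * W) * cmod (\<beta> j)"
          by (simp add: norm_mult mult.commute)
      qed
      finally show ?thesis by (simp only: sum_distrib_left)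
    qed
    have "(\<lambda>K. S p K) \<longlonglongrightarrow> I p" using poly[of a n] by (simp add: p_def)
    from LIMSEQ_D[OF this eW]
    obtain N where N: "\<And>K. K \<ge> N \<Longrightarrow> cmod (S p K - I p) < e / (2 * W)" by blast
    have "cmod (S f K - I f) < e" if "K \<ge> N" for K
    proof -
      have "S f K - I f = (S f K - S p K) + (S p K - I p) - (I f - I p)" by simp
      also have "cmod \<dots> \<le> cmod (S f K - S p K) + cmod (S p K - I p) + cmod (I f - I p)"
        using norm_triangle_ineq4[of "(S f K - S p K) + (S p K - I p)" "I f - I p"]
          norm_triangle_ineq[of "S f K - S p K" "S p K - I p"] by linarith
      also have "\<dots> \<le> e / (2 * W) * D + e / (2 * W) * 1 + e / (2 * W) * (\<Sum>j<5. cmod (\<beta> j))"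
        using 1[of K] 2 N[OF that] by linarith
      also have "\<dots> = e / (2 * W) * W" by (simp only: W_def distrib_left)
      also have "\<dots> < e" using e W by simp
      finally show ?thesis .
    qed
    then show "\<exists>N. \<forall>K\<ge>N. cmod (S f K - I f) < e" by blast
  qed
  then show ?thesis using p\<rho> unfolding S_def I_def by blast
qed

subsection \<open>Measures with values in the sequence space\<close>

text \<open>Inner regularity gives a compact set for each measure, and their finite union serves all
  of them.\<close>

lemma compact_inner_family:
  fixes \<nu> :: "'i \<Rightarrow> real measure"
  assumes I: "finite I" and \<nu>: "\<And>i. i \<in> I \<Longrightarrow> prob_on_unit (\<nu> i)"
    and A: "A \<in> sets borel" and e: "e > 0"
  shows "\<exists>K. compact K \<and> K \<subseteq> A \<and> (\<forall>i\<in>I. measure (\<nu> i) (A - K) \<le> e)"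
proof -
  have one: "\<exists>K. compact K \<and> K \<subseteq> A \<and> measure \<mu> (A - K) \<le> e" if "prob_on_unit \<mu>" for \<mu>
  proof -
    interpret real_distribution \<mu> using that by (simp add: prob_on_unit_def)
    have reg: "emeasure \<mu> A = (SUP K \<in> {K. K \<subseteq> A \<and> compact K}. emeasure \<mu> K)"
      by (rule inner_regular) (use A in auto)
    show ?thesis
    proof (cases "measure \<mu> A = 0")
      case True
      then show ?thesis using e by (intro exI[of _ "{}"]) auto
    next
      case False
      then have pos: "measure \<mu> A > 0" using measure_nonneg[of \<mu> A] by linarith
      have "ennreal (measure \<mu> A - e) < emeasure \<mu> A"
        using e pos unfolding emeasure_eq_measure by (intro ennreal_lessI) auto
      then obtain K where K: "K \<subseteq> A" "compact K" "ennreal (measure \<mu> A - e) < emeasure \<mu> K"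
        unfolding reg less_SUP_iff by blast
      then have "\<not> measure \<mu> K \<le> measure \<mu> A - e"
        unfolding emeasure_eq_measure using ennreal_leI[of "measure \<mu> K" "measure \<mu> A - e"] by (auto simp: not_le[symmetric])
      moreover have "measure \<mu> (A - K) = measure \<mu> A - measure \<mu> K"
        using K A by (intro finite_measure_Diff) (auto simp: borel_compact)
      ultimately show ?thesis using K by (intro exI[of _ K]) auto
    qed
  qed
  have "\<forall>i\<in>I. \<exists>K. compact K \<and> K \<subseteq> A \<and> measure (\<nu> i) (A - K) \<le> e" using one \<nu> by blast
  then obtain K where K: "\<And>i. i \<in> I \<Longrightarrow> compact (K i)" "\<And>i. i \<in> I \<Longrightarrow> K i \<subseteq> A"
    "\<And>i. i \<in> I \<Longrightarrow> measure (\<nu> i) (A - K i) \<le> e" by metis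
  have "measure (\<nu> i) (A - (\<Union>i\<in>I. K i)) \<le> e" if i: "i \<in> I" for i
  proof -
    interpret real_distribution "\<nu> i" using \<nu>[OF i] by (simp add: prob_on_unit_def)
    have "measure (\<nu> i) (A - (\<Union>i\<in>I. K i)) \<le> measure (\<nu> i) (A - K i)"
      using i A K(1) by (intro finite_measure_mono) (auto simp: borel_compact)
    then show ?thesis using K(3)[OF i] by linarith
  qed
  moreover have "compact (\<Union>i\<in>I. K i)" using K(1) I by auto
  moreover have "(\<Union>i\<in>I. K i) \<subseteq> A" using K(2) by blast
  ultimately show ?thesis by blast
qed

text \<open>Level sets are shrunk to compact sets inside them; on their union \<open>f\<close> is
  locally constant, hence continuous, and Tietze extends it with the same bound. A single
  \<open>g\<close> must serve all measures, because the square sum bound couples the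
  coordinates.\<close>

lemma lusin_simple:
  fixes \<nu> :: "'i \<Rightarrow> real measure" and f :: "real \<Rightarrow> complex"
  assumes I: "finite I" and \<nu>: "\<And>i. i \<in> I \<Longrightarrow> prob_on_unit (\<nu> i)"
    and f: "simple_function borel f" and B: "\<And>x. cmod (f x) \<le> B" and e: "e > 0"
  shows "\<exists>g E. continuous_on UNIV g \<and> (\<forall>x. cmod (g x) \<le> B) \<and> E \<in> sets borel \<and>
           (\<forall>x. x \<notin> E \<longrightarrow> g x = f x) \<and> (\<forall>i\<in>I. measure (\<nu> i) E \<le> e)"
proof -
  have fin: "finite (range f)" using f by (simp add: simple_function_def)
  \<comment> \<open>There are \<open>n - 1\<close> level sets, each losing at most
    \<open>e / n\<close>.\<close>
  define n where "n = real (card (range f)) + 1"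
  have n: "n > 0" by (simp add: n_def add_nonneg_pos)
  have "\<forall>a\<in>range f. \<exists>K. compact K \<and> K \<subseteq> f -` {a} \<and> (\<forall>i\<in>I. measure (\<nu> i) (f -` {a} - K) \<le> e / n)"
    using e n by (intro ballI compact_inner_family I \<nu> simple_function_vimage[OF f]) auto
  then obtain K where K: "\<And>a. a \<in> range f \<Longrightarrow> compact (K a)" "\<And>a. a \<in> range f \<Longrightarrow> K a \<subseteq> f -` {a}"
    "\<And>a i. a \<in> range f \<Longrightarrow> i \<in> I \<Longrightarrow> measure (\<nu> i) (f -` {a} - K a) \<le> e / n" by metis
  define S where "S = (\<Union>a\<in>range f. K a)"
  have "compact S" unfolding S_def using K(1) fin by (intro compact_UN) auto
  then have clS: "closed S" by (rule compact_imp_closed)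
  have "continuous_on S f"
    unfolding S_def
  proof (rule continuous_on_closed_Union[OF fin])
    show "closed (K a)" if "a \<in> range f" for a using K(1)[OF that] by (rule compact_imp_closed)
    show "continuous_on (K a) f" if "a \<in> range f" for a
      using K(2)[OF that] by (subst continuous_on_cong[OF refl, of _ _ "\<lambda>_. a"]) auto
  qed
  moreover have "closedin (top_of_set UNIV) S" using clS by simp
  moreover have "0 \<le> B" using order_trans[OF norm_ge_zero B] .
  ultimately obtain g where g: "continuous_on UNIV g" "\<And>x. x \<in> S \<Longrightarrow> g x = f x" "\<And>x. x \<in> UNIV \<Longrightarrow> cmod (g x) \<le> B"
    using Tietze[of S f UNIV B] B by metis
  have meas: "measure (\<nu> i) (- S) \<le> e" if i: "i \<in> I" for i
  proof -
    interpret real_distribution "\<nu> i" using \<nu>[OF i] by (simp add: prob_on_unit_def)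
    have bor: "f -` {a} - K a \<in> sets borel" if "a \<in> range f" for a
      using simple_function_vimage[OF f] K(1)[OF that] by (auto simp: borel_compact)
    have "measure (\<nu> i) (- S) \<le> measure (\<nu> i) (\<Union>a\<in>range f. f -` {a} - K a)"
    proof (rule finite_measure_mono)
      show "- S \<subseteq> (\<Union>a\<in>range f. f -` {a} - K a)" by (auto simp: S_def)
      have "(\<Union>a\<in>range f. f -` {a} - K a) \<in> sets borel"
        using bor fin by (intro sets.finite_UN) auto
      then show "(\<Union>a\<in>range f. f -` {a} - K a) \<in> events" by simp
    qed
    also have "\<dots> \<le> (\<Sum>a\<in>range f. measure (\<nu> i) (f -` {a} - K a))"
      using bor fin by (intro finite_measure_subadditive_finite) auto
    also have "\<dots> \<le> (\<Sum>a\<in>range f. e / n)" by (intro sum_mono K(3) i)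
    also have "\<dots> = (n - 1) * (e / n)" by (simp add: n_def)
    also have "\<dots> \<le> e" using e n by (simp add: field_simps)
    finally show ?thesis .
  qed
  show ?thesis
    by (intro exI[of _ g] exI[of _ "- S"]) (use g meas clS in auto)
qed

text \<open>Coordinate \<open>k\<close> of the integral of \<open>f\<close> against a vector
  measure; five measures per coordinate are what \<open>discrete_riesz\<close> supplies.\<close>

definition vint :: "(nat \<Rightarrow> nat \<Rightarrow> real measure) \<Rightarrow> (nat \<Rightarrow> nat \<Rightarrow> complex) \<Rightarrow> nat \<Rightarrow> (real \<Rightarrow> complex) \<Rightarrow> complex" where
  "vint \<rho> \<beta> k f = (\<Sum>j<5. \<beta> k j * (\<integral>x. f x \<partial>\<rho> k j))"

text \<open>A countably additive measure with values in the sequence space, given by its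
  coordinates, each a combination of five probability measures on the unit interval.\<close>

locale ell2_measure =
  fixes \<rho> :: "nat \<Rightarrow> nat \<Rightarrow> real measure" and \<beta> :: "nat \<Rightarrow> nat \<Rightarrow> complex" and C :: real
  assumes prob: "\<And>k j. j < 5 \<Longrightarrow> prob_on_unit (\<rho> k j)"
    and C_nonneg: "C \<ge> 0"
    and continuous_bound: "\<And>g B N. continuous_on UNIV g \<Longrightarrow> (\<And>x. x \<in> {0..1} \<Longrightarrow> cmod (g x) \<le> B) \<Longrightarrow>
          (\<Sum>k<N. (cmod (vint \<rho> \<beta> k g))\<^sup>2) \<le> C * B\<^sup>2"
begin

abbreviation "xi \<equiv> vint \<rho> \<beta>"

lemma bounded_borel_integrable:
  assumes "bounded_borel f" "j < 5" shows "integrable (\<rho> k j) f"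
proof -
  obtain b where "\<And>x. x \<in> {0..1} \<Longrightarrow> cmod (f x) \<le> b" using bounded_borelD[OF assms(1)] by metis
  then show ?thesis by (rule prob_on_unit_integrable(1)[OF prob[OF assms(2)] bounded_borel_measurable[OF assms(1)]])
qed

lemma xi_add:
  assumes "bounded_borel f" "bounded_borel g"
  shows "xi k (\<lambda>x. f x + g x) = xi k f + xi k g"
  using assms by (simp add: vint_def bounded_borel_integrable distrib_left sum.distrib)

lemma xi_diff:
  assumes "bounded_borel f" "bounded_borel g"
  shows "xi k (\<lambda>x. f x - g x) = xi k f - xi k g"
  using assms by (simp add: vint_def bounded_borel_integrable right_diff_distrib sum_subtractf)

lemma xi_scale:
  shows "xi k (\<lambda>x. c * f x) = c * xi k f"
  by (simp add: vint_def sum_distrib_left mult_ac)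

lemma xi_zero [simp]: "xi k (\<lambda>x. 0) = 0"
  by (simp add: vint_def)

lemma xi_sum:
  assumes "finite I" "\<And>i. i \<in> I \<Longrightarrow> bounded_borel (F i)"
  shows "xi k (\<lambda>x. \<Sum>i\<in>I. F i x) = (\<Sum>i\<in>I. xi k (F i))"
  using assms
proof (induction I)
  case (insert i I)
  then show ?case by (simp add: xi_add bounded_borel_sum)
qed simp

lemma xi_cong:
  assumes "bounded_borel f" "bounded_borel g" "\<And>x. x \<in> {0..1} \<Longrightarrow> f x = g x"
  shows "xi k f = xi k g"
  unfolding vint_def
proof (intro sum.cong refl arg_cong2[where f = "(*)"] integral_cong_AE)
  fix j :: nat assume "j \<in> {..<5}"
  then have p: "prob_on_unit (\<rho> k j)" using prob by simp
  interpret real_distribution "\<rho> k j" using p by (simp add: prob_on_unit_def)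
  show "f \<in> borel_measurable (\<rho> k j)" "g \<in> borel_measurable (\<rho> k j)"
    using assms(1,2) by (auto simp: bounded_borel_def)
  show "AE x in \<rho> k j. f x = g x"
    using p[unfolded prob_on_unit_def, THEN conjunct2] by (rule eventually_mono) (rule assms(3))
qed

lemma xi_le:
  assumes "bounded_borel f" "\<And>x. x \<in> {0..1} \<Longrightarrow> cmod (f x) \<le> b"
  shows "cmod (xi k f) \<le> (\<Sum>j<5. cmod (\<beta> k j)) * b"
proof -
  have "cmod (xi k f) \<le> (\<Sum>j<5. cmod (\<beta> k j) * b)"
    unfolding vint_def
  proof (rule sum_norm_le)
    fix j :: nat assume "j \<in> {..<5}"
    then show "cmod (\<beta> k j * (\<integral>x. f x \<partial>\<rho> k j)) \<le> cmod (\<beta> k j) * b"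
      unfolding norm_mult using assms
      by (intro mult_left_mono prob_on_unit_integrable(2) prob bounded_borel_measurable) auto
  qed
  then show ?thesis by (simp add: sum_distrib_right)
qed

lemma xi_le_measure:
  assumes f: "bounded_borel f" and E: "E \<in> sets borel" and b: "\<And>x. cmod (f x) \<le> b * indicator E x"
  shows "cmod (xi k f) \<le> (\<Sum>j<5. cmod (\<beta> k j) * (b * measure (\<rho> k j) E))"
  unfolding vint_def
proof (rule sum_norm_le)
  fix j :: nat assume "j \<in> {..<5}"
  then have j: "j < 5" by simp
  interpret real_distribution "\<rho> k j" using prob[OF j] by (simp add: prob_on_unit_def)
  have "cmod (\<integral>x. f x \<partial>\<rho> k j) \<le> (\<integral>x. cmod (f x) \<partial>\<rho> k j)" by (rule integral_norm_bound)
  also have "\<dots> \<le> (\<integral>x. b * indicator E x \<partial>\<rho> k j)"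
    using bounded_borel_integrable[OF f j] E b
    by (intro integral_mono) (auto intro!: integrable_mult_right integrable_real_indicator simp: less_top[symmetric])
  also have "\<dots> = b * measure (\<rho> k j) E" using E by simp
  finally show "cmod (\<beta> k j * (\<integral>x. f x \<partial>\<rho> k j)) \<le> cmod (\<beta> k j) * (b * measure (\<rho> k j) E)"
    unfolding norm_mult by (rule mult_left_mono) simp
qed

lemma xi_tendsto:
  assumes f: "\<And>n. bounded_borel (fn n)" "bounded_borel f"
    and d: "\<And>n x. x \<in> {0..1} \<Longrightarrow> cmod (fn n x - f x) \<le> d n" "d \<longlonglongrightarrow> 0"
  shows "(\<lambda>n. xi k (fn n)) \<longlonglongrightarrow> xi k f"
proof -
  have "cmod (xi k (fn n) - xi k f) \<le> (\<Sum>j<5. cmod (\<beta> k j)) * d n" for n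
    unfolding xi_diff[OF f(1,2), symmetric] by (rule xi_le[OF bounded_borel_diff[OF f(1,2)] d(1)])
  moreover have "(\<lambda>n. (\<Sum>j<5. cmod (\<beta> k j)) * d n) \<longlonglongrightarrow> 0"
    using tendsto_mult[OF tendsto_const d(2)] by simp
  ultimately have "(\<lambda>n. xi k (fn n) - xi k f) \<longlonglongrightarrow> 0"
    by (rule Lim_null_comparison[OF always_eventually[OF allI]])
  then show ?thesis by (simp add: LIM_zero_iff)
qed

lemma bounded_borel_simple:
  assumes "simple_function borel f" shows "bounded_borel f"
proof -
  obtain b where "\<And>x. cmod (f x) \<le> b" using simple_function_bounded[OF assms] by metis
  then show ?thesis
    by (intro bounded_borelI[of _ b] borel_measurable_simple_function assms)
qed

text \<open>Lusin functions for the finitely many measures behind the first \<open>N\<close>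
  coordinates have integrals converging in each of these coordinates, so the bound for continuous
  functions passes to the simple function.\<close>

lemma simple_bound:
  assumes f: "simple_function borel f" and B: "\<And>x. cmod (f x) \<le> B"
  shows "(\<Sum>k<N. (cmod (xi k f))\<^sup>2) \<le> C * B\<^sup>2"
proof -
  have B0: "B \<ge> 0" using order_trans[OF norm_ge_zero B] .
  define I where "I = {..<N} \<times> {..<5::nat}"
  define P where "P n g E \<longleftrightarrow> continuous_on UNIV g \<and> (\<forall>x. cmod (g x) \<le> B) \<and> E \<in> sets borel \<and>
           (\<forall>x. x \<notin> E \<longrightarrow> g x = f x) \<and> (\<forall>i\<in>I. measure (\<rho> (fst i) (snd i)) E \<le> inverse (real (Suc n)))" for n g E
  have "\<exists>g E. P n g E" for n
    unfolding P_def by (rule lusin_simple[OF _ _ f B]) (auto simp: I_def prob)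
  then obtain g E where P: "\<And>n. P n (g n) (E n)" by metis
  have gc: "continuous_on UNIV (g n)" and gB: "cmod (g n x) \<le> B" and E: "E n \<in> sets borel"
    and gf: "x \<notin> E n \<Longrightarrow> g n x = f x" and mE: "k < N \<Longrightarrow> j < 5 \<Longrightarrow> measure (\<rho> k j) (E n) \<le> inverse (real (Suc n))"
    for n x k j
    using P[of n] unfolding P_def I_def by auto
  have lim: "(\<lambda>n. xi k (g n)) \<longlonglongrightarrow> xi k f" if k: "k < N" for k
  proof -
    have "cmod (xi k (g n) - xi k f) \<le> (\<Sum>j<5. cmod (\<beta> k j) * (2 * B)) * inverse (real (Suc n))" for n
    proof -
      have bb: "bounded_borel (g n)" "bounded_borel f"
        using gc f by (auto intro: bounded_borel_continuous bounded_borel_simple)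
      have "cmod (g n x - f x) \<le> 2 * B * indicator (E n) x" for x
        using norm_triangle_ineq4[of "g n x" "f x"] gB[of n x] B[of x] gf[of x n] by (auto simp: indicator_def)
      then have "cmod (xi k (\<lambda>x. g n x - f x)) \<le> (\<Sum>j<5. cmod (\<beta> k j) * (2 * B * measure (\<rho> k j) (E n)))"
        by (intro xi_le_measure bounded_borel_diff bb E)
      also have "\<dots> \<le> (\<Sum>j<5. cmod (\<beta> k j) * (2 * B * inverse (real (Suc n))))"
        using mE[OF k] B0 by (intro sum_mono mult_left_mono) auto
      finally show ?thesis by (simp add: xi_diff[OF bb] sum_distrib_right mult.assoc)
    qed
    moreover have "(\<lambda>n. (\<Sum>j<5. cmod (\<beta> k j) * (2 * B)) * inverse (real (Suc n))) \<longlonglongrightarrow> 0"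
      using tendsto_mult[OF tendsto_const LIMSEQ_inverse_real_of_nat] by simp
    ultimately have "(\<lambda>n. xi k (g n) - xi k f) \<longlonglongrightarrow> 0"
      by (rule Lim_null_comparison[OF always_eventually[OF allI]])
    then show ?thesis by (simp add: LIM_zero_iff)
  qed
  have lims: "(\<lambda>n. \<Sum>k<N. (cmod (xi k (g n)))\<^sup>2) \<longlonglongrightarrow> (\<Sum>k<N. (cmod (xi k f))\<^sup>2)"
    by (intro tendsto_intros lim) auto
  have "(\<Sum>k<N. (cmod (xi k (g n)))\<^sup>2) \<le> C * B\<^sup>2" for n
    by (intro continuous_bound gc gB)
  then show ?thesis by (intro LIMSEQ_le_const2[OF lims] exI[of _ 0] allI impI)
qed

text \<open>Roundings of the cut-off function converge uniformly on the unit interval and are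
  bounded on the whole line by \<open>2 / real (Suc n) + B\<close>, so the bound for simple
  functions applies and passes to the limit.\<close>

lemma xi_bound:
  assumes f: "bounded_borel f" and B: "\<And>x. x \<in> {0..1} \<Longrightarrow> cmod (f x) \<le> B"
  shows "(\<Sum>k<N. (cmod (xi k f))\<^sup>2) \<le> C * B\<^sup>2"
proof -
  have B0: "B \<ge> 0" using order_trans[OF norm_ge_zero B[of 0]] by simp
  have cB: "cmod (restrict_unit f x) \<le> B" for x using B[of x] B0 by (auto simp: restrict_unit_def indicator_def)
  have rB: "cmod (round_grid n (restrict_unit f) x) \<le> 2 / real (Suc n) + B" for n x
    using norm_triangle_sub[of "round_grid n (restrict_unit f) x" "restrict_unit f x"] round_grid_error[of n "restrict_unit f" x] cB[of x] by linarith
  have lim: "(\<lambda>n. xi k (round_grid n (restrict_unit f))) \<longlonglongrightarrow> xi k f" for k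
  proof (rule xi_tendsto[OF _ f _ round_grid_error_tendsto])
    show "bounded_borel (round_grid n (restrict_unit f))" for n by (intro bounded_borel_simple simple_function_round_restrict f)
    show "cmod (round_grid n (restrict_unit f) x - f x) \<le> 2 / real (Suc n)" if "x \<in> {0..1}" for n x
      using round_grid_error[of n "restrict_unit f" x] that by simp
  qed
  have l1: "(\<lambda>n. \<Sum>k<N. (cmod (xi k (round_grid n (restrict_unit f))))\<^sup>2) \<longlonglongrightarrow> (\<Sum>k<N. (cmod (xi k f))\<^sup>2)"
    by (intro tendsto_intros lim)
  have l2: "(\<lambda>n. C * (2 / real (Suc n) + B)\<^sup>2) \<longlonglongrightarrow> C * (0 + B)\<^sup>2"
    by (intro tendsto_intros round_grid_error_tendsto)
  have "(\<Sum>k<N. (cmod (xi k (round_grid n (restrict_unit f))))\<^sup>2) \<le> C * (2 / real (Suc n) + B)\<^sup>2" for n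
    by (rule simple_bound[OF simple_function_round_restrict[OF f] rB])
  then have "(\<Sum>k<N. (cmod (xi k f))\<^sup>2) \<le> C * (0 + B)\<^sup>2"
    by (intro LIMSEQ_le[OF l1 l2] exI[of _ 0] allI impI)
  then show ?thesis by simp
qed

end

section \<open>Norms in the sequence space and the Gram form of the vector measure\<close>

lemma square_summable:
  fixes x :: "nat \<Rightarrow> complex"
  assumes "\<And>N. (\<Sum>k<N. (cmod (x k))\<^sup>2) \<le> R"
  shows "summable (\<lambda>k. (cmod (x k))\<^sup>2)" "(\<Sum>k. (cmod (x k))\<^sup>2) \<le> R"
proof -
  show s: "summable (\<lambda>k. (cmod (x k))\<^sup>2)" using assms by (intro summableI_nonneg_bounded[where x = R]) auto
  show "(\<Sum>k. (cmod (x k))\<^sup>2) \<le> R" using s assms by (intro suminf_le_const) auto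
qed

lemma ell2_cauchy_schwarz:
  fixes x y :: "nat \<Rightarrow> complex"
  assumes x: "summable (\<lambda>k. (cmod (x k))\<^sup>2)" and y: "summable (\<lambda>k. (cmod (y k))\<^sup>2)"
  shows "summable (\<lambda>k. cnj (x k) * y k)"
    "cmod (\<Sum>k. cnj (x k) * y k) \<le> sqrt (\<Sum>k. (cmod (x k))\<^sup>2) * sqrt (\<Sum>k. (cmod (y k))\<^sup>2)"
proof -
  have le: "(\<Sum>k<N. cmod (cnj (x k) * y k)) \<le> sqrt (\<Sum>k. (cmod (x k))\<^sup>2) * sqrt (\<Sum>k. (cmod (y k))\<^sup>2)" for N
  proof -
    have "(\<Sum>k<N. cmod (cnj (x k) * y k)) = (\<Sum>k<N. \<bar>cmod (x k)\<bar> * \<bar>cmod (y k)\<bar>)" by (simp add: norm_mult)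
    also have "\<dots> \<le> sqrt (\<Sum>k<N. (cmod (x k))\<^sup>2) * sqrt (\<Sum>k<N. (cmod (y k))\<^sup>2)"
      using L2_set_mult_ineq[of "\<lambda>k. cmod (x k)" "\<lambda>k. cmod (y k)" "{..<N}"] by (simp add: L2_set_def)
    also have "\<dots> \<le> sqrt (\<Sum>k. (cmod (x k))\<^sup>2) * sqrt (\<Sum>k. (cmod (y k))\<^sup>2)"
      using x y by (intro mult_mono real_sqrt_le_mono sum_le_suminf real_sqrt_ge_zero sum_nonneg suminf_nonneg) auto
    finally show ?thesis .
  qed
  have s: "summable (\<lambda>k. cmod (cnj (x k) * y k))" by (rule summableI_nonneg_bounded[OF _ le]) simp
  then show "summable (\<lambda>k. cnj (x k) * y k)" by (rule summable_norm_cancel)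
  have "cmod (\<Sum>k. cnj (x k) * y k) \<le> (\<Sum>k. cmod (cnj (x k) * y k))" by (rule summable_norm[OF s])
  also have "\<dots> \<le> sqrt (\<Sum>k. (cmod (x k))\<^sup>2) * sqrt (\<Sum>k. (cmod (y k))\<^sup>2)"
    by (rule suminf_le_const[OF s le])
  finally show "cmod (\<Sum>k. cnj (x k) * y k) \<le> sqrt (\<Sum>k. (cmod (x k))\<^sup>2) * sqrt (\<Sum>k. (cmod (y k))\<^sup>2)" .
qed

context ell2_measure
begin

lemma xi_summable:
  assumes "bounded_borel f" shows "summable (\<lambda>k. (cmod (xi k f))\<^sup>2)"
proof -
  obtain b where "\<And>x. x \<in> {0..1} \<Longrightarrow> cmod (f x) \<le> b" using bounded_borelD[OF assms] by metis
  from square_summable(1)[OF xi_bound[OF assms this]] show ?thesis .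
qed

lemma xi_norm_le:
  assumes "bounded_borel f" "\<And>x. x \<in> {0..1} \<Longrightarrow> cmod (f x) \<le> b"
  shows "(\<Sum>k. (cmod (xi k f))\<^sup>2) \<le> C * b\<^sup>2"
  by (rule square_summable(2)[OF xi_bound[OF assms]])

text \<open>The conjugation inside \<open>xi\<close> cancels the antilinearity caused by the one
  outside, so this is the bilinear version of the inner product that \<open>bounded_form\<close>
  asks for.\<close>

definition xi_form :: "(real \<Rightarrow> complex) \<Rightarrow> (real \<Rightarrow> complex) \<Rightarrow> complex" where
  "xi_form f g = (\<Sum>k. cnj (xi k (\<lambda>x. cnj (f x))) * xi k g)"

lemma xi_form_summable:
  assumes "bounded_borel f" "bounded_borel g"
  shows "summable (\<lambda>k. cnj (xi k (\<lambda>x. cnj (f x))) * xi k g)"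
  by (intro ell2_cauchy_schwarz xi_summable bounded_borel_cnj assms)

lemma xi_form_le:
  assumes "bounded_borel f" "bounded_borel g"
  shows "cmod (xi_form f g) \<le> sqrt (\<Sum>k. (cmod (xi k (\<lambda>x. cnj (f x))))\<^sup>2) * sqrt (\<Sum>k. (cmod (xi k g))\<^sup>2)"
  unfolding xi_form_def by (intro ell2_cauchy_schwarz xi_summable bounded_borel_cnj assms)

sublocale form: bounded_form xi_form C
proof
  show "C \<ge> 0" by (rule C_nonneg)
next
  fix f f' g assume b: "bounded_borel f" "bounded_borel f'" "bounded_borel g"
  then show "xi_form (\<lambda>x. f x + f' x) g = xi_form f g + xi_form f' g"
    by (simp add: xi_form_def xi_add bounded_borel_cnj xi_form_summable distrib_right suminf_add)
next
  fix f g g' assume b: "bounded_borel f" "bounded_borel g" "bounded_borel g'"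
  then show "xi_form f (\<lambda>x. g x + g' x) = xi_form f g + xi_form f g'"
    by (simp add: xi_form_def xi_add bounded_borel_cnj xi_form_summable distrib_left suminf_add)
next
  fix a f g assume b: "bounded_borel f" "bounded_borel g"
  then show "xi_form (\<lambda>x. a * f x) g = a * xi_form f g"
    using suminf_mult[OF xi_form_summable[OF b], of a] by (simp add: xi_form_def xi_scale mult_ac)
next
  fix a f g assume b: "bounded_borel f" "bounded_borel g"
  then show "xi_form f (\<lambda>x. a * g x) = a * xi_form f g"
    using suminf_mult[OF xi_form_summable[OF b], of a] by (simp add: xi_form_def xi_scale mult_ac)
next
  fix f g a b assume bb: "bounded_borel f" "bounded_borel g"
    and a: "\<And>x. x \<in> {0..1} \<Longrightarrow> cmod (f x) \<le> a" and b: "\<And>x. x \<in> {0..1} \<Longrightarrow> cmod (g x) \<le> b"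
  have a0: "a \<ge> 0" and b0: "b \<ge> 0"
    using order_trans[OF norm_ge_zero a[of 0]] order_trans[OF norm_ge_zero b[of 0]] by auto
  have "cmod (xi_form f g) \<le> sqrt (\<Sum>k. (cmod (xi k (\<lambda>x. cnj (f x))))\<^sup>2) * sqrt (\<Sum>k. (cmod (xi k g))\<^sup>2)"
    by (rule xi_form_le[OF bb])
  also have "\<dots> \<le> sqrt (C * a\<^sup>2) * sqrt (C * b\<^sup>2)"
    using a b bb
    by (intro mult_mono real_sqrt_le_mono xi_norm_le bounded_borel_cnj real_sqrt_ge_zero suminf_nonneg xi_summable)
       (auto simp: C_nonneg)
  also have "\<dots> = C * a * b" using a0 b0 C_nonneg by (simp add: real_sqrt_mult)
  finally show "cmod (xi_form f g) \<le> C * a * b" .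
qed

end

section \<open>Countable additivity in norm\<close>

lemma cnj_indicator: "(\<lambda>x. cnj (indicator A x)) = (indicator A :: real \<Rightarrow> complex)"
  by (auto simp: indicator_def)

lemma bounded_borel_indicator: "A \<in> sets borel \<Longrightarrow> bounded_borel (indicator A)"
  by (intro bounded_borelI[of _ 1] borel_measurable_indicator) (auto simp: indicator_def)

text \<open>By disjointness at most one term is nonzero at each point.\<close>

lemma norm_sum_indicator_le:
  fixes \<epsilon> :: "'i \<Rightarrow> complex"
  assumes I: "finite I" and d: "disjoint_family_on F I" and \<epsilon>: "\<And>i. i \<in> I \<Longrightarrow> cmod (\<epsilon> i) \<le> 1"
  shows "cmod (\<Sum>i\<in>I. \<epsilon> i * indicator (F i) x) \<le> indicator (\<Union>i\<in>I. F i) x"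
proof (cases "\<exists>i\<in>I. x \<in> F i")
  case True
  then obtain j where j: "j \<in> I" "x \<in> F j" by blast
  have "(\<Sum>i\<in>I. \<epsilon> i * indicator (F i) x) = (\<Sum>i\<in>I. if i = j then \<epsilon> i else 0)"
    using j d by (intro sum.cong refl) (auto simp: indicator_def disjoint_family_on_def)
  also have "\<dots> = \<epsilon> j" using j I by simp
  finally show ?thesis using \<epsilon>[OF j(1)] j by (auto simp: indicator_def)
next
  case False
  then have "(\<Sum>i\<in>I. \<epsilon> i * indicator (F i) x) = 0" by (intro sum.neutral) auto
  then show ?thesis by simp
qed

text \<open>By the parallelogram law one of the two signs does not decrease the square sum.\<close>

lemma exists_signs:
  fixes x :: "'i \<Rightarrow> nat \<Rightarrow> complex"
  assumes "finite I"
  shows "\<exists>\<epsilon>. (\<forall>i\<in>I. \<epsilon> i = 1 \<or> \<epsilon> i = - 1) \<and>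
     (\<Sum>i\<in>I. \<Sum>k<N. (cmod (x i k))\<^sup>2) \<le> (\<Sum>k<N. (cmod (\<Sum>i\<in>I. \<epsilon> i * x i k))\<^sup>2)"
  using assms
proof (induction I)
  case (insert j I)
  then obtain \<epsilon> where \<epsilon>: "\<forall>i\<in>I. \<epsilon> i = 1 \<or> \<epsilon> i = - 1"
    "(\<Sum>i\<in>I. \<Sum>k<N. (cmod (x i k))\<^sup>2) \<le> (\<Sum>k<N. (cmod (\<Sum>i\<in>I. \<epsilon> i * x i k))\<^sup>2)" by blast
  define s where "s k = (\<Sum>i\<in>I. \<epsilon> i * x i k)" for k
  have par: "(cmod (a + b))\<^sup>2 + (cmod (a - b))\<^sup>2 = 2 * (cmod a)\<^sup>2 + 2 * (cmod b)\<^sup>2" for a b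
    unfolding cmod_power2 by (simp add: power2_eq_square algebra_simps)
  have sumpar: "(\<Sum>k<N. (cmod (s k + x j k))\<^sup>2) + (\<Sum>k<N. (cmod (s k - x j k))\<^sup>2)
      = 2 * (\<Sum>k<N. (cmod (s k))\<^sup>2) + 2 * (\<Sum>k<N. (cmod (x j k))\<^sup>2)"
    by (simp add: sum.distrib[symmetric] par sum_distrib_left)
  have "\<exists>e :: complex. (e = 1 \<or> e = - 1) \<and>
    (\<Sum>k<N. (cmod (s k))\<^sup>2) + (\<Sum>k<N. (cmod (x j k))\<^sup>2) \<le> (\<Sum>k<N. (cmod (s k + e * x j k))\<^sup>2)"
  proof (cases "(\<Sum>k<N. (cmod (s k))\<^sup>2) + (\<Sum>k<N. (cmod (x j k))\<^sup>2) \<le> (\<Sum>k<N. (cmod (s k + x j k))\<^sup>2)")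
    case True
    then show ?thesis by (intro exI[of _ 1]) simp
  next
    case False
    with sumpar show ?thesis by (intro exI[of _ "- 1"]) simp
  qed
  then obtain e :: complex where e: "e = 1 \<or> e = - 1"
    "(\<Sum>k<N. (cmod (s k))\<^sup>2) + (\<Sum>k<N. (cmod (x j k))\<^sup>2) \<le> (\<Sum>k<N. (cmod (s k + e * x j k))\<^sup>2)"
    by blast
  have eqk: "(\<Sum>i\<in>insert j I. (\<epsilon>(j := e)) i * x i k) = s k + e * x j k" for k
  proof -
    have "(\<Sum>i\<in>I. (\<epsilon>(j := e)) i * x i k) = s k"
      unfolding s_def using insert.hyps by (intro sum.cong refl) auto
    then show ?thesis using insert.hyps by simp
  qed
  have "(\<Sum>i\<in>insert j I. \<Sum>k<N. (cmod (x i k))\<^sup>2) \<le> (\<Sum>k<N. (cmod (s k + e * x j k))\<^sup>2)"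
    using e(2) \<epsilon>(2)[folded s_def] insert.hyps by simp
  then have "(\<Sum>i\<in>insert j I. \<Sum>k<N. (cmod (x i k))\<^sup>2)
      \<le> (\<Sum>k<N. (cmod (\<Sum>i\<in>insert j I. (\<epsilon>(j := e)) i * x i k))\<^sup>2)" unfolding eqk .
  moreover have "\<forall>i\<in>insert j I. (\<epsilon>(j := e)) i = 1 \<or> (\<epsilon>(j := e)) i = - 1" using \<epsilon>(1) e(1) by simp
  ultimately show ?case by blast
qed simp

context ell2_measure
begin

text \<open>Suitable signs bound the sum of squared norms by the squared norm of one integral, that
  of a function of modulus at most 1. Hence the bound does not depend on the number of sets.\<close>

lemma disjoint_square_sum_le:
  assumes I: "finite I" and F: "\<And>i. i \<in> I \<Longrightarrow> F i \<in> sets borel" "disjoint_family_on F I"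
  shows "(\<Sum>i\<in>I. \<Sum>k<N. (cmod (xi k (indicator (F i))))\<^sup>2) \<le> C"
proof -
  obtain \<epsilon> where \<epsilon>: "\<And>i. i \<in> I \<Longrightarrow> \<epsilon> i = 1 \<or> \<epsilon> i = - 1"
    and le: "(\<Sum>i\<in>I. \<Sum>k<N. (cmod (xi k (indicator (F i))))\<^sup>2) \<le> (\<Sum>k<N. (cmod (\<Sum>i\<in>I. \<epsilon> i * xi k (indicator (F i))))\<^sup>2)"
    using exists_signs[OF I, of "\<lambda>i k. xi k (indicator (F i))" N] by blast
  have b: "bounded_borel (\<lambda>x. \<epsilon> i * indicator (F i) x)" if "i \<in> I" for i
    using F(1)[OF that] by (intro bounded_borel_mult bounded_borel_const bounded_borel_indicator)
  have n: "cmod (\<epsilon> i) \<le> 1" if "i \<in> I" for i using \<epsilon>[OF that] by auto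
  have "(\<Sum>i\<in>I. \<epsilon> i * xi k (indicator (F i))) = xi k (\<lambda>x. \<Sum>i\<in>I. \<epsilon> i * indicator (F i) x)" for k
    by (simp only: xi_sum[OF I b] xi_scale)
  then have "(\<Sum>k<N. (cmod (\<Sum>i\<in>I. \<epsilon> i * xi k (indicator (F i))))\<^sup>2) =
      (\<Sum>k<N. (cmod (xi k (\<lambda>x. \<Sum>i\<in>I. \<epsilon> i * indicator (F i) x)))\<^sup>2)" by simp
  also have "\<dots> \<le> C * 1\<^sup>2"
  proof (rule xi_bound)
    show "bounded_borel (\<lambda>x. \<Sum>i\<in>I. \<epsilon> i * indicator (F i) x)" using b by (rule bounded_borel_sum)
    show "cmod (\<Sum>i\<in>I. \<epsilon> i * indicator (F i) x) \<le> 1" for x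
      by (rule order_trans[OF norm_sum_indicator_le[OF I F(2)] indicator_le_1]) (rule n)
  qed
  finally show ?thesis using le by simp
qed

text \<open>Continuity from above of the scalar measures settles each coordinate separately;
  uniformity over the coordinates is left to \<open>xi_norm_tendsto_0\<close>.\<close>

lemma xi_indicator_tendsto_0:
  assumes E: "\<And>n. E n \<in> sets borel" "decseq E" "(\<Inter>n. E n) = {}"
  shows "(\<lambda>n. xi k (indicator (E n))) \<longlonglongrightarrow> 0"
proof -
  have m: "(\<lambda>n. measure (\<rho> k j) (E n)) \<longlonglongrightarrow> 0" if "j < 5" for j
  proof -
    interpret real_distribution "\<rho> k j" using prob[OF that] by (simp add: prob_on_unit_def)
    have "(\<lambda>n. measure (\<rho> k j) (E n)) \<longlonglongrightarrow> measure (\<rho> k j) (\<Inter>n. E n)"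
      using E by (intro finite_Lim_measure_decseq) auto
    then show ?thesis by (simp add: E(3))
  qed
  have "cmod (xi k (indicator (E n))) \<le> (\<Sum>j<5. cmod (\<beta> k j) * (1 * measure (\<rho> k j) (E n)))" for n
    by (intro xi_le_measure bounded_borel_indicator E) (auto simp: indicator_def)
  moreover have "(\<lambda>n. \<Sum>j<5. cmod (\<beta> k j) * (1 * measure (\<rho> k j) (E n))) \<longlonglongrightarrow> (\<Sum>j<(5::nat). cmod (\<beta> k j) * (1 * 0))"
    by (intro tendsto_intros m) auto
  then have "(\<lambda>n. \<Sum>j<5. cmod (\<beta> k j) * (1 * measure (\<rho> k j) (E n))) \<longlonglongrightarrow> 0" by simp
  ultimately show ?thesis by (rule Lim_null_comparison[OF always_eventually[OF allI]])
qed

text \<open>Countable additivity in norm: otherwise infinitely many disjoint sets would carry vectors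
  of norm bounded away from zero, which contradicts the bound on disjoint square sums.\<close>

lemma xi_norm_tendsto_0:
  assumes E: "\<And>n. E n \<in> sets borel" "decseq E" "(\<Inter>n. E n) = {}"
  shows "(\<lambda>n. \<Sum>k. (cmod (xi k (indicator (E n))))\<^sup>2) \<longlonglongrightarrow> 0"
proof (rule ccontr)
  \<comment> \<open>Truncated square sums, since coordinatewise convergence controls only finitely
    many coordinates at a time.\<close>
  define a where "a N F = (\<Sum>k<N. (cmod (xi k (indicator F)))\<^sup>2)" for N and F :: "real set"
  have a_mono: "a N F \<le> a M F" if "N \<le> M" for N M F
    unfolding a_def using that by (intro sum_mono2) auto
  assume "\<not> ?thesis"
  then obtain \<delta> where \<delta>: "\<delta> > 0" and ex: "\<And>J. \<exists>n\<ge>J. \<delta> \<le> \<bar>\<Sum>k. (cmod (xi k (indicator (E n))))\<^sup>2\<bar>"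
    unfolding LIMSEQ_def by (auto simp: dist_real_def not_less)
  \<comment> \<open>The set is \<open>E n - E (max n m)\<close>: a truncated square sum that is
    large for \<open>E n\<close> stays large after a late tail is removed.\<close>
  have step: "\<exists>F J' N. F \<subseteq> E J \<and> F \<in> sets borel \<and> J \<le> J' \<and> F \<inter> E J' = {} \<and> \<delta> / 2 < a N F" for J
  proof -
    obtain n where n: "n \<ge> J" "\<delta> \<le> \<bar>\<Sum>k. (cmod (xi k (indicator (E n))))\<^sup>2\<bar>" using ex by blast
    have sm: "summable (\<lambda>k. (cmod (xi k (indicator (E n))))\<^sup>2)" by (intro xi_summable bounded_borel_indicator E)
    have "\<exists>N. \<delta> / 2 < a N (E n)"
    proof (rule ccontr)
      assume "\<not> ?thesis"
      then have "(\<Sum>k. (cmod (xi k (indicator (E n))))\<^sup>2) \<le> \<delta> / 2"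
        by (intro suminf_le_const[OF sm]) (auto simp: a_def not_less)
      moreover have "(\<Sum>k. (cmod (xi k (indicator (E n))))\<^sup>2) \<ge> 0" by (intro suminf_nonneg sm) auto
      ultimately show False using n(2) \<delta> by linarith
    qed
    then obtain N where N: "\<delta> / 2 < a N (E n)" by blast
    have "(\<lambda>m. a N (E n - E m)) \<longlonglongrightarrow> a N (E n)"
    proof -
      have "xi k (indicator (E n - E m)) = xi k (indicator (E n)) - xi k (indicator (E m))" if "m \<ge> n" for k m
      proof -
        have "(indicator (E n - E m) :: real \<Rightarrow> complex) = (\<lambda>x. indicator (E n) x - indicator (E m) x)"
          using decseqD[OF E(2) that] by (auto simp: fun_eq_iff indicator_def)
        then show ?thesis using E(1) by (simp add: xi_diff bounded_borel_indicator)
      qed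
      then have "\<forall>\<^sub>F m in sequentially. (\<Sum>k<N. (cmod (xi k (indicator (E n)) - xi k (indicator (E m))))\<^sup>2) = a N (E n - E m)"
        unfolding eventually_sequentially by (intro exI[of _ n]) (simp add: a_def)
      moreover have "(\<lambda>m. \<Sum>k<N. (cmod (xi k (indicator (E n)) - xi k (indicator (E m))))\<^sup>2)
          \<longlonglongrightarrow> (\<Sum>k<N. (cmod (xi k (indicator (E n)) - 0))\<^sup>2)"
        by (intro tendsto_intros xi_indicator_tendsto_0 E)
      ultimately show ?thesis by (simp add: a_def Lim_transform_eventually)
    qed
    then have "\<forall>\<^sub>F m in sequentially. \<delta> / 2 < a N (E n - E m)" using N by (rule order_tendstoD)
    then obtain m where m: "\<delta> / 2 < a N (E n - E (max n m))"
      unfolding eventually_sequentially by (metis max.cobounded2)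
    show ?thesis
      using n(1) m E(1) decseqD[OF E(2) n(1)]
      by (intro exI[of _ "E n - E (max n m)"] exI[of _ "max n m"] exI[of _ N]) auto
  qed
  \<comment> \<open>The truncation index is enlarged at each stage, which \<open>a_mono\<close>
    allows; the gap \<open>F i \<inter> E J = {}\<close> leaves room for the next set inside
    \<open>E J\<close>.\<close>
  have fam: "\<exists>F J N. (\<forall>i<n. F i \<in> sets borel \<and> F i \<inter> E J = {} \<and> \<delta> / 2 < a N (F i)) \<and> disjoint_family_on F {..<n}" for n :: nat
  proof (induction n)
    case 0
    then show ?case by (auto simp: disjoint_family_on_def)
  next
    case (Suc n)
    then obtain F J N where F: "\<And>i. i < n \<Longrightarrow> F i \<in> sets borel" "\<And>i. i < n \<Longrightarrow> F i \<inter> E J = {}" "\<And>i. i < n \<Longrightarrow> \<delta> / 2 < a N (F i)"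
      and d: "disjoint_family_on F {..<n}" by blast
    obtain G J' N' where G: "G \<subseteq> E J" "G \<in> sets borel" "J \<le> J'" "G \<inter> E J' = {}" "\<delta> / 2 < a N' G" using step[of J] by blast
    have "F i \<inter> E J' = {}" "\<delta> / 2 < a (max N N') (F i)" if "i < n" for i
      using F(2,3)[OF that] decseqD[OF E(2) G(3)] a_mono[of N "max N N'" "F i"] by auto
    moreover have "\<delta> / 2 < a (max N N') G" using G(5) a_mono[of N' "max N N'" G] by auto
    ultimately have "\<forall>i<Suc n. (F(n := G)) i \<in> sets borel \<and> (F(n := G)) i \<inter> E J' = {} \<and> \<delta> / 2 < a (max N N') ((F(n := G)) i)"
      using F(1) G by (auto simp: less_Suc_eq)
    moreover have "disjoint_family_on (F(n := G)) {..<Suc n}"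
    proof -
      have FF: "F i \<inter> F j = {}" if "i < n" "j < n" "i \<noteq> j" for i j
        using d that by (auto simp: disjoint_family_on_def)
      have FG: "F i \<inter> G = {}" if "i < n" for i using F(2)[OF that] G(1) by blast
      show ?thesis
        unfolding disjoint_family_on_def
      proof (intro ballI impI)
        fix p q assume "p \<in> {..<Suc n}" "q \<in> {..<Suc n}" "p \<noteq> q"
        then consider "p < n" "q < n" | "p = n" "q < n" | "p < n" "q = n" by force
        then show "(F(n := G)) p \<inter> (F(n := G)) q = {}"
          using FF[OF _ _ \<open>p \<noteq> q\<close>] FG[of p] FG[of q] by cases (simp_all add: Int_commute)
      qed
    qed
    ultimately show ?case by blast
  qed
  \<comment> \<open>So many sets that their square sums together exceed \<open>C\<close>, against
    \<open>disjoint_square_sum_le\<close>.\<close>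
  obtain n :: nat where n: "C / (\<delta> / 2) < real n" using reals_Archimedean2 by blast
  obtain F J N where F: "\<And>i. i < n \<Longrightarrow> F i \<in> sets borel" "\<And>i. i < n \<Longrightarrow> \<delta> / 2 < a N (F i)"
    and d: "disjoint_family_on F {..<n}" using fam[of n] by blast
  have "C < real n * (\<delta> / 2)" using n \<delta> by (simp add: pos_divide_less_eq)
  also have "\<dots> = (\<Sum>i<n. \<delta> / 2)" by simp
  also have "\<dots> \<le> (\<Sum>i<n. a N (F i))" using F(2) by (intro sum_mono) (auto intro: less_imp_le)
  also have "\<dots> \<le> C" unfolding a_def by (rule disjoint_square_sum_le[OF _ _ d]) (use F(1) in auto)
  finally show False by simp
qed

section \<open>The bimeasure of the vector measure\<close>

definition xi_bimeasure :: "real set \<Rightarrow> real set \<Rightarrow> complex" where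
  "xi_bimeasure A B = xi_form (indicator A) (indicator B)"

lemma xi_bimeasure_eq: "xi_bimeasure A B = (\<Sum>k. cnj (xi k (indicator A)) * xi k (indicator B))"
  by (simp add: xi_bimeasure_def xi_form_def cnj_indicator)

lemma xi_bimeasure_cnj:
  assumes "A \<in> sets borel" "B \<in> sets borel" shows "xi_bimeasure A B = cnj (xi_bimeasure B A)"
proof -
  have "summable (\<lambda>k. cnj (xi k (indicator B)) * xi k (indicator A))"
    using xi_form_summable[OF bounded_borel_indicator[OF assms(2)] bounded_borel_indicator[OF assms(1)]]
    by (simp add: cnj_indicator)
  then have "(\<lambda>k. cnj (cnj (xi k (indicator B)) * xi k (indicator A))) sums cnj (xi_bimeasure B A)"
    unfolding xi_bimeasure_eq by (subst sums_cnj) (rule summable_sums)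
  then show ?thesis unfolding xi_bimeasure_eq by (simp add: sums_iff mult.commute)
qed

text \<open>Reduces countable additivity to convergence along decreasing sets with empty
  intersection: the error of a partial sum of indicators is the indicator of the tail
  \<open>E n\<close> with opposite sign.\<close>

lemma tail_union:
  fixes B :: "nat \<Rightarrow> real set"
  assumes "range B \<subseteq> sets borel" "disjoint_family B"
  defines "E \<equiv> \<lambda>n. \<Union>i\<in>{n..}. B i"
  shows "E n \<in> sets borel" "decseq E" "(\<Inter>n. E n) = {}"
    "(\<lambda>x. (\<Sum>i<n. indicator (B i) x) - indicator (\<Union>i. B i) x) = (\<lambda>x. - 1 * indicator (E n) x :: complex)"
proof -
  show "E n \<in> sets borel" unfolding E_def using assms(1) by auto
  show "decseq E" unfolding E_def decseq_def by fastforce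
  show "(\<Inter>n. E n) = {}"
  proof (rule ccontr)
    assume "(\<Inter>n. E n) \<noteq> {}"
    then obtain x where x: "\<And>n. x \<in> E n" by blast
    obtain i where i: "x \<in> B i" using x[of 0] by (auto simp: E_def)
    obtain j where "j \<ge> Suc i" "x \<in> B j" using x[of "Suc i"] by (auto simp: E_def)
    then show False using i assms(2) unfolding disjoint_family_on_def
      by (metis Int_iff UNIV_I Suc_n_not_le_n empty_iff)
  qed
  show "(\<lambda>x. (\<Sum>i<n. indicator (B i) x) - indicator (\<Union>i. B i) x) = (\<lambda>x. - 1 * indicator (E n) x :: complex)"
  proof
    fix x
    have "(\<Sum>i<n. indicator (B i) x :: complex) = indicator (\<Union>i<n. B i) x"
      using assms(2) by (subst indicator_UN_disjoint) (auto simp: disjoint_family_on_def)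
    moreover have "(\<Union>i. B i) = (\<Union>i<n. B i) \<union> E n" unfolding E_def UN_Un[symmetric]
      by (rule arg_cong[where f = "\<lambda>S. \<Union> (B ` S)"]) auto
    moreover have "(\<Union>i<n. B i) \<inter> E n = {}"
    proof -
      have "B i \<inter> B j = {}" if "i < n" "n \<le> j" for i j
        by (rule disjoint_family_onD[OF assms(2)]) (use that in auto)
      then show ?thesis unfolding E_def by blast
    qed
    ultimately show "(\<Sum>i<n. indicator (B i) x) - indicator (\<Union>i. B i) x = (- 1 * indicator (E n) x :: complex)"
      by (auto simp: indicator_def)
  qed
qed

text \<open>By Cauchy-Schwarz the error is at most the norm of the vector of \<open>A\<close> times
  that of a tail, which tends to 0.\<close>

lemma sigma_additive_xi_bimeasure:
  assumes A: "A \<in> sets borel" shows "sigma_additive (xi_bimeasure A)"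
  unfolding sigma_additive_def
proof (intro allI impI)
  fix B :: "nat \<Rightarrow> real set" assume B: "range B \<subseteq> sets borel" "disjoint_family B"
  define E where "E n = (\<Union>i\<in>{n..}. B i)" for n
  note E = tail_union[OF B, folded E_def]
  have bb: "bounded_borel (indicator A)" "bounded_borel (indicator (B i))" "bounded_borel (indicator (\<Union>i. B i))"
    "bounded_borel (indicator (E n))" for i n
    using A B(1) E(1) by (auto intro!: bounded_borel_indicator)
  have "(\<Sum>i<n. xi_bimeasure A (B i)) - xi_bimeasure A (\<Union>i. B i) = - xi_form (indicator A) (indicator (E n))" for n
  proof -
    have "(\<Sum>i<n. xi_bimeasure A (B i)) - xi_bimeasure A (\<Union>i. B i)
        = xi_form (indicator A) (\<lambda>x. (\<Sum>i<n. indicator (B i) x) - indicator (\<Union>i. B i) x)"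
      unfolding xi_bimeasure_def using bb by (simp add: form.sum_right form.diff_right bounded_borel_sum)
    also have "\<dots> = - xi_form (indicator A) (indicator (E n))"
      unfolding E(4) using form.scale_right[OF bb(1,4), of "-1"] by simp
    finally show ?thesis .
  qed
  moreover have "(\<lambda>n. xi_form (indicator A) (indicator (E n))) \<longlonglongrightarrow> 0"
  proof (rule Lim_null_comparison[OF always_eventually[OF allI]])
    show "cmod (xi_form (indicator A) (indicator (E n))) \<le> sqrt (\<Sum>k. (cmod (xi k (indicator A)))\<^sup>2) * sqrt (\<Sum>k. (cmod (xi k (indicator (E n))))\<^sup>2)" for n
      using xi_form_le[OF bb(1,4), of n] by (simp add: cnj_indicator)
    have "(\<lambda>n. sqrt (\<Sum>k. (cmod (xi k (indicator A)))\<^sup>2) * sqrt (\<Sum>k. (cmod (xi k (indicator (E n))))\<^sup>2)) \<longlonglongrightarrow>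
        sqrt (\<Sum>k. (cmod (xi k (indicator A)))\<^sup>2) * sqrt 0"
      by (intro tendsto_intros xi_norm_tendsto_0 E)
    then show "(\<lambda>n. sqrt (\<Sum>k. (cmod (xi k (indicator A)))\<^sup>2) * sqrt (\<Sum>k. (cmod (xi k (indicator (E n))))\<^sup>2)) \<longlonglongrightarrow> 0" by simp
  qed
  ultimately have "(\<lambda>n. (\<Sum>i<n. xi_bimeasure A (B i)) - xi_bimeasure A (\<Union>i. B i)) \<longlonglongrightarrow> 0"
    using tendsto_minus by fastforce
  then show "(\<lambda>n. xi_bimeasure A (B n)) sums xi_bimeasure A (\<Union>n. B n)" by (simp add: sums_def LIM_zero_iff)
qed

lemma disjoint_imp_family: "disjoint \<P> \<Longrightarrow> disjoint_family_on (\<lambda>x. x) \<P>"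
  by (auto simp: disjoint_def disjoint_family_on_def)

text \<open>All but finitely many coordinates of the vector of \<open>A\<close> are negligible, and the remaining
  coordinates are dominated by finitely many regular measures.\<close>

lemma radon_regular_xi_bimeasure:
  assumes A: "A \<in> sets borel" shows "radon_regular (xi_bimeasure A)"
  unfolding radon_regular_def
proof (intro ballI allI impI)
  fix A' :: "real set" and e :: real assume A': "A' \<in> sets borel" and e: "e > 0"
  define x where "x k = xi k (indicator A)" for k
  have sx: "summable (\<lambda>k. (cmod (x k))\<^sup>2)" unfolding x_def by (intro xi_summable bounded_borel_indicator A)
  have "(\<lambda>N. (\<Sum>k. (cmod (x (k + N)))\<^sup>2)) \<longlonglongrightarrow> 0" using suminf_exist_split2[OF sx] .
  then have "(\<lambda>N. sqrt (\<Sum>k. (cmod (x (k + N)))\<^sup>2) * sqrt C) \<longlonglongrightarrow> sqrt 0 * sqrt C" by (intro tendsto_intros)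
  then have "\<forall>\<^sub>F N in sequentially. sqrt (\<Sum>k. (cmod (x (k + N)))\<^sup>2) * sqrt C < e / 2"
    using e by (intro order_tendstoD) auto
  then obtain N where N: "sqrt (\<Sum>k. (cmod (x (k + N)))\<^sup>2) * sqrt C < e / 2"
    unfolding eventually_sequentially by blast
  \<comment> \<open>Total influence of the measures on the first \<open>N\<close> coordinates,
    weighted by \<open>x\<close>; the added 1 makes it positive.\<close>
  define W where "W = (\<Sum>k<N. cmod (x k) * (\<Sum>j<5. cmod (\<beta> k j))) + 1"
  have W: "W > 0" unfolding W_def by (intro add_nonneg_pos sum_nonneg mult_nonneg_nonneg) auto
  obtain K where K: "compact K" "K \<subseteq> A'"
    "\<And>i. i \<in> {..<N} \<times> {..<5} \<Longrightarrow> measure (\<rho> (fst i) (snd i)) (A' - K) \<le> e / (2 * W)"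
    using compact_inner_family[of "{..<N} \<times> {..<5}" "\<lambda>i. \<rho> (fst i) (snd i)" A' "e / (2 * W)"] prob A' e W by auto
  have main: "(\<Sum>B\<in>\<P>. cmod (xi_bimeasure A B)) \<le> e"
    if P: "finite \<P>" "disjoint \<P>" "\<forall>B\<in>\<P>. B \<in> sets borel \<and> B \<subseteq> A' - K" for \<P>
  proof -
    \<comment> \<open>Phases turn the sum of moduli into one value of the form, at a function
      \<open>g\<close> dominated by the indicator of \<open>A' - K\<close>.\<close>
    define u where "u B = cnj (sgn (xi_bimeasure A B))" for B
    have u: "cmod (u B) \<le> 1" for B by (simp add: u_def norm_sgn)
    have uz: "of_real (cmod (xi_bimeasure A B)) = u B * xi_bimeasure A B" for B
    proof -
      have "xi_bimeasure A B = of_real (cmod (xi_bimeasure A B)) * sgn (xi_bimeasure A B)" by (cases "xi_bimeasure A B = 0") (simp_all add: sgn_eq)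
      moreover have "cnj (sgn z) * (of_real (cmod z) * sgn z) = of_real (cmod z)" for z
      proof (cases "z = 0")
        case False
        have "cnj (sgn z) * sgn z = 1"
          using False by (metis complex_norm_square mult.commute norm_sgn of_real_1 one_power2)
        then show ?thesis by (metis mult.assoc mult.commute mult_1_right)
      qed simp
      ultimately show ?thesis unfolding u_def by metis
    qed
    define g where "g s = (\<Sum>B\<in>\<P>. u B * indicator B s)" for s
    have gi: "cmod (g s) \<le> indicator (A' - K) s" for s
    proof -
      have "cmod (g s) \<le> indicator (\<Union>B\<in>\<P>. B) s"
        unfolding g_def by (rule norm_sum_indicator_le[OF P(1) disjoint_imp_family[OF P(2)] u])
      also have "\<dots> \<le> indicator (A' - K) s" using P(3) by (intro indicator_leI) auto
      finally show ?thesis .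
    qed
    have bi: "bounded_borel (indicator A)" "\<And>B. B \<in> \<P> \<Longrightarrow> bounded_borel (indicator B)"
      using A P(3) by (auto intro: bounded_borel_indicator)
    have bg: "bounded_borel g"
      unfolding g_def using bi by (intro bounded_borel_sum bounded_borel_mult) auto
    have g1: "cmod (g s) \<le> 1" for s by (rule order_trans[OF gi indicator_le_1])
    have AK: "A' - K \<in> sets borel" using A' K(1) by (auto simp: borel_compact)
    define y where "y k = xi k g" for k
    have sy: "summable (\<lambda>k. (cmod (y k))\<^sup>2)" unfolding y_def by (rule xi_summable[OF bg])
    have yC: "(\<Sum>k. (cmod (y k))\<^sup>2) \<le> C" unfolding y_def using xi_norm_le[OF bg g1] by simp
    have "of_real (\<Sum>B\<in>\<P>. cmod (xi_bimeasure A B)) = (\<Sum>B\<in>\<P>. u B * xi_bimeasure A B)" by (simp add: uz)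
    also have "\<dots> = xi_form (indicator A) g"
      unfolding g_def xi_bimeasure_def using bi P(1) by (subst form.sum_right) (auto simp: form.scale_right)
    also have "\<dots> = (\<Sum>k. cnj (x k) * y k)" by (simp add: xi_form_def cnj_indicator x_def y_def)
    finally have eq: "(\<Sum>B\<in>\<P>. cmod (xi_bimeasure A B)) = cmod (\<Sum>k. cnj (x k) * y k)"
      by (metis abs_of_nonneg norm_ge_zero norm_of_real sum_nonneg)
    \<comment> \<open>The tail is small through \<open>x\<close> by the choice of \<open>N\<close>,
      the head through \<open>y\<close> by the choice of \<open>K\<close>.\<close>
    have "(\<Sum>k. cnj (x k) * y k) = (\<Sum>k. cnj (x (k + N)) * y (k + N)) + (\<Sum>k<N. cnj (x k) * y k)"
      by (rule suminf_split_initial_segment[OF ell2_cauchy_schwarz(1)[OF sx sy]])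
    also have "cmod \<dots> \<le> cmod (\<Sum>k. cnj (x (k + N)) * y (k + N)) + cmod (\<Sum>k<N. cnj (x k) * y k)"
      by (rule norm_triangle_ineq)
    also have "cmod (\<Sum>k. cnj (x (k + N)) * y (k + N)) \<le> sqrt (\<Sum>k. (cmod (x (k + N)))\<^sup>2) * sqrt C"
    proof -
      have s': "summable (\<lambda>k. (cmod (x (k + N)))\<^sup>2)" "summable (\<lambda>k. (cmod (y (k + N)))\<^sup>2)"
        using sx sy by (auto simp: summable_iff_shift[of "\<lambda>k. (cmod (x k))\<^sup>2"] summable_iff_shift[of "\<lambda>k. (cmod (y k))\<^sup>2"])
      have "(\<Sum>k. (cmod (y (k + N)))\<^sup>2) \<le> C"
        using suminf_split_initial_segment[OF sy, of N] yC sum_nonneg[of "{..<N}" "\<lambda>k. (cmod (y k))\<^sup>2"] by simp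
      then have "sqrt (\<Sum>k. (cmod (x (k + N)))\<^sup>2) * sqrt (\<Sum>k. (cmod (y (k + N)))\<^sup>2) \<le> sqrt (\<Sum>k. (cmod (x (k + N)))\<^sup>2) * sqrt C"
        by (intro mult_left_mono real_sqrt_le_mono real_sqrt_ge_zero suminf_nonneg s') auto
      then show ?thesis using ell2_cauchy_schwarz(2)[OF s'] by linarith
    qed
    also have "cmod (\<Sum>k<N. cnj (x k) * y k) \<le> e / 2"
    proof -
      have "cmod (\<Sum>k<N. cnj (x k) * y k) \<le> (\<Sum>k<N. cmod (x k) * ((\<Sum>j<5. cmod (\<beta> k j)) * (e / (2 * W))))"
      proof (rule sum_norm_le)
        fix k assume k: "k \<in> {..<N}"
        have "cmod (y k) \<le> (\<Sum>j<5. cmod (\<beta> k j) * (1 * measure (\<rho> k j) (A' - K)))"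
          unfolding y_def using gi by (intro xi_le_measure bg AK) auto
        also have "\<dots> \<le> (\<Sum>j<5. cmod (\<beta> k j) * (e / (2 * W)))"
          using K(3) k by (intro sum_mono mult_left_mono) auto
        finally have "cmod (y k) \<le> (\<Sum>j<5. cmod (\<beta> k j)) * (e / (2 * W))" by (simp only: sum_distrib_right)
        from mult_left_mono[OF this norm_ge_zero[of "x k"]]
        show "cmod (cnj (x k) * y k) \<le> cmod (x k) * ((\<Sum>j<5. cmod (\<beta> k j)) * (e / (2 * W)))"
          by (simp only: norm_mult complex_mod_cnj)
      qed
      also have "\<dots> = (\<Sum>k<N. cmod (x k) * (\<Sum>j<5. cmod (\<beta> k j))) * (e / (2 * W))"
        by (simp only: sum_distrib_right mult.assoc)
      also have "\<dots> = (W - 1) * (e / (2 * W))" by (simp only: W_def add_diff_cancel_right')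
      also have "\<dots> \<le> W * (e / (2 * W))" using e W by (intro mult_right_mono) auto
      also have "\<dots> = e / 2" using W by simp
      finally show ?thesis .
    qed
    finally show ?thesis unfolding eq using N by simp
  qed
  show "\<exists>K. compact K \<and> K \<subseteq> A' \<and> (\<forall>\<P>. finite \<P> \<longrightarrow> disjoint \<P> \<longrightarrow>
      (\<forall>B\<in>\<P>. B \<in> sets borel \<and> B \<subseteq> A' - K) \<longrightarrow> (\<Sum>B\<in>\<P>. cmod (xi_bimeasure A B)) \<le> e)"
    by (intro exI[of _ K] conjI K(1,2) allI impI main)
qed

text \<open>A step function on a partition with coefficients of modulus at most 1 has modulus at
  most 1, so the bound of the form also bounds the semivariation.\<close>

lemma finite_semivariation_xi_bimeasure: "finite_semivariation xi_bimeasure"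
  unfolding finite_semivariation_def
proof (intro exI[of _ C] allI impI, elim conjE)
  fix \<A> \<B> :: "real set set" and a b
  assume A: "finite \<A>" "partition_on UNIV \<A>" "\<A> \<subseteq> sets borel" "\<forall>A\<in>\<A>. cmod (a A) \<le> 1"
    and B: "finite \<B>" "partition_on UNIV \<B>" "\<B> \<subseteq> sets borel" "\<forall>B\<in>\<B>. cmod (b B) \<le> 1"
  have le: "cmod (\<Sum>A\<in>\<A>. a A * indicator A x) \<le> 1"
    if "finite \<A>" "partition_on UNIV \<A>" "\<forall>A\<in>\<A>. cmod (a A) \<le> 1" for \<A> and a :: "real set \<Rightarrow> complex" and x
  proof -
    have "cmod (\<Sum>A\<in>\<A>. a A * indicator A x) \<le> indicator (\<Union>A\<in>\<A>. A) x"
      using that by (intro norm_sum_indicator_le disjoint_imp_family partition_onD2) auto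
    then show ?thesis by (rule order_trans) (rule indicator_le_1)
  qed
  have bA: "\<And>A. A \<in> \<A> \<Longrightarrow> bounded_borel (indicator A)" and bB: "\<And>B. B \<in> \<B> \<Longrightarrow> bounded_borel (indicator B)"
    using A(3) B(3) by (auto intro: bounded_borel_indicator)
  have "(\<Sum>A\<in>\<A>. \<Sum>B\<in>\<B>. a A * b B * xi_bimeasure A B)
      = xi_form (\<lambda>x. \<Sum>A\<in>\<A>. a A * indicator A x) (\<lambda>x. \<Sum>B\<in>\<B>. b B * indicator B x)"
    unfolding xi_bimeasure_def using bA bB A(1) B(1) by (intro form.sum_both[symmetric])
  also have "cmod \<dots> \<le> C * 1 * 1"
    using bA bB A B by (intro form.bound bounded_borel_sum bounded_borel_mult bounded_borel_const le)
  finally show "cmod (\<Sum>A\<in>\<A>. \<Sum>B\<in>\<B>. a A * b B * xi_bimeasure A B) \<le> C" by simp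
qed

text \<open>Additivity and regularity were shown in the second argument; conjugate symmetry
  transfers them to the first.\<close>

lemma bimeasure_xi_bimeasure: "bimeasure xi_bimeasure"
  unfolding bimeasure_def
proof (intro conjI ballI finite_semivariation_xi_bimeasure)
  fix B :: "real set" assume B: "B \<in> sets borel"
  show "sigma_additive (xi_bimeasure B)" "radon_regular (xi_bimeasure B)"
    by (rule sigma_additive_xi_bimeasure[OF B], rule radon_regular_xi_bimeasure[OF B])
  have norm: "cmod (xi_bimeasure A B) = cmod (xi_bimeasure B A)" if "A \<in> sets borel" for A
    using xi_bimeasure_cnj[OF that B] by simp
  show "sigma_additive (\<lambda>A. xi_bimeasure A B)"
    unfolding sigma_additive_def
  proof (intro allI impI)
    fix A :: "nat \<Rightarrow> real set" assume A: "range A \<subseteq> sets borel" "disjoint_family A"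
    then have "(\<lambda>n. xi_bimeasure B (A n)) sums xi_bimeasure B (\<Union>n. A n)"
      using sigma_additive_xi_bimeasure[OF B] unfolding sigma_additive_def by blast
    then have "(\<lambda>n. cnj (xi_bimeasure B (A n))) sums cnj (xi_bimeasure B (\<Union>n. A n))" by (simp add: sums_cnj)
    moreover have "cnj (xi_bimeasure B (A n)) = xi_bimeasure (A n) B" for n using xi_bimeasure_cnj[of "A n" B] A(1) B by auto
    moreover have "cnj (xi_bimeasure B (\<Union>n. A n)) = xi_bimeasure (\<Union>n. A n) B" using xi_bimeasure_cnj[of "\<Union>n. A n" B] A(1) B by auto
    ultimately show "(\<lambda>n. xi_bimeasure (A n) B) sums xi_bimeasure (\<Union>n. A n) B" by simp
  qed
  show "radon_regular (\<lambda>A. xi_bimeasure A B)"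
    unfolding radon_regular_def
  proof (intro ballI allI impI)
    fix A :: "real set" and e :: real assume A: "A \<in> sets borel" and e: "e > 0"
    obtain K where K: "compact K" "K \<subseteq> A" "\<And>\<P>. finite \<P> \<Longrightarrow> disjoint \<P> \<Longrightarrow>
        (\<forall>D\<in>\<P>. D \<in> sets borel \<and> D \<subseteq> A - K) \<Longrightarrow> (\<Sum>D\<in>\<P>. cmod (xi_bimeasure B D)) \<le> e"
      using radon_regular_xi_bimeasure[OF B, unfolded radon_regular_def, rule_format, OF A e] by blast
    have main: "(\<Sum>D\<in>\<P>. cmod (xi_bimeasure D B)) \<le> e"
      if "finite \<P>" "disjoint \<P>" "\<forall>D\<in>\<P>. D \<in> sets borel \<and> D \<subseteq> A - K" for \<P>
      using K(3)[OF that] that(3) norm by simp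
    show "\<exists>K. compact K \<and> K \<subseteq> A \<and> (\<forall>\<P>. finite \<P> \<longrightarrow> disjoint \<P> \<longrightarrow>
        (\<forall>D\<in>\<P>. D \<in> sets borel \<and> D \<subseteq> A - K) \<longrightarrow> (\<Sum>D\<in>\<P>. cmod (xi_bimeasure D B)) \<le> e)"
      by (intro exI[of _ K] conjI K(1,2) allI impI main)
  qed
qed

text \<open>The quadratic form is the squared norm of the vector integral of
  \<open>f\<close>.\<close>

lemma positive_definite_xi_bimeasure: "positive_definite_bimeasure xi_bimeasure"
  unfolding positive_definite_bimeasure_def
proof (intro conjI bimeasure_xi_bimeasure ballI allI impI)
  show "xi_bimeasure A B = cnj (xi_bimeasure B A)" if "A \<in> sets borel" "B \<in> sets borel" for A B
    using that by (rule xi_bimeasure_cnj)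
  fix r :: nat and a :: "nat \<Rightarrow> complex" and A :: "nat \<Rightarrow> real set"
  assume A: "\<forall>i<r. A i \<in> sets borel"
  define f where "f x = (\<Sum>i<r. a i * indicator (A i) x)" for x
  have bA: "bounded_borel (indicator (A i))" if "i \<in> {..<r}" for i using A that by (auto intro: bounded_borel_indicator)
  have bf: "bounded_borel f" unfolding f_def using bA by (intro bounded_borel_sum bounded_borel_mult) auto
  have "(\<Sum>i<r. \<Sum>j<r. cnj (a i) * a j * xi_bimeasure (A i) (A j))
      = xi_form (\<lambda>x. \<Sum>i<r. cnj (a i) * indicator (A i) x) (\<lambda>x. \<Sum>j<r. a j * indicator (A j) x)"
    unfolding xi_bimeasure_def using bA by (intro form.sum_both[symmetric]) auto
  also have "(\<lambda>x. \<Sum>i<r. cnj (a i) * indicator (A i) x) = (\<lambda>x. cnj (f x))"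
    unfolding f_def cnj_sum complex_cnj_mult by (intro ext sum.cong refl) (simp add: indicator_def)
  also have "xi_form (\<lambda>x. cnj (f x)) (\<lambda>x. \<Sum>j<r. a j * indicator (A j) x) = (\<Sum>k. cnj (xi k f) * xi k f)"
    unfolding f_def[symmetric] by (simp add: xi_form_def)
  also have "\<dots> = (\<Sum>k. of_real ((cmod (xi k f))\<^sup>2))"
    by (metis (no_types, lifting) complex_norm_square mult.commute)
  also have "\<dots> = of_real (\<Sum>k. (cmod (xi k f))\<^sup>2)"
    by (rule suminf_of_real[OF xi_summable[OF bf], symmetric])
  also have "\<dots> \<in> \<real>\<^sub>\<ge>\<^sub>0" by (simp add: suminf_nonneg xi_summable[OF bf])
  finally show "(\<Sum>i<r. \<Sum>j<r. cnj (a i) * a j * xi_bimeasure (A i) (A j)) \<in> \<real>\<^sub>\<ge>\<^sub>0" .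
qed

end

subsection \<open>The process in a discrete probability space\<close>

text \<open>The geometric law on the natural numbers, carried on the reals to fit the sample type of
  the final statement.\<close>

definition nat_space :: "real measure" where
  "nat_space = measure_pmf (map_pmf real (geometric_pmf (1 / 2)))"

text \<open>The weight is the inverse square root of the probability of the point, which makes the
  embedding of the sequence space isometric.\<close>

definition embed :: "(nat \<Rightarrow> complex) \<Rightarrow> real \<Rightarrow> complex" where
  "embed x \<omega> = of_real (sqrt (2 ^ Suc (nat \<lfloor>\<omega>\<rfloor>))) * x (nat \<lfloor>\<omega>\<rfloor>)"

lemma nat_space_integral:
  fixes f :: "real \<Rightarrow> 'b :: {banach, second_countable_topology}"
  assumes "summable (\<lambda>n. norm ((1 / 2) ^ Suc n *\<^sub>R f (real n)))"
  shows "integrable nat_space f" "(\<integral>\<omega>. f \<omega> \<partial>nat_space) = (\<Sum>n. (1 / 2) ^ Suc n *\<^sub>R f (real n))"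
proof -
  let ?g = "geometric_pmf (1 / 2)"
  have p: "pmf ?g n = (1 / 2) ^ Suc n" for n by simp
  have i: "integrable (count_space UNIV) (\<lambda>n. pmf ?g n *\<^sub>R f (real n))"
    unfolding p integrable_count_space_nat_iff using assms .
  have "integrable (measure_pmf ?g) (\<lambda>n. f (real n))"
    unfolding measure_pmf_eq_density using i by (subst integrable_density) auto
  then show "integrable nat_space f" by (simp add: nat_space_def integrable_map_pmf_eq)
  have "(\<integral>\<omega>. f \<omega> \<partial>nat_space) = (\<integral>n. f (real n) \<partial>measure_pmf ?g)"
    by (simp add: nat_space_def integral_map_pmf)
  also have "\<dots> = (\<integral>n. pmf ?g n *\<^sub>R f (real n) \<partial>count_space UNIV)"
    unfolding measure_pmf_eq_density by (subst integral_density) auto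
  also have "\<dots> = (\<Sum>n. (1 / 2) ^ Suc n *\<^sub>R f (real n))"
    using integral_count_space_nat[OF i] unfolding p .
  finally show "(\<integral>\<omega>. f \<omega> \<partial>nat_space) = (\<Sum>n. (1 / 2) ^ Suc n *\<^sub>R f (real n))" .
qed

lemma embed_real: "embed x (real n) = of_real (sqrt (2 ^ Suc n)) * x n"
  by (simp add: embed_def)

lemma embed_norm_sq: "(1 / 2) ^ Suc n *\<^sub>R (cmod (embed x (real n)))\<^sup>2 = (cmod (x n))\<^sup>2"
proof -
  have "(cmod (embed x (real n)))\<^sup>2 = 2 ^ Suc n * (cmod (x n))\<^sup>2"
    unfolding embed_real norm_mult power_mult_distrib by (simp del: power_Suc)
  then show ?thesis by (simp add: power_divide)
qed

lemma embed_inner_term: "(1 / 2) ^ Suc n *\<^sub>R (cnj (embed x (real n)) * embed y (real n)) = cnj (x n) * y n"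
proof -
  have s: "complex_of_real (sqrt (2 ^ Suc n)) * of_real (sqrt (2 ^ Suc n)) = 2 ^ Suc n"
    unfolding of_real_mult[symmetric] by (simp del: power_Suc)
  have "cnj (embed x (real n)) * embed y (real n)
      = (of_real (sqrt (2 ^ Suc n)) * of_real (sqrt (2 ^ Suc n))) * (cnj (x n) * y n)"
    unfolding embed_real by (simp add: mult_ac del: power_Suc)
  also have "\<dots> = 2 ^ Suc n * (cnj (x n) * y n)" unfolding s ..
  finally show ?thesis by (simp add: scaleR_conv_of_real power_divide)
qed

lemma embed_L2:
  assumes "summable (\<lambda>n. (cmod (x n))\<^sup>2)"
  shows "L2_fun nat_space (embed x)" "(\<integral>\<omega>. (cmod (embed x \<omega>))\<^sup>2 \<partial>nat_space) = (\<Sum>n. (cmod (x n))\<^sup>2)"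
proof -
  have s: "summable (\<lambda>n. norm ((1 / 2) ^ Suc n *\<^sub>R (cmod (embed x (real n)))\<^sup>2))"
    unfolding embed_norm_sq using assms by simp
  show "L2_fun nat_space (embed x)"
    unfolding L2_fun_def using nat_space_integral(1)[OF s] by (simp add: nat_space_def)
  show "(\<integral>\<omega>. (cmod (embed x \<omega>))\<^sup>2 \<partial>nat_space) = (\<Sum>n. (cmod (x n))\<^sup>2)"
    unfolding nat_space_integral(2)[OF s] embed_norm_sq ..
qed

lemma embed_inner:
  assumes x: "summable (\<lambda>n. (cmod (x n))\<^sup>2)" and y: "summable (\<lambda>n. (cmod (y n))\<^sup>2)"
  shows "L2_inner nat_space (embed x) (embed y) = (\<Sum>n. cnj (x n) * y n)"
proof -
  have "summable (\<lambda>n. cmod (x n) * cmod (y n))"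
  proof (rule summable_comparison_test')
    show "summable (\<lambda>n. (cmod (x n))\<^sup>2 + (cmod (y n))\<^sup>2)" using x y by (rule summable_add)
    have "a * b \<le> a\<^sup>2 + b\<^sup>2" if "a \<ge> 0" "b \<ge> 0" for a b :: real
      using sum_squares_bound[of a b] mult_nonneg_nonneg[OF that] by linarith
    then show "norm (cmod (x n) * cmod (y n)) \<le> (cmod (x n))\<^sup>2 + (cmod (y n))\<^sup>2" if "n \<ge> 0" for n by simp
  qed
  then have "summable (\<lambda>n. norm ((1 / 2) ^ Suc n *\<^sub>R (cnj (embed x (real n)) * embed y (real n))))"
    unfolding embed_inner_term by (simp add: norm_mult)
  from nat_space_integral(2)[OF this] show ?thesis
    unfolding L2_inner_def embed_inner_term .
qed

lemma embed_diff: "embed x \<omega> - embed y \<omega> = embed (\<lambda>k. x k - y k) \<omega>"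
  by (simp add: embed_def right_diff_distrib)

lemma embed_sum: "(\<Sum>i\<in>I. a i * embed (x i) \<omega>) = embed (\<lambda>k. \<Sum>i\<in>I. a i * x i k) \<omega>"
  unfolding embed_def sum_distrib_left by (simp only: mult.left_commute)

section \<open>The process with its spectral measure and bimeasure\<close>

lemma simple_function_eq_sum:
  fixes p :: "real \<Rightarrow> complex"
  assumes "simple_function borel p"
  shows "p = (\<lambda>x. \<Sum>a\<in>range p. a * indicator (p -` {a}) x)"
proof
  fix x
  have fin: "finite (range p)" using assms by (simp add: simple_function_def)
  have "(\<Sum>a\<in>range p. a * indicator (p -` {a}) x) = (\<Sum>a\<in>range p. if a = p x then a else 0)"
    by (intro sum.cong refl) (auto simp: indicator_def)
  then show "p x = (\<Sum>a\<in>range p. a * indicator (p -` {a}) x)" using fin by simp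
qed

lemma uniform_limit_round_grid: "uniform_limit UNIV (\<lambda>n. round_grid n f) f sequentially"
proof (rule uniform_limitI)
  fix e :: real assume "e > 0"
  then have "\<forall>\<^sub>F n in sequentially. 2 / real (Suc n) < e" by (rule order_tendstoD(2)[OF round_grid_error_tendsto])
  then show "\<forall>\<^sub>F n in sequentially. \<forall>x\<in>UNIV. dist (round_grid n f x) (f x) < e"
    by eventually_elim (auto simp: dist_norm intro: order_le_less_trans[OF round_grid_error])
qed

context ell2_measure
begin

definition process :: "real \<Rightarrow> real \<Rightarrow> complex" where
  "process t = embed (\<lambda>k. xi k (\<lambda>s. exp (\<i> * of_real t * of_real s)))"

definition stoch :: "real set \<Rightarrow> real \<Rightarrow> complex" where
  "stoch A = embed (\<lambda>k. xi k (indicator A))"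

lemma bounded_borel_exp_i: "bounded_borel (\<lambda>s. exp (\<i> * of_real t * of_real s))"
  by (intro bounded_borel_continuous continuous_intros)

lemma L2_distance:
  assumes "bounded_borel f" "bounded_borel g" "\<And>x. x \<in> {0..1} \<Longrightarrow> cmod (f x - g x) \<le> b"
  shows "(\<integral>\<omega>. (cmod (embed (\<lambda>k. xi k f) \<omega> - embed (\<lambda>k. xi k g) \<omega>))\<^sup>2 \<partial>nat_space) \<le> C * b\<^sup>2"
proof -
  have b: "bounded_borel (\<lambda>x. f x - g x)" using assms by blast
  have "(\<integral>\<omega>. (cmod (embed (\<lambda>k. xi k f) \<omega> - embed (\<lambda>k. xi k g) \<omega>))\<^sup>2 \<partial>nat_space)
      = (\<integral>\<omega>. (cmod (embed (\<lambda>k. xi k (\<lambda>x. f x - g x)) \<omega>))\<^sup>2 \<partial>nat_space)"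
    by (simp add: embed_diff xi_diff assms)
  also have "\<dots> = (\<Sum>k. (cmod (xi k (\<lambda>x. f x - g x)))\<^sup>2)" by (rule embed_L2(2)[OF xi_summable[OF b]])
  also have "\<dots> \<le> C * b\<^sup>2" by (rule xi_norm_le[OF b assms(3)])
  finally show ?thesis .
qed

lemma L2_nonneg: "0 \<le> (\<integral>\<omega>. (cmod (f \<omega>))\<^sup>2 \<partial>nat_space)"
  by (rule integral_nonneg_AE) simp

text \<open>Conjugation inside \<open>xi_form\<close> turns the negative exponential of the kernel
  into the positive one of the process, so the bilinear form returns the inner product of the
  variables.\<close>

lemma covariance_process: "covariance nat_space process t t' = form.form_kernel t t'"
proof -
  have c: "(\<lambda>s. cnj (exp (- (\<i> * of_real t * of_real s)))) = (\<lambda>s. exp (\<i> * of_real t * of_real s))"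
    by (simp add: exp_cnj)
  have "covariance nat_space process t t' = (\<Sum>k. cnj (xi k (\<lambda>s. exp (\<i> * of_real t * of_real s))) * xi k (\<lambda>s. exp (\<i> * of_real t' * of_real s)))"
    unfolding covariance_def process_def by (intro embed_inner xi_summable bounded_borel_exp_i)
  then show ?thesis unfolding form.form_kernel_def xi_form_def c .
qed

lemma second_order_process: "second_order_process nat_space process"
  unfolding second_order_process_def
proof (intro conjI allI)
  show "prob_space nat_space" unfolding nat_space_def by (rule prob_space_measure_pmf)
  show "L2_fun nat_space (process t)" for t
    unfolding process_def by (intro embed_L2 xi_summable bounded_borel_exp_i)
  show "L2_tendsto nat_space process (process t) (at t)" for t
    unfolding L2_tendsto_def
  proof (rule tendsto_sandwich[OF always_eventually[OF allI] always_eventually[OF allI]])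
    show "0 \<le> (\<integral>\<omega>. (cmod (process u \<omega> - process t \<omega>))\<^sup>2 \<partial>nat_space)" for u by (rule L2_nonneg)
    show "(\<integral>\<omega>. (cmod (process u \<omega> - process t \<omega>))\<^sup>2 \<partial>nat_space) \<le> C * \<bar>u - t\<bar>\<^sup>2" for u
      unfolding process_def by (intro L2_distance bounded_borel_exp_i norm_exp_i_diff)
    have "((\<lambda>u. C * \<bar>u - t\<bar>\<^sup>2) \<longlongrightarrow> C * \<bar>t - t\<bar>\<^sup>2) (at t)" by (intro tendsto_intros)
    then show "((\<lambda>u. C * \<bar>u - t\<bar>\<^sup>2) \<longlongrightarrow> 0) (at t)" by simp
  qed auto
qed

lemma simple_bimeasure_integral_xi_bimeasure:
  assumes p: "simple_function borel p" and q: "simple_function borel q"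
  shows "simple_bimeasure_integral xi_bimeasure p q = xi_form p q"
proof -
  have fin: "finite (range p)" "finite (range q)" using p q by (auto simp: simple_function_def)
  have "xi_form p q = xi_form (\<lambda>x. \<Sum>a\<in>range p. a * indicator (p -` {a}) x) (\<lambda>x. \<Sum>b\<in>range q. b * indicator (q -` {b}) x)"
    using simple_function_eq_sum[OF p] simple_function_eq_sum[OF q] by simp
  also have "\<dots> = simple_bimeasure_integral xi_bimeasure p q"
    unfolding simple_bimeasure_integral_def xi_bimeasure_def
    by (intro form.sum_both fin bounded_borel_indicator simple_function_vimage p q)
  finally show ?thesis ..
qed

text \<open>Approximation in the definition of the integral is uniform on the whole line, hence the
  global bounds and the rounding of \<open>f\<close> and \<open>g\<close> themselves instead of
  their cut-offs.\<close>

lemma has_bimeasure_integral_xi_bimeasure: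
  assumes f: "bounded_borel f" "\<And>x. cmod (f x) \<le> a" and g: "bounded_borel g" "\<And>x. cmod (g x) \<le> b"
  shows "has_bimeasure_integral xi_bimeasure f g (xi_form f g)"
  unfolding has_bimeasure_integral_def
proof (intro exI conjI allI)
  have sf: "simple_function borel (round_grid n f)" "simple_function borel (round_grid n g)" for n
    using simple_function_round_grid f g by (auto simp: bounded_borel_def)
  then show "simple_function borel (round_grid n f)" "simple_function borel (round_grid n g)" for n by auto
  show "uniform_limit UNIV (\<lambda>n. round_grid n f) f sequentially" "uniform_limit UNIV (\<lambda>n. round_grid n g) g sequentially"
    by (rule uniform_limit_round_grid)+
  show "(\<lambda>n. simple_bimeasure_integral xi_bimeasure (round_grid n f) (round_grid n g)) \<longlonglongrightarrow> xi_form f g"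
    unfolding simple_bimeasure_integral_xi_bimeasure[OF sf]
  proof (rule form.tendsto_form)
    show "bounded_borel (round_grid n f)" "bounded_borel (round_grid n g)" for n by (intro bounded_borel_simple sf)+
    show "cmod (round_grid n f x - f x) \<le> 2 / real (Suc n)" "cmod (round_grid n g x - g x) \<le> 2 / real (Suc n)" for n x
      by (rule round_grid_error)+
  qed (rule f g round_grid_error_tendsto)+
qed

lemma spectral_bimeasure_xi_bimeasure: "spectral_bimeasure nat_space process xi_bimeasure"
  unfolding spectral_bimeasure_def covariance_process form.form_kernel_def
  by (intro conjI positive_definite_xi_bimeasure allI has_bimeasure_integral_xi_bimeasure[where a = 1 and b = 1] bounded_borel_continuous continuous_intros)
     (simp_all add: norm_exp_eq_Re)

text \<open>The squared distance of a partial sum from the limit is the square sum of the vector of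
  a tail, handled by \<open>xi_norm_tendsto_0\<close>.\<close>

lemma stochastic_measure_stoch: "stochastic_measure nat_space stoch"
  unfolding stochastic_measure_def
proof (intro conjI ballI allI impI)
  show "L2_fun nat_space (stoch A)" if "A \<in> sets borel" for A
    unfolding stoch_def using that by (intro embed_L2 xi_summable bounded_borel_indicator)
  fix B :: "nat \<Rightarrow> real set" assume B: "range B \<subseteq> sets borel" "disjoint_family B"
  define E where "E n = (\<Union>i\<in>{n..}. B i)" for n
  note E = tail_union[OF B, folded E_def]
  have bb: "bounded_borel (indicator (B i))" "bounded_borel (indicator (\<Union>i. B i))" "bounded_borel (indicator (E n))" for i n
    using B(1) E(1) by (auto intro!: bounded_borel_indicator)
  have "(\<integral>\<omega>. (cmod ((\<Sum>k<n. stoch (B k) \<omega>) - stoch (\<Union>k. B k) \<omega>))\<^sup>2 \<partial>nat_space)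
      = (\<Sum>k. (cmod (xi k (indicator (E n))))\<^sup>2)" for n
  proof -
    have x: "(\<Sum>i<n. xi k (indicator (B i))) - xi k (indicator (\<Union>i. B i)) = - xi k (indicator (E n))" for k
    proof -
      have "(\<Sum>i<n. xi k (indicator (B i))) - xi k (indicator (\<Union>i. B i))
          = xi k (\<lambda>x. (\<Sum>i<n. indicator (B i) x) - indicator (\<Union>i. B i) x)"
        using bb by (simp add: xi_sum xi_diff bounded_borel_sum)
      then show ?thesis unfolding E(4) xi_scale by simp
    qed
    have "(\<Sum>k<n. stoch (B k) \<omega>) - stoch (\<Union>k. B k) \<omega> = embed (\<lambda>k. - xi k (indicator (E n))) \<omega>" for \<omega>
      using embed_sum[of "\<lambda>_. 1" "\<lambda>i k. xi k (indicator (B i))" \<omega> "{..<n}"]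
      by (simp add: stoch_def embed_diff x)
    then show ?thesis
      using embed_L2(2)[of "\<lambda>k. - xi k (indicator (E n))"] xi_summable[OF bb(3)] by simp
  qed
  then show "L2_tendsto nat_space (\<lambda>n \<omega>. \<Sum>k<n. stoch (B k) \<omega>) (stoch (\<Union>k. B k)) sequentially"
    unfolding L2_tendsto_def using xi_norm_tendsto_0[OF E(1-3)] by simp
qed

lemma has_stochastic_integral_process:
  "has_stochastic_integral nat_space stoch (\<lambda>s. exp (\<i> * of_real t * of_real s)) (process t)"
  unfolding has_stochastic_integral_def
proof (intro conjI exI allI)
  let ?f = "\<lambda>s. exp (\<i> * of_real t * of_real s)"
  show "L2_fun nat_space (process t)" using second_order_process by (simp add: second_order_process_def)
  have sf: "simple_function borel (round_grid n ?f)" for n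
    by (rule simple_function_round_grid[where b = 1])
       (use bounded_borel_exp_i in \<open>auto simp: bounded_borel_def norm_exp_eq_Re\<close>)
  then show "simple_function borel (round_grid n ?f)" for n .
  show "uniform_limit UNIV (\<lambda>n. round_grid n ?f) ?f sequentially" by (rule uniform_limit_round_grid)
  have s: "simple_stochastic_integral stoch (round_grid n ?f) = embed (\<lambda>k. xi k (round_grid n ?f))" for n
  proof
    fix \<omega>
    let ?p = "round_grid n ?f"
    have "simple_stochastic_integral stoch ?p \<omega> = embed (\<lambda>k. \<Sum>a\<in>range ?p. a * xi k (indicator (?p -` {a}))) \<omega>"
      by (simp add: simple_stochastic_integral_def stoch_def embed_sum)
    moreover have "(\<Sum>a\<in>range ?p. a * xi k (indicator (?p -` {a}))) = xi k ?p" for k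
    proof -
      have "xi k ?p = xi k (\<lambda>x. \<Sum>a\<in>range ?p. a * indicator (?p -` {a}) x)"
        using simple_function_eq_sum[OF sf] by metis
      also have "\<dots> = (\<Sum>a\<in>range ?p. xi k (\<lambda>x. a * indicator (?p -` {a}) x))"
        using sf[of n] by (intro xi_sum bounded_borel_mult bounded_borel_const bounded_borel_indicator simple_function_vimage)
          (simp_all add: simple_function_def)
      finally show ?thesis by (simp only: xi_scale)
    qed
    ultimately show "simple_stochastic_integral stoch ?p \<omega> = embed (\<lambda>k. xi k ?p) \<omega>" by simp
  qed
  show "L2_tendsto nat_space (\<lambda>n. simple_stochastic_integral stoch (round_grid n ?f)) (process t) sequentially"
    unfolding L2_tendsto_def s process_def
  proof (rule tendsto_sandwich[OF always_eventually[OF allI] always_eventually[OF allI]])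
    show "0 \<le> (\<integral>\<omega>. (cmod (embed (\<lambda>k. xi k (round_grid n ?f)) \<omega> - embed (\<lambda>k. xi k ?f) \<omega>))\<^sup>2 \<partial>nat_space)" for n by (rule L2_nonneg)
    show "(\<integral>\<omega>. (cmod (embed (\<lambda>k. xi k (round_grid n ?f)) \<omega> - embed (\<lambda>k. xi k ?f) \<omega>))\<^sup>2 \<partial>nat_space) \<le> C * (2 / real (Suc n))\<^sup>2" for n
      by (intro L2_distance bounded_borel_exp_i bounded_borel_simple sf round_grid_error)
    have "(\<lambda>n. C * (2 / real (Suc n))\<^sup>2) \<longlonglongrightarrow> C * 0\<^sup>2" by (intro tendsto_intros round_grid_error_tendsto)
    then show "(\<lambda>n. C * (2 / real (Suc n))\<^sup>2) \<longlonglongrightarrow> 0" by simp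
  qed auto
qed

text \<open>The indicator of a set off the unit interval agrees with 0 where \<open>xi\<close>
  looks, so the stochastic measure of that set vanishes identically.\<close>

lemma hausdorff_process_process: "hausdorff_process nat_space process"
proof -
  have "L2_inner nat_space (stoch A) (stoch B) = xi_bimeasure A B" if "A \<in> sets borel" "B \<in> sets borel" for A B
    unfolding stoch_def xi_bimeasure_eq using that by (intro embed_inner xi_summable bounded_borel_indicator)
  then have ss: "spectral_stochastic_measure nat_space process xi_bimeasure stoch"
    unfolding spectral_stochastic_measure_def
    using stochastic_measure_stoch has_stochastic_integral_process by blast
  have "stoch A \<omega> = 0" if "A \<in> sets borel" "A \<inter> {0..1} = {}" for A \<omega>
  proof -
    have "xi k (indicator A) = xi k (\<lambda>_. 0)" for k
      by (rule xi_cong) (use that in \<open>auto intro: bounded_borel_indicator simp: indicator_def\<close>)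
    then show ?thesis by (simp add: stoch_def embed_def)
  qed
  then have "\<forall>A\<in>sets borel. A \<inter> {0..1} = {} \<longrightarrow> (AE \<omega> in nat_space. stoch A \<omega> = 0)" by simp
  with ss show ?thesis
    unfolding hausdorff_process_def weakly_harmonizable_def
    using second_order_process spectral_bimeasure_xi_bimeasure by blast
qed

end

section \<open>Bernstein polynomials and the moments of one coordinate\<close>

definition moment_map :: "(nat \<Rightarrow> complex) \<Rightarrow> complex poly \<Rightarrow> complex" where
  "moment_map w p = (\<Sum>i\<le>degree p. coeff p i * w i)"

lemma moment_map_eq: "degree p \<le> d \<Longrightarrow> moment_map w p = (\<Sum>i\<le>d. coeff p i * w i)"
  unfolding moment_map_def by (rule sum.mono_neutral_left) (auto simp: coeff_eq_0)

lemma moment_map_add: "moment_map w (p + q) = moment_map w p + moment_map w q"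
proof -
  let ?d = "max (degree p) (degree q)"
  have "degree (p + q) \<le> ?d" by (rule degree_add_le_max)
  then show ?thesis
    using moment_map_eq[of "p + q" ?d] moment_map_eq[of p ?d] moment_map_eq[of q ?d]
    by (simp add: sum.distrib distrib_right)
qed

lemma moment_map_smult: "moment_map w (smult a p) = a * moment_map w p"
  by (subst moment_map_eq[OF degree_smult_le]) (simp add: moment_map_def sum_distrib_left mult.assoc)

lemma moment_map_sum: "moment_map w (\<Sum>i\<in>I. p i) = (\<Sum>i\<in>I. moment_map w (p i))"
  by (induction I rule: infinite_finite_induct) (simp_all add: moment_map_add, simp_all add: moment_map_def)

lemma moment_map_monom: "moment_map w (monom 1 n) = w n"
  by (subst moment_map_eq[OF degree_monom_le]) (simp add: if_distrib[of "\<lambda>x. x * _"] cong: if_cong)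

text \<open>The identity \<open>(m choose n) * (K choose m) = (K choose n) * (K - n choose (m -
  n))\<close> pulls out \<open>x ^ n\<close>, and the remaining sum is the binomial expansion of
  \<open>(x + y) ^ (K - n)\<close> with \<open>x + y = 1\<close>. The expansion is exact, so a
  functional known only on polynomials can be applied to it.\<close>

lemma monom_bernstein:
  assumes n: "n \<le> K"
  shows "(monom 1 n :: complex poly) = (\<Sum>m\<le>K. smult (of_nat (m choose n) / of_nat (K choose n)) (bernstein_poly K m))"
proof -
  let ?x = "[:0, 1:] :: complex poly" and ?y = "[:1, -1:] :: complex poly"
  have one: "?x + ?y = 1" by simp
  have "(\<Sum>m\<le>K. of_nat (m choose n) * bernstein_poly K m) = (\<Sum>m\<in>{n..K}. of_nat (m choose n) * bernstein_poly K m)"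
    by (rule sum.mono_neutral_right) auto
  also have "\<dots> = (\<Sum>m\<in>{n..K}. of_nat (K choose n) * ?x ^ n * (of_nat (K - n choose (m - n)) * ?x ^ (m - n) * ?y ^ (K - m)))"
  proof (rule sum.cong[OF refl])
    fix m assume m: "m \<in> {n..K}"
    have c: "of_nat (m choose n) * (of_nat (K choose m) :: complex poly) = of_nat (K choose n) * of_nat (K - n choose (m - n))"
      using choose_mult[of n m K] m by (simp flip: of_nat_mult add: mult.commute)
    have x: "?x ^ m = ?x ^ n * ?x ^ (m - n)" using m by (simp flip: power_add)
    have "of_nat (m choose n) * bernstein_poly K m = (of_nat (m choose n) * of_nat (K choose m)) * ?x ^ m * ?y ^ (K - m)"
      by (simp only: bernstein_poly_def mult.assoc)
    also have "\<dots> = of_nat (K choose n) * ?x ^ n * (of_nat (K - n choose (m - n)) * ?x ^ (m - n) * ?y ^ (K - m))"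
      unfolding c x by (simp only: mult_ac)
    finally show "of_nat (m choose n) * bernstein_poly K m = of_nat (K choose n) * ?x ^ n * (of_nat (K - n choose (m - n)) * ?x ^ (m - n) * ?y ^ (K - m))" .
  qed
  also have "\<dots> = of_nat (K choose n) * ?x ^ n * (\<Sum>m\<in>{n..K}. of_nat (K - n choose (m - n)) * ?x ^ (m - n) * ?y ^ (K - m))"
    by (simp only: sum_distrib_left)
  also have "(\<Sum>m\<in>{n..K}. of_nat (K - n choose (m - n)) * ?x ^ (m - n) * ?y ^ (K - m))
      = (\<Sum>l\<le>K - n. of_nat (K - n choose l) * ?x ^ l * ?y ^ (K - n - l))"
    by (rule sum.reindex_bij_witness[of _ "\<lambda>l. l + n" "\<lambda>m. m - n"]) (use n in auto)
  also have "\<dots> = (?x + ?y) ^ (K - n)" by (rule binomial_ring[symmetric])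
  finally have eq: "(\<Sum>m\<le>K. of_nat (m choose n) * bernstein_poly K m) = of_nat (K choose n) * ?x ^ n"
    unfolding one by simp
  have nz: "(of_nat (K choose n) :: complex) \<noteq> 0" using n by simp
  have "(\<Sum>m\<le>K. smult (of_nat (m choose n) / of_nat (K choose n)) (bernstein_poly K m))
      = (\<Sum>m\<le>K. [:1 / of_nat (K choose n):] * (of_nat (m choose n) * bernstein_poly K m))"
    by (intro sum.cong refl) (simp add: of_nat_poly)
  also have "\<dots> = [:1 / of_nat (K choose n):] * (of_nat (K choose n) * ?x ^ n)"
    unfolding eq[symmetric] by (simp only: sum_distrib_left)
  also have "\<dots> = ?x ^ n" using nz by (simp add: of_nat_poly)
  also have "\<dots> = monom 1 n" by (simp add: monom_altdef)
  finally show ?thesis ..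
qed

text \<open>The ratio is the product of the factors \<open>(m - i) / (K - i)\<close> for
  \<open>i < n\<close>. Each lies in the unit interval and within \<open>n / (K - n)\<close> of
  \<open>m / K\<close>, and the \<open>n\<close> errors add up.\<close>

lemma choose_ratio_error:
  assumes m: "m \<le> K" and n: "n < K"
  shows "\<bar>real (m choose n) / real (K choose n) - (real m / real K) ^ n\<bar> \<le> real (n * n) / real (K - n)"
proof -
  define z where "z i = real (m - i) / real (K - i)" for i
  \<comment> \<open>With natural subtraction the product formula also holds for
    \<open>r < n\<close>, through the factor at \<open>i = r\<close>.\<close>
  have c: "real (r choose n) = (\<Prod>i<n. real (r - i)) / fact n" for r
  proof (cases "n \<le> r")
    case True
    have "real (r choose n) = (\<Prod>i<n. real r - real i) / fact n"
      unfolding binomial_gbinomial gbinomial_prod_rev by (simp add: atLeast0LessThan)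
    also have "(\<Prod>i<n. real r - real i) = (\<Prod>i<n. real (r - i))"
      using True by (intro prod.cong refl) auto
    finally show ?thesis .
  next
    case False
    then have "(\<Prod>i<n. real (r - i)) = 0" by (intro prod_zero) (auto intro!: bexI[of _ r])
    then show ?thesis using False by (simp add: binomial_eq_0)
  qed
  have ratio: "real (m choose n) / real (K choose n) = (\<Prod>i<n. z i)"
    unfolding c z_def by (simp add: prod_dividef)
  have z01: "0 \<le> z i" "z i \<le> 1" if "i < n" for i
    using that m n by (auto simp: z_def divide_le_eq_1)
  have zi: "\<bar>z i - real m / real K\<bar> \<le> real n / real (K - n)" if i: "i < n" for i
  proof (cases "i \<le> m")
    case True
    have K: "real (K - i) = real K - real i" "real (m - i) = real m - real i" using True m by auto
    have pos: "real K > 0" "real K - real i > 0" using i n by auto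
    have "z i - real m / real K = - (real i * (real K - real m)) / (real K * (real K - real i))"
      unfolding z_def K using pos by (simp add: field_simps)
    then have "\<bar>z i - real m / real K\<bar> = real i * (real K - real m) / (real K * (real K - real i))"
      using pos m by (simp add: abs_mult)
    also have "\<dots> \<le> real i * real K / (real K * (real K - real i))"
      using pos m by (intro divide_right_mono mult_left_mono) auto
    also have "\<dots> = real i / (real K - real i)" using pos by simp
    also have "\<dots> \<le> real n / real (K - n)" using i n by (intro frac_le) auto
    finally show ?thesis .
  next
    case False
    then have "\<bar>z i - real m / real K\<bar> = real m / real K" by (simp add: z_def)
    also have "\<dots> \<le> real n / real (K - n)" using False i n by (intro frac_le) auto
    finally show ?thesis .
  qed
  have "\<bar>(\<Prod>i<n. z i) - (\<Prod>i<n. real m / real K)\<bar> \<le> (\<Sum>i<n. \<bar>z i - real m / real K\<bar>)"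
    using norm_prod_diff[of "{..<n}" z "\<lambda>_. real m / real K"] z01 m n
    by (auto simp: divide_le_eq_1)
  also have "\<dots> \<le> (\<Sum>i<n. real n / real (K - n))" by (intro sum_mono zi) simp
  finally show ?thesis unfolding ratio by simp
qed

lemma coeff_mult_Reals:
  fixes p q :: "complex poly"
  assumes "\<And>i. coeff p i \<in> \<real>" "\<And>i. coeff q i \<in> \<real>"
  shows "coeff (p * q) i \<in> \<real>"
  unfolding coeff_mult by (intro sum_in_Reals Reals_mult assms)

lemma coeff_power_Reals:
  fixes p :: "complex poly"
  assumes "\<And>i. coeff p i \<in> \<real>"
  shows "coeff (p ^ n) i \<in> \<real>"
  by (induction n arbitrary: i) (simp_all add: coeff_mult_Reals assms)

text \<open>Real coefficients let conjugation pass through the polynomial, so that the conjugated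
  slot of the Gram sum contains the conjugate of the same functional.\<close>

lemma coeff_bernstein_poly_Reals: "coeff (bernstein_poly K m) i \<in> \<real>"
  unfolding bernstein_poly_def
  by (intro coeff_mult_Reals coeff_power_Reals)
     (auto simp: of_nat_poly coeff_pCons split: nat.split)

text \<open>Testing with \<open>cnj a\<close> and \<open>a\<close> turns the double Bernstein sum
  into a sum of squared moduli over coordinates; dropping coordinates then only decreases
  it.\<close>

lemma bernstein_square_bound:
  assumes gram: "\<And>n m N. min n m < N \<Longrightarrow> \<mu> n m = (\<Sum>k<N. cnj (w k n) * w k m)"
    and C: "\<And>a b :: nat \<Rightarrow> complex. (\<And>m. m \<le> K \<Longrightarrow> cmod (a m) \<le> 1) \<Longrightarrow> (\<And>m. m \<le> K \<Longrightarrow> cmod (b m) \<le> 1) \<Longrightarrow>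
        cmod (\<Sum>m1\<le>K. \<Sum>m2\<le>K. a m1 * b m2 * bernstein_moment \<mu> K K m1 m2) \<le> C"
    and a: "\<And>m. m \<le> K \<Longrightarrow> cmod (a m) \<le> 1"
  shows "(\<Sum>k<N. (cmod (\<Sum>m\<le>K. a m * moment_map (w k) (bernstein_poly K m)))\<^sup>2) \<le> C"
proof -
  define b where "b = bernstein_poly K"
  \<comment> \<open>At least \<open>N\<close>, and large enough for the finite Gram formula to be
    exact at all degrees of the Bernstein polynomials of order \<open>K\<close>.\<close>
  define M where "M = N + Suc (\<Sum>m\<le>K. degree (b m))"
  define S where "S k = (\<Sum>m\<le>K. a m * moment_map (w k) (b m))" for k
  have real: "cnj (coeff (b m) i) = coeff (b m) i" for m i
    using coeff_bernstein_poly_Reals[of K m i] by (simp add: b_def Reals_cnj_iff)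
  have L: "bernstein_moment \<mu> K K m1 m2 = (\<Sum>k<M. cnj (moment_map (w k) (b m1)) * moment_map (w k) (b m2))"
    if m: "m1 \<le> K" "m2 \<le> K" for m1 m2
  proof -
    have "bernstein_moment \<mu> K K m1 m2
        = (\<Sum>i\<le>degree (b m1). \<Sum>j\<le>degree (b m2). \<Sum>k<M. coeff (b m1) i * coeff (b m2) j * (cnj (w k i) * w k j))"
      unfolding bernstein_moment_def moment_functional_def b_def[symmetric]
    proof (intro sum.cong refl)
      fix i j assume "i \<in> {..degree (b m1)}"
      moreover have "degree (b m1) \<le> (\<Sum>m\<le>K. degree (b m))"
        using m by (intro member_le_sum) auto
      ultimately have "min i j < M" by (auto simp: M_def)
      then show "coeff (b m1) i * coeff (b m2) j * \<mu> i j = (\<Sum>k<M. coeff (b m1) i * coeff (b m2) j * (cnj (w k i) * w k j))"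
        using gram by (simp add: sum_distrib_left)
    qed
    also have "\<dots> = (\<Sum>i\<le>degree (b m1). \<Sum>k<M. \<Sum>j\<le>degree (b m2). coeff (b m1) i * coeff (b m2) j * (cnj (w k i) * w k j))"
      by (intro sum.cong refl sum.swap)
    also have "\<dots> = (\<Sum>k<M. \<Sum>i\<le>degree (b m1). \<Sum>j\<le>degree (b m2). coeff (b m1) i * coeff (b m2) j * (cnj (w k i) * w k j))"
      by (rule sum.swap)
    also have "\<dots> = (\<Sum>k<M. cnj (moment_map (w k) (b m1)) * moment_map (w k) (b m2))"
      unfolding moment_map_def cnj_sum complex_cnj_mult real sum_product
      by (intro sum.cong refl) (simp only: mult_ac)
    finally show ?thesis .
  qed
  have "(\<Sum>m1\<le>K. \<Sum>m2\<le>K. cnj (a m1) * a m2 * bernstein_moment \<mu> K K m1 m2)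
      = (\<Sum>m1\<le>K. \<Sum>m2\<le>K. \<Sum>k<M. cnj (a m1 * moment_map (w k) (b m1)) * (a m2 * moment_map (w k) (b m2)))"
    by (intro sum.cong refl) (simp add: L sum_distrib_left mult_ac)
  also have "\<dots> = (\<Sum>m1\<le>K. \<Sum>k<M. \<Sum>m2\<le>K. cnj (a m1 * moment_map (w k) (b m1)) * (a m2 * moment_map (w k) (b m2)))"
    by (intro sum.cong refl sum.swap)
  also have "\<dots> = (\<Sum>k<M. \<Sum>m1\<le>K. \<Sum>m2\<le>K. cnj (a m1 * moment_map (w k) (b m1)) * (a m2 * moment_map (w k) (b m2)))"
    by (rule sum.swap)
  also have "\<dots> = (\<Sum>k<M. cnj (S k) * S k)"
    by (intro sum.cong refl) (simp add: S_def sum_product)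
  also have "\<dots> = of_real (\<Sum>k<M. (cmod (S k))\<^sup>2)"
    unfolding of_real_sum by (intro sum.cong refl) (metis complex_norm_square mult.commute)
  finally have "cmod (\<Sum>m1\<le>K. \<Sum>m2\<le>K. cnj (a m1) * a m2 * bernstein_moment \<mu> K K m1 m2) = (\<Sum>k<M. (cmod (S k))\<^sup>2)"
    by (simp only: norm_of_real) (simp add: sum_nonneg)
  moreover have "cmod (\<Sum>m1\<le>K. \<Sum>m2\<le>K. cnj (a m1) * a m2 * bernstein_moment \<mu> K K m1 m2) \<le> C"
    by (rule C) (use a in auto)
  moreover have "(\<Sum>k<N. (cmod (S k))\<^sup>2) \<le> (\<Sum>k<M. (cmod (S k))\<^sup>2)"
    by (rule sum_mono2) (auto simp: M_def)
  ultimately show ?thesis by (simp add: S_def b_def)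
qed

text \<open>The moment \<open>w n\<close> is an exact Bernstein sum with weights
  \<open>(m choose n) / (K choose n)\<close>. Replacing these by \<open>(m / K) ^ n\<close> costs at
  most \<open>n * n / (K - n)\<close> times the bounded total mass \<open>D\<close>.\<close>

lemma bernstein_moment_limit:
  assumes D: "\<And>K. (\<Sum>m\<le>K. cmod (moment_map w (bernstein_poly K m))) \<le> D"
  shows "(\<lambda>K. \<Sum>m\<le>K. of_real (real m / real K) ^ n * moment_map w (bernstein_poly K m)) \<longlonglongrightarrow> w n"
proof -
  have D0: "D \<ge> 0" using order_trans[OF sum_nonneg D] by (metis norm_ge_zero)
  define T where "T K = (\<Sum>m\<le>K. of_real (real m / real K) ^ n * moment_map w (bernstein_poly K m))" for K
  have "cmod (T K - w n) \<le> real (n * n) / real (K - n) * D" if K: "K > n" for K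
  proof -
    have "w n = moment_map w (\<Sum>m\<le>K. smult (of_nat (m choose n) / of_nat (K choose n)) (bernstein_poly K m))"
      using monom_bernstein[of n K] K moment_map_monom[of w n] by simp
    also have "\<dots> = (\<Sum>m\<le>K. of_nat (m choose n) / of_nat (K choose n) * moment_map w (bernstein_poly K m))"
      by (simp only: moment_map_sum moment_map_smult)
    finally have "T K - w n = (\<Sum>m\<le>K. (of_real (real m / real K) ^ n - of_nat (m choose n) / of_nat (K choose n)) * moment_map w (bernstein_poly K m))"
      by (simp only: T_def left_diff_distrib sum_subtractf)
    also have "cmod \<dots> \<le> (\<Sum>m\<le>K. real (n * n) / real (K - n) * cmod (moment_map w (bernstein_poly K m)))"
    proof (rule sum_norm_le)
      fix m assume m: "m \<in> {..K}"
      have "complex_of_real (real m / real K) ^ n - of_nat (m choose n) / of_nat (K choose n)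
          = of_real ((real m / real K) ^ n - real (m choose n) / real (K choose n))" by simp
      then have "cmod (of_real (real m / real K) ^ n - of_nat (m choose n) / of_nat (K choose n)) \<le> real (n * n) / real (K - n)"
        using choose_ratio_error[of m K n] m K by (simp only: norm_of_real abs_minus_commute atMost_iff)
      then show "cmod ((of_real (real m / real K) ^ n - of_nat (m choose n) / of_nat (K choose n)) * moment_map w (bernstein_poly K m))
          \<le> real (n * n) / real (K - n) * cmod (moment_map w (bernstein_poly K m))"
        unfolding norm_mult by (rule mult_right_mono) simp
    qed
    also have "\<dots> \<le> real (n * n) / real (K - n) * D"
      unfolding sum_distrib_left[symmetric] by (intro mult_left_mono D) simp
    finally show ?thesis .
  qed
  then have "\<forall>\<^sub>F K in sequentially. cmod (T K - w n) \<le> real (n * n) / real (K - n) * D"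
    unfolding eventually_sequentially by (intro exI[of _ "Suc n"]) auto
  moreover have "(\<lambda>K. real (n * n) / real (K - n) * D) \<longlonglongrightarrow> 0"
  proof -
    have "(\<lambda>K. real (n * n) / real K * D) \<longlonglongrightarrow> 0 * D" by (intro tendsto_mult lim_const_over_n tendsto_const)
    then have "(\<lambda>K. real (n * n) / real (K + n - n) * D) \<longlonglongrightarrow> 0" by simp
    then show ?thesis by (rule LIMSEQ_offset)
  qed
  ultimately have "(\<lambda>K. T K - w n) \<longlonglongrightarrow> 0" by (rule Lim_null_comparison)
  then show ?thesis unfolding T_def by (simp add: LIM_zero_iff)
qed

section \<open>Existence of the process and the equivalence\<close>

theorem hausdorff_process_exists:
  assumes an: "analytic_kernel \<Phi>" and pd: "positive_definite_kernel \<Phi>"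
    and wb: "weakly_bounded (kernel_moment \<Phi>)"
  shows "\<exists>X. hausdorff_process nat_space X \<and> (\<forall>t s. \<Phi> t s = covariance nat_space X t s)"
proof -
  obtain c r where c: "double_power_series \<Phi> c r"
    using an[unfolded analytic_kernel_iff, rule_format, of 0 0] by auto
  have "psd_series c r"
    unfolding psd_series_def using c psd_on_positive_definite_kernel[OF pd] by blast
  from psd_series_factorization[OF this] obtain v where v0: "\<And>p k. p < k \<Longrightarrow> v p k = 0"
    and v: "\<And>p q N. min p q < N \<Longrightarrow> c p q = (\<Sum>k<N. cnj (v p k) * v q k)" by metis
  \<comment> \<open>The factor passes from Taylor coefficients to moments; conjugation in the first
    slot turns \<open>(- \<i>) ^ n\<close> into the required \<open>\<i> ^ n\<close>.\<close>
  define w where "w k n = (- \<i>) ^ n * fact n * v n k" for k n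
  have w0: "w k n = 0" if "n < k" for k n using v0[OF that] by (simp add: w_def)
  have gram: "kernel_moment \<Phi> n m = (\<Sum>k<N. cnj (w k n) * w k m)" if "min n m < N" for n m N
    unfolding kernel_moment_eq[OF c] v[OF that] w_def by (simp add: sum_distrib_left mult_ac)
  obtain C where C: "C > 0"
    and Cb': "\<forall>k1 k2. \<forall>a b :: nat \<Rightarrow> complex.
        (\<forall>m\<le>k1. cmod (a m) \<le> 1) \<longrightarrow> (\<forall>m\<le>k2. cmod (b m) \<le> 1) \<longrightarrow>
        cmod (\<Sum>m1\<le>k1. \<Sum>m2\<le>k2. a m1 * b m2 * bernstein_moment (kernel_moment \<Phi>) k1 k2 m1 m2) \<le> C"
    using wb unfolding weakly_bounded_def by blast
  have Cb: "cmod (\<Sum>m1\<le>k1. \<Sum>m2\<le>k2. a m1 * b m2 * bernstein_moment (kernel_moment \<Phi>) k1 k2 m1 m2) \<le> C"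
    if "\<forall>m\<le>k1. cmod (a m) \<le> 1" "\<forall>m\<le>k2. cmod (b m) \<le> 1" for k1 k2 and a b :: "nat \<Rightarrow> complex"
    by (rule Cb'[THEN spec, of k1, THEN spec, of k2, THEN spec, of a, THEN spec, of b, THEN mp, THEN mp, OF that])
  define b where "b k K m = moment_map (w k) (bernstein_poly K m)" for k K m
  have sq: "(\<Sum>k<N. (cmod (\<Sum>m\<le>K. a m * b k K m))\<^sup>2) \<le> C" if "\<And>m. m \<le> K \<Longrightarrow> cmod (a m) \<le> 1" for a N K
    unfolding b_def by (rule bernstein_square_bound[OF gram]) (use Cb that in auto)
  \<comment> \<open>Phases adapted to coordinate \<open>k\<close> produce its total mass, and the
    square bound is used for this coordinate alone.\<close>
  have D: "(\<Sum>m\<le>K. cmod (b k K m)) \<le> sqrt C" for k K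
  proof (rule real_le_rsqrt)
    define a where "a m = cnj (sgn (b k K m))" for m
    have "a m * b k K m = of_real (cmod (b k K m))" for m
    proof (cases "b k K m = 0")
      case False
      have "cnj (b k K m) * b k K m = of_real ((cmod (b k K m))\<^sup>2)" by (metis complex_norm_square mult.commute)
      then show ?thesis using False by (simp add: a_def sgn_eq power2_eq_square)
    qed simp
    then have "(\<Sum>m\<le>K. cmod (b k K m)) = cmod (\<Sum>m\<le>K. a m * b k K m)"
      by (simp add: sum_nonneg flip: of_real_sum)
    then have "(\<Sum>m\<le>K. cmod (b k K m))\<^sup>2 = (cmod (\<Sum>m\<le>K. a m * b k K m))\<^sup>2" by simp
    also have "\<dots> \<le> (\<Sum>k<Suc k. (cmod (\<Sum>m\<le>K. a m * b k K m))\<^sup>2)" by (simp add: sum_nonneg)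
    also have "\<dots> \<le> C" by (rule sq) (simp add: a_def norm_sgn)
    finally show "(\<Sum>m\<le>K. cmod (b k K m))\<^sup>2 \<le> C" .
  qed
  have lim: "(\<lambda>K. \<Sum>m\<le>K. of_real (real m / real K) ^ n * b k K m) \<longlonglongrightarrow> w k n" for k n
    unfolding b_def by (rule bernstein_moment_limit[OF D[unfolded b_def]])
  define Q where "Q k \<rho> \<beta> \<longleftrightarrow> (\<forall>j<5. prob_on_unit (\<rho> j)) \<and>
     (\<forall>f. continuous_on UNIV f \<longrightarrow>
        (\<lambda>K. \<Sum>m\<le>K. f (real m / real K) * b k K m) \<longlonglongrightarrow> (\<Sum>j<(5::nat). \<beta> j * (\<integral>x. f x \<partial>\<rho> j)))" for k \<rho> \<beta>
  have "\<exists>\<rho> \<beta>. Q k \<rho> \<beta>" for k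
    unfolding Q_def by (rule discrete_riesz[OF D]) (use lim in \<open>auto simp: convergent_def\<close>)
  then obtain \<rho> \<beta> where Q: "\<And>k. Q k (\<rho> k) (\<beta> k)" by metis
  have prob: "prob_on_unit (\<rho> k j)" if "j < 5" for k j using Q[of k] that by (simp add: Q_def)
  have vlim: "(\<lambda>K. \<Sum>m\<le>K. f (real m / real K) * b k K m) \<longlonglongrightarrow> vint \<rho> \<beta> k f"
    if "continuous_on UNIV f" for f k
    using Q[of k, unfolded Q_def, THEN conjunct2, rule_format, OF that] by (simp only: vint_def)
  interpret ell2_measure \<rho> \<beta> C
  proof
    show "prob_on_unit (\<rho> k j)" if "j < 5" for k j by (rule prob[OF that])
    show "C \<ge> 0" using C by simp
    fix g :: "real \<Rightarrow> complex" and B N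
    assume g: "continuous_on UNIV g" and B: "\<And>x. x \<in> {0..1} \<Longrightarrow> cmod (g x) \<le> B"
    have B0: "B \<ge> 0" using order_trans[OF norm_ge_zero B[of 0]] by simp
    have "(\<Sum>k<N. (cmod (\<Sum>m\<le>K. g (real m / real K) * b k K m))\<^sup>2) \<le> C * B\<^sup>2" for K
    proof -
      \<comment> \<open>Scaling to modulus at most 1; for \<open>B = 0\<close> the function vanishes
        at the nodes and the quotient is 0.\<close>
      define a where "a m = g (real m / real K) / of_real B" for m
      have gB: "cmod (g (real m / real K)) \<le> B" if "m \<le> K" for m
        using that by (intro B) (auto simp: divide_le_eq_1)
      have ga: "g (real m / real K) = of_real B * a m" if "m \<le> K" for m
        using gB[OF that] by (cases "B = 0") (auto simp: a_def)
      have "(\<Sum>m\<le>K. g (real m / real K) * b k K m) = of_real B * (\<Sum>m\<le>K. a m * b k K m)" for k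
        unfolding sum_distrib_left by (intro sum.cong refl) (simp add: ga)
      then have "(\<Sum>k<N. (cmod (\<Sum>m\<le>K. g (real m / real K) * b k K m))\<^sup>2)
          = B\<^sup>2 * (\<Sum>k<N. (cmod (\<Sum>m\<le>K. a m * b k K m))\<^sup>2)"
        by (simp only: norm_mult power_mult_distrib sum_distrib_left[symmetric] norm_of_real power2_abs)
      also have "\<dots> \<le> B\<^sup>2 * C"
      proof (rule mult_left_mono[OF sq])
        show "cmod (a m) \<le> 1" if "m \<le> K" for m
          using gB[OF that] B0 by (cases "B = 0") (auto simp: a_def norm_divide divide_le_eq_1)
      qed simp
      finally show ?thesis by (simp add: mult.commute)
    qed
    moreover have "(\<lambda>K. \<Sum>k<N. (cmod (\<Sum>m\<le>K. g (real m / real K) * b k K m))\<^sup>2) \<longlonglongrightarrow> (\<Sum>k<N. (cmod (vint \<rho> \<beta> k g))\<^sup>2)"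
      by (intro tendsto_intros vlim g)
    ultimately show "(\<Sum>k<N. (cmod (vint \<rho> \<beta> k g))\<^sup>2) \<le> C * B\<^sup>2"
      by (intro LIMSEQ_le_const2) auto
  qed
  have xw: "vint \<rho> \<beta> k (\<lambda>u. of_real u ^ n) = w k n" for k n
    by (rule LIMSEQ_unique[OF vlim lim]) (intro continuous_intros)
  have "kernel_moment \<Phi> n m = kernel_moment form.form_kernel n m" for n m
  proof -
    have "kernel_moment form.form_kernel n m = (\<Sum>k. cnj (w k n) * w k m)"
      unfolding form.kernel_moment_form xi_form_def by (simp add: xw)
    \<comment> \<open>Triangularity makes the series finite, with a length for which
      \<open>gram\<close> applies.\<close>
    also have "\<dots> = (\<Sum>k<Suc (min n m). cnj (w k n) * w k m)"
      by (rule suminf_finite) (auto simp: w0 min_def split: if_splits)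
    also have "\<dots> = kernel_moment \<Phi> n m" by (rule gram[symmetric]) simp
    finally show ?thesis ..
  qed
  then have "\<Phi> = form.form_kernel"
    by (intro analytic_kernel_eqI[OF an form.analytic_form_kernel])
  then show ?thesis
    using hausdorff_process_process covariance_process by (intro exI[of _ process]) simp
qed

text \<open>A type cannot be bound by a quantifier, so existence is asserted over the sample type
  \<open>real\<close>, where \<open>nat_space\<close> lives. The second conjunct covers processes
  over an arbitrary type \<open>'w\<close>, including the forward implication for them.\<close>

theorem corollary4p1:
  fixes \<Phi> :: "real \<Rightarrow> real \<Rightarrow> complex"
  shows "((\<exists>(M :: real measure) X. hausdorff_process M X \<and> (\<forall>t s. \<Phi> t s = covariance M X t s)) \<longleftrightarrow>
            analytic_kernel \<Phi> \<and> positive_definite_kernel \<Phi> \<and> weakly_bounded (kernel_moment \<Phi>)) \<and>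
         (\<forall>(M :: 'w measure) X. hausdorff_process M X \<and> (\<forall>t s. \<Phi> t s = covariance M X t s) \<longrightarrow>
            (analytic_kernel \<Phi> \<and> positive_definite_kernel \<Phi> \<and> weakly_bounded (kernel_moment \<Phi>)) \<and>
            (weakly_stationary M X \<longleftrightarrow> hankel (kernel_moment \<Phi>)))"
proof (intro conjI allI impI iffI)
  assume "\<exists>(M :: real measure) X. hausdorff_process M X \<and> (\<forall>t s. \<Phi> t s = covariance M X t s)"
  then obtain M :: "real measure" and X where X: "hausdorff_process M X" and "\<forall>t s. \<Phi> t s = covariance M X t s"
    by blast
  then have "\<Phi> = covariance M X" by (simp add: fun_eq_iff)
  with hausdorff_process_kernel[OF X]
  show "analytic_kernel \<Phi>" "positive_definite_kernel \<Phi>" "weakly_bounded (kernel_moment \<Phi>)" by simp_all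
next
  assume "analytic_kernel \<Phi> \<and> positive_definite_kernel \<Phi> \<and> weakly_bounded (kernel_moment \<Phi>)"
  then show "\<exists>(M :: real measure) X. hausdorff_process M X \<and> (\<forall>t s. \<Phi> t s = covariance M X t s)"
    using hausdorff_process_exists by blast
next
  fix M :: "'w measure" and X
  assume "hausdorff_process M X \<and> (\<forall>t s. \<Phi> t s = covariance M X t s)"
  then have X: "hausdorff_process M X" and "\<Phi> = covariance M X" by (auto simp: fun_eq_iff)
  with hausdorff_process_kernel[OF X]
  show "analytic_kernel \<Phi>" "positive_definite_kernel \<Phi>" "weakly_bounded (kernel_moment \<Phi>)"
    "weakly_stationary M X \<Longrightarrow> hankel (kernel_moment \<Phi>)" "hankel (kernel_moment \<Phi>) \<Longrightarrow> weakly_stationary M X"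
    by simp_all
qed

end
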